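(* Let $n\geq1$ and for $c\in\mathbb{N}$ let $\Psi_{c}=F_{n}/\gamma_{c}(F_{n})$ be the free nilpotent group on $n$ generators ($F_n$ the free group, $\gamma_c$ the $c$-th term of the lower central series, $\gamma_1(F_n)=F_n$). For every $c\in\mathbb{N}$, the natural map $\widehat{IA(\Psi_{c})}\to IA(\hat{\Psi}_{c})$ is an isomorphism.
   Context: $\hat{X}$ denotes profinite completion. $IA(\Psi_{c})=\ker(Aut(\Psi_{c})\to Aut(\Psi_{c}/\Psi_{c}'))$ and $IA(\hat{\Psi}_{c})=\ker(Aut(\hat{\Psi}_{c})\to Aut(\widehat{\Psi_{c}/\Psi_{c}'}))$, where $\Psi_c/\Psi_c'\cong\mathbb{Z}^n$ for $c\geq2$. *)

theory Defs
  imports "HOL-Algebra.Algebra"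
begin

text \<open>Letters are pairs (i, b) with i < n a generator index and b the sign
  (True = x_i, False = x_i inverse).\<close>

fun red_cons :: "nat \<times> bool \<Rightarrow> (nat \<times> bool) list \<Rightarrow> (nat \<times> bool) list" where
  "red_cons x [] = [x]"
| "red_cons x (y # ys) = (if fst x = fst y \<and> snd x \<noteq> snd y then ys else x # y # ys)"

definition reduce :: "(nat \<times> bool) list \<Rightarrow> (nat \<times> bool) list" where
  "reduce ws = foldr red_cons ws []"

definition reduced :: "(nat \<times> bool) list \<Rightarrow> bool" where
  "reduced ws \<longleftrightarrow> (\<forall>i. Suc i < length ws \<longrightarrow>
      \<not> (fst (ws ! i) = fst (ws ! Suc i) \<and> snd (ws ! i) \<noteq> snd (ws ! Suc i)))"

definition free_group :: "nat \<Rightarrow> (nat \<times> bool) list monoid" where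
  "free_group n = \<lparr> carrier = {ws. reduced ws \<and> fst ` set ws \<subseteq> {..<n}},
                    monoid.mult = (\<lambda>xs ys. reduce (xs @ ys)),
                    monoid.one = [] \<rparr>"

primrec lcs_aux :: "('a, 'b) monoid_scheme \<Rightarrow> nat \<Rightarrow> 'a set" where
  "lcs_aux G 0 = carrier G"
| "lcs_aux G (Suc k) = generate G
     {x \<otimes>\<^bsub>G\<^esub> y \<otimes>\<^bsub>G\<^esub> inv\<^bsub>G\<^esub> x \<otimes>\<^bsub>G\<^esub> inv\<^bsub>G\<^esub> y | x y. x \<in> carrier G \<and> y \<in> lcs_aux G k}"

definition lcs :: "('a, 'b) monoid_scheme \<Rightarrow> nat \<Rightarrow> 'a set" where
  "lcs G c = lcs_aux G (c - 1)"   \<comment> \<open>gamma_c(G), gamma_1(G) = G\<close>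

definition Psi :: "nat \<Rightarrow> nat \<Rightarrow> (nat \<times> bool) list set monoid" where
  "Psi n c = free_group n Mod lcs (free_group n) c"

definition IA :: "('a, 'b) monoid_scheme \<Rightarrow> ('a \<Rightarrow> 'a) set" where
  "IA G = {\<phi> \<in> auto G. \<forall>x \<in> carrier G.
            derived G (carrier G) #>\<^bsub>G\<^esub> \<phi> x = derived G (carrier G) #>\<^bsub>G\<^esub> x}"

definition IA_group :: "('a, 'b) monoid_scheme \<Rightarrow> ('a \<Rightarrow> 'a) monoid" where
  "IA_group G = (AutoGroup G) \<lparr> carrier := IA G \<rparr>"

definition FIN :: "('a, 'b) monoid_scheme \<Rightarrow> 'a set set" where
  "FIN G = {N. N \<lhd> G \<and> finite (rcosets\<^bsub>G\<^esub> N)}"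

definition completion :: "('a, 'b) monoid_scheme \<Rightarrow> ('a set \<Rightarrow> 'a set) monoid" where
  "completion G = \<lparr> carrier = {\<xi>. \<xi> \<in> extensional (FIN G)
                        \<and> (\<forall>N \<in> FIN G. \<xi> N \<in> rcosets\<^bsub>G\<^esub> N)
                        \<and> (\<forall>N \<in> FIN G. \<forall>M \<in> FIN G. N \<subseteq> M \<longrightarrow> \<xi> N \<subseteq> \<xi> M)},
                    monoid.mult = (\<lambda>\<xi> \<zeta>. \<lambda>N \<in> FIN G. \<xi> N <#>\<^bsub>G\<^esub> \<zeta> N),
                    monoid.one = (\<lambda>N \<in> FIN G. N) \<rparr>"

definition eta :: "('a, 'b) monoid_scheme \<Rightarrow> 'a \<Rightarrow> ('a set \<Rightarrow> 'a set)" where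
  "eta G x = (\<lambda>N \<in> FIN G. N #>\<^bsub>G\<^esub> x)"

definition open_nbhd :: "('a, 'b) monoid_scheme \<Rightarrow> 'a set \<Rightarrow> ('a set \<Rightarrow> 'a set) set" where
  "open_nbhd G N = {\<xi> \<in> carrier (completion G). \<xi> N = N}"

definition hat_map :: "('a, 'b) monoid_scheme \<Rightarrow> ('c, 'd) monoid_scheme \<Rightarrow> ('a \<Rightarrow> 'c)
                       \<Rightarrow> ('a set \<Rightarrow> 'a set) \<Rightarrow> ('c set \<Rightarrow> 'c set)" where
  "hat_map G H f = (\<lambda>\<xi> \<in> carrier (completion G).
       \<lambda>N \<in> FIN H. N <#>\<^bsub>H\<^esub> (f ` (\<xi> (f -` N \<inter> carrier G))))"

definition cont_aut :: "('a, 'b) monoid_scheme \<Rightarrow> (('a set \<Rightarrow> 'a set) \<Rightarrow> ('a set \<Rightarrow> 'a set)) set" where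
  "cont_aut G = {\<alpha> \<in> auto (completion G).
       \<forall>N \<in> FIN G. \<exists>M \<in> FIN G. \<alpha> ` open_nbhd G M \<subseteq> open_nbhd G N}"

text \<open>Kernel of Aut(hat G) -> Aut(hat(G/G')): alpha induces the identity on
  hat(G/G'), whose finite quotients are the G/N with G' contained in N.\<close>
definition IA_hat :: "('a, 'b) monoid_scheme \<Rightarrow> (('a set \<Rightarrow> 'a set) \<Rightarrow> ('a set \<Rightarrow> 'a set)) set" where
  "IA_hat G = {\<alpha> \<in> cont_aut G. \<forall>\<xi> \<in> carrier (completion G). \<forall>N \<in> FIN G.
                 derived G (carrier G) \<subseteq> N \<longrightarrow> \<alpha> \<xi> N = \<xi> N}"

definition IA_hat_group :: "('a, 'b) monoid_scheme
      \<Rightarrow> (('a set \<Rightarrow> 'a set) \<Rightarrow> ('a set \<Rightarrow> 'a set)) monoid" where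
  "IA_hat_group G = (AutoGroup (completion G)) \<lparr> carrier := IA_hat G \<rparr>"

text \<open>Basic identity neighbourhoods of the congruence (compact-open) topology
  on IA(hat G).\<close>
definition cong_nbhd :: "('a, 'b) monoid_scheme \<Rightarrow> 'a set
      \<Rightarrow> (('a set \<Rightarrow> 'a set) \<Rightarrow> ('a set \<Rightarrow> 'a set)) set" where
  "cong_nbhd G N = {\<alpha> \<in> IA_hat G. \<forall>\<xi> \<in> carrier (completion G). \<alpha> \<xi> N = \<xi> N}"

text \<open>The natural map hat(IA(G)) -> IA(hat G) is the unique continuous homomorphism
  Phi with Phi (eta phi) = hat phi for phi in IA(G) (unique since eta has dense image
  and the target is Hausdorff). "It is an isomorphism" is stated as existence of a
  continuous group isomorphism with this extension property.\<close>
definition natural_map_is_iso :: "('a, 'b) monoid_scheme \<Rightarrow> bool" where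
  "natural_map_is_iso G \<longleftrightarrow>
     (\<exists>\<Phi>. \<Phi> \<in> iso (completion (IA_group G)) (IA_hat_group G)
        \<and> (\<forall>N \<in> FIN G. \<exists>K \<in> FIN (IA_group G).
              \<Phi> ` open_nbhd (IA_group G) K \<subseteq> cong_nbhd G N)
        \<and> (\<forall>\<phi> \<in> IA G. \<Phi> (eta (IA_group G) \<phi>) = hat_map G G \<phi>))"

end

theory Submission
  imports Defs
begin

text \<open>Write \<open>G\<close> for the free nilpotent group, \<open>L\<^sub>i\<close> for its lower central series and \<open>A\<close> for its
  group of IA-automorphisms. For \<open>N\<close> of finite index and stable under \<open>A\<close>, let \<open>C\<^sub>N\<close> be the subgroup of \<open>A\<close> acting
  trivially on \<open>G/N\<close>; it has finite index in \<open>A\<close>.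

  Injectivity amounts to the congruence subgroup property: every \<open>K\<close> of finite index in \<open>A\<close> contains some
  \<open>C\<^sub>N\<close>. By induction on \<open>i\<close> one shows that some \<open>C\<^sub>N\<close> lies in \<open>K A\<^sub>i\<close>, where \<open>A\<^sub>i\<close> acts trivially on \<open>G/L\<^sub>i\<close>.
  Finitely generated nilpotent groups separate \<open>L\<^sub>i\<close> modulo \<open>m\<close>-th powers and \<open>L\<^sub>i\<^sub>+\<^sub>1\<close>, so an element of \<open>A\<^sub>i\<close> that
  is trivial modulo a suitable \<open>N\<close> moves each generator by an \<open>m\<close>-th power of an element of \<open>L\<^sub>i\<close>,
  modulo \<open>L\<^sub>i\<^sub>+\<^sub>1\<close>. By freeness it is an \<open>m\<close>-th power in \<open>A\<^sub>i\<close> modulo \<open>A\<^sub>i\<^sub>+\<^sub>1\<close>, hence lies in \<open>K A\<^sub>i\<^sub>+\<^sub>1\<close> when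
  \<open>m\<close> is the index of \<open>K\<close>.

  Surjectivity holds because, modulo \<open>N\<close>, a continuous IA-automorphism of the completion moves the generators by
  elements of \<open>G'\<close>, so by freeness it agrees modulo \<open>N\<close> with an element of \<open>A\<close>.\<close>

text \<open>One fact carries both halves: an endomorphism trivial modulo \<open>G'\<close> is
  trivial on every factor of the lower central series. It makes such endomorphisms of a nilpotent
  group bijective, so generators may be moved freely by elements of \<open>G'\<close>. It also makes
  displacements multiply under iteration, so roots of automorphisms can be taken one layer at a
  time.

  The obstacle in the induction is that correcting an automorphism by an element of \<open>K\<close>
  may destroy its triviality modulo \<open>N\<close>, on which the extraction of \<open>m\<close>-th
  powers rests. The induction hypothesis is therefore applied not to \<open>K\<close> but to its
  intersection with a congruence subgroup chosen for the next layer. The exponent is the index of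
  \<open>K\<close> because Lagrange's theorem puts every \<open>m\<close>-th power into
  \<open>K\<close>.

  Separation comes from a maximality argument, which reduces it to the finiteness of a finitely
  generated nilpotent group with torsion center. A subgroup of finite index need not be stable under
  IA-automorphisms, so it is replaced by its core throughout.

  Indices start at 0: \<open>lcs_aux G k\<close> is the term usually numbered
  \<open>k + 1\<close>.\<close>

declare lcs_aux.simps(2) [simp del]

section \<open>Cosets and the lower central series\<close>

lemma (in group) inv_mult_cancel [simp]:
  assumes "x \<in> carrier G" "y \<in> carrier G"
  shows "inv x \<otimes> (x \<otimes> y) = y" "x \<otimes> (inv x \<otimes> y) = y"
  using assms by (simp_all flip: m_assoc)

lemma (in group) subgroup_nat_pow_closed:
  "subgroup H G \<Longrightarrow> h \<in> H \<Longrightarrow> h [^] (k::nat) \<in> H"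
  using subgroup_int_pow_closed[of H h "int k"] by (simp add: int_pow_int)

lemmas (in group) group_normalize = m_assoc inv_mult_group

lemma (in normal) rcos_eq_iff:
  assumes "x \<in> carrier G" "y \<in> carrier G"
  shows "H #> x = H #> y \<longleftrightarrow> x \<otimes> inv y \<in> H"
proof
  assume "H #> x = H #> y"
  then have "x \<in> H #> y"
    using rcos_self[OF assms(1) subgroup_axioms] by simp
  then show "x \<otimes> inv y \<in> H"
    using assms rcos_module[OF is_group] by blast
next
  assume "x \<otimes> inv y \<in> H"
  then have "x \<in> H #> y"
    using assms rcos_module[OF is_group] by blast
  then show "H #> x = H #> y"
    using assms(2) repr_independence subgroup_axioms by fastforce
qed

lemma (in normal) rcos_mult_cong:
  assumes "H #> a = H #> a'" "H #> b = H #> b'"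
    "a \<in> carrier G" "a' \<in> carrier G" "b \<in> carrier G" "b' \<in> carrier G"
  shows "H #> (a \<otimes> b) = H #> (a' \<otimes> b')"
  using assms by (simp flip: rcos_sum)

lemma (in normal) rcos_mult_left:
  assumes "h \<in> H" "a \<in> carrier G"
  shows "H #> (h \<otimes> a) = H #> a"
  using assms by (simp add: rcos_eq_iff mem_carrier m_assoc)

lemma (in normal) rcos_eq_self_iff:
  assumes "x \<in> carrier G"
  shows "H #> x = H \<longleftrightarrow> x \<in> H"
  using rcos_eq_iff[of x \<one>] assms by (simp add: subset)

lemma (in normal) rcoset_eq_of_mem:
  assumes "C \<in> rcosets H" "x \<in> C"
  shows "C = H #> x"
  using assms repr_independence[of x H] subgroup_axioms by (auto simp: RCOSETS_def)

text \<open>Commutativity is asked of the values of \<open>h\<close> rather than of the target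
  because \<open>commutator_derived\<close> applies this to a map into a possibly nonabelian
  quotient.\<close>

lemma (in group_hom) derived_subset_kernel:
  assumes "\<And>x y. \<lbrakk>x \<in> carrier G; y \<in> carrier G\<rbrakk> \<Longrightarrow> h x \<otimes>\<^bsub>H\<^esub> h y = h y \<otimes>\<^bsub>H\<^esub> h x"
  shows "derived G (carrier G) \<subseteq> kernel G H h"
  unfolding derived_def
proof (rule G.generate_subgroup_incl[OF _ subgroup_kernel], rule subsetI)
  fix z assume "z \<in> derived_set G (carrier G)"
  then obtain x y where z: "x \<in> carrier G" "y \<in> carrier G" "z = x \<otimes> y \<otimes> inv x \<otimes> inv y"
    by auto
  have "h z = h y \<otimes>\<^bsub>H\<^esub> h x \<otimes>\<^bsub>H\<^esub> inv\<^bsub>H\<^esub> h x \<otimes>\<^bsub>H\<^esub> inv\<^bsub>H\<^esub> h y"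
    using z assms by simp
  then show "z \<in> kernel G H h"
    using z by (simp add: kernel_def H.m_assoc)
qed

lemma (in group) hom_equalizer_subgroup:
  assumes "group H" "f \<in> hom G H" "g \<in> hom G H"
  shows "subgroup {x \<in> carrier G. f x = g x} G"
proof -
  interpret f: group_hom G H f using assms by (simp add: group_hom_def group_hom_axioms_def)
  interpret g: group_hom G H g using assms by (simp add: group_hom_def group_hom_axioms_def)
  have "\<one> \<in> {x \<in> carrier G. f x = g x}" by simp
  then show ?thesis by (intro subgroupI) auto
qed

lemma (in group) hom_eq_on_generate:
  assumes "group H" "f \<in> hom G H" "g \<in> hom G H"
    and "S \<subseteq> carrier G" "\<And>x. x \<in> S \<Longrightarrow> f x = g x" "x \<in> generate G S"
  shows "f x = g x"
proof -
  have "generate G S \<subseteq> {x \<in> carrier G. f x = g x}"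
    using assms(4,5) by (intro generate_subgroup_incl[OF _ hom_equalizer_subgroup[OF assms(1-3)]]) auto
  then show ?thesis using assms(6) by auto
qed

section \<open>Commutator calculus along the lower central series\<close>

context group
begin

definition commutator :: "'a \<Rightarrow> 'a \<Rightarrow> 'a" where
  "commutator x y = x \<otimes> y \<otimes> inv x \<otimes> inv y"

lemma commutator_closed [simp]:
  "x \<in> carrier G \<Longrightarrow> y \<in> carrier G \<Longrightarrow> commutator x y \<in> carrier G"
  by (simp add: commutator_def)

lemma commutator_one [simp]:
  assumes "x \<in> carrier G"
  shows "commutator x \<one> = \<one>" "commutator \<one> x = \<one>"
  using assms by (simp_all add: commutator_def)

lemma lcs_aux_1: "lcs_aux G (Suc 0) = derived G (carrier G)"
proof -
  have "{x \<otimes> y \<otimes> inv x \<otimes> inv y | x y. x \<in> carrier G \<and> y \<in> carrier G} = derived_set G (carrier G)"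
    by blast
  then show ?thesis by (simp add: derived_def lcs_aux.simps)
qed

text \<open>Conjugation distributes over commutators and preserves the previous term, so the
  generating set itself is closed under conjugation.\<close>

lemma lcs_aux_normal: "lcs_aux G k \<lhd> G"
proof (induction k)
  case 0
  then show ?case by (simp add: normal_self)
next
  case (Suc k)
  then interpret N: normal "lcs_aux G k" G .
  show ?case unfolding lcs_aux.simps
  proof (rule normal_generateI)
    show "{x \<otimes> y \<otimes> inv x \<otimes> inv y | x y. x \<in> carrier G \<and> y \<in> lcs_aux G k} \<subseteq> carrier G"
      using N.mem_carrier by auto
  next
    fix h g assume "h \<in> {x \<otimes> y \<otimes> inv x \<otimes> inv y | x y. x \<in> carrier G \<and> y \<in> lcs_aux G k}"
      and g: "g \<in> carrier G"
    then obtain x y where x: "x \<in> carrier G" and y: "y \<in> lcs_aux G k"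
      and h: "h = x \<otimes> y \<otimes> inv x \<otimes> inv y" by blast
    let ?x = "g \<otimes> x \<otimes> inv g" and ?y = "g \<otimes> y \<otimes> inv g"
    have "?x \<in> carrier G" "?y \<in> lcs_aux G k"
      using g x y N.inv_op_closed2 by auto
    moreover have "g \<otimes> h \<otimes> inv g = ?x \<otimes> ?y \<otimes> inv ?x \<otimes> inv ?y"
      using g x y N.mem_carrier by (simp add: h group_normalize)
    ultimately show "g \<otimes> h \<otimes> inv g
        \<in> {x \<otimes> y \<otimes> inv x \<otimes> inv y | x y. x \<in> carrier G \<and> y \<in> lcs_aux G k}"
      by blast
  qed
qed

lemma lcs_aux_subgroup: "subgroup (lcs_aux G k) G"
  by (rule normal_imp_subgroup[OF lcs_aux_normal])

lemma lcs_aux_in_carrier: "x \<in> lcs_aux G k \<Longrightarrow> x \<in> carrier G"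
  by (rule subgroup.mem_carrier[OF lcs_aux_subgroup])

lemma commutator_in_lcs_aux:
  "x \<in> carrier G \<Longrightarrow> y \<in> lcs_aux G k \<Longrightarrow> commutator x y \<in> lcs_aux G (Suc k)"
  unfolding lcs_aux.simps commutator_def by (rule generate.incl) blast

lemma lcs_aux_Suc_subset_iff:
  assumes "subgroup H G"
  shows "lcs_aux G (Suc k) \<subseteq> H \<longleftrightarrow> (\<forall>x\<in>carrier G. \<forall>y\<in>lcs_aux G k. commutator x y \<in> H)"
proof
  assume "\<forall>x\<in>carrier G. \<forall>y\<in>lcs_aux G k. commutator x y \<in> H"
  then show "lcs_aux G (Suc k) \<subseteq> H"
    unfolding lcs_aux.simps by (intro generate_subgroup_incl[OF _ assms]) (auto simp: commutator_def)
qed (use commutator_in_lcs_aux in \<open>auto\<close>)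

lemma lcs_aux_Suc_subset: "lcs_aux G (Suc k) \<subseteq> lcs_aux G k"
proof -
  interpret N: normal "lcs_aux G k" G by (rule lcs_aux_normal)
  show ?thesis
    by (subst lcs_aux_Suc_subset_iff[OF lcs_aux_subgroup])
       (auto simp: commutator_def N.inv_op_closed2)
qed

lemma lcs_aux_antimono: "i \<le> j \<Longrightarrow> lcs_aux G j \<subseteq> lcs_aux G i"
  using lift_Suc_antimono_le[of "lcs_aux G", OF lcs_aux_Suc_subset] .

lemma lcs_aux_central:
  assumes x: "x \<in> carrier G" and y: "y \<in> lcs_aux G k"
  shows "lcs_aux G (Suc k) #> (x \<otimes> y) = lcs_aux G (Suc k) #> (y \<otimes> x)"
proof -
  interpret N: normal "lcs_aux G (Suc k)" G by (rule lcs_aux_normal)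
  have "(x \<otimes> y) \<otimes> inv (y \<otimes> x) = commutator x y"
    using x lcs_aux_in_carrier[OF y] by (simp add: commutator_def group_normalize)
  then show ?thesis
    using x lcs_aux_in_carrier[OF y] commutator_in_lcs_aux[OF x y] by (simp add: N.rcos_eq_iff)
qed

lemma lcs_aux_conj:
  assumes x: "x \<in> carrier G" and y: "y \<in> lcs_aux G k"
  shows "lcs_aux G (Suc k) #> (x \<otimes> y \<otimes> inv x) = lcs_aux G (Suc k) #> y"
proof -
  interpret N: normal "lcs_aux G (Suc k)" G by (rule lcs_aux_normal)
  have "x \<otimes> y \<otimes> inv x \<otimes> inv y = commutator x y"
    by (simp add: commutator_def)
  then show ?thesis
    using x lcs_aux_in_carrier[OF y] commutator_in_lcs_aux[OF x y] by (simp add: N.rcos_eq_iff)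
qed

lemma commutator_mult_left:
  assumes "x \<in> carrier G" "x' \<in> carrier G" "y \<in> carrier G"
  shows "commutator (x \<otimes> x') y = x \<otimes> commutator x' y \<otimes> inv x \<otimes> commutator x y"
  using assms by (simp add: commutator_def group_normalize)

lemma commutator_mult_right:
  assumes "x \<in> carrier G" "y \<in> carrier G" "y' \<in> carrier G"
  shows "commutator x (y \<otimes> y') = commutator x y \<otimes> (y \<otimes> commutator x y' \<otimes> inv y)"
  using assms by (simp add: commutator_def group_normalize)

lemma commutator_inv_left:
  assumes "x \<in> carrier G" "y \<in> carrier G"
  shows "commutator (inv x) y = inv x \<otimes> inv (commutator x y) \<otimes> x"
  using assms by (simp add: commutator_def group_normalize)

lemma commutator_inv_right:
  assumes "x \<in> carrier G" "y \<in> carrier G"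
  shows "commutator x (inv y) = inv y \<otimes> inv (commutator x y) \<otimes> y"
  using assms by (simp add: commutator_def group_normalize)

text \<open>For \<open>y\<close> in the \<open>k\<close>-th term, \<open>x \<mapsto> [x, y]\<close> is a homomorphism modulo the \<open>(k+2)\<close>-nd term with
  commuting values, so it kills the derived subgroup.\<close>
lemma commutator_derived:
  assumes d: "d \<in> derived G (carrier G)" and y: "y \<in> lcs_aux G k"
  shows "commutator d y \<in> lcs_aux G (Suc (Suc k))"
proof -
  let ?N = "lcs_aux G (Suc (Suc k))"
  interpret N: normal ?N G by (rule lcs_aux_normal)
  note yc = lcs_aux_in_carrier[OF y]
  define f where "f x = ?N #> commutator x y" for x
  have comm: "f x <#> f x' = f x' <#> f x" if "x \<in> carrier G" "x' \<in> carrier G" for x x'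
    using that yc y lcs_aux_central[of "commutator x y" "commutator x' y" "Suc k"] commutator_in_lcs_aux
    by (simp add: f_def N.rcos_sum)
  have "f \<in> hom G (G Mod ?N)"
  proof (rule homI)
    fix x x' assume x: "x \<in> carrier G" "x' \<in> carrier G"
    have "f (x \<otimes> x') = (?N #> (x \<otimes> commutator x' y \<otimes> inv x)) <#> f x"
      using x yc by (simp add: f_def commutator_mult_left N.rcos_sum)
    also have "\<dots> = f x' <#> f x"
      using x y lcs_aux_conj[of x "commutator x' y" "Suc k"] commutator_in_lcs_aux
      by (simp add: f_def)
    finally show "f (x \<otimes> x') = f x \<otimes>\<^bsub>G Mod ?N\<^esub> f x'"
      using comm x by simp
  qed (use yc in \<open>auto simp: f_def carrier_FactGroup\<close>)
  then interpret group_hom G "G Mod ?N" f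
    using N.factorgroup_is_group by (simp add: group_hom_def group_hom_axioms_def)
  have "derived G (carrier G) \<subseteq> kernel G (G Mod ?N) f"
    by (rule derived_subset_kernel) (use comm in simp)
  then have "f d = ?N" "d \<in> carrier G" using d by (auto simp: kernel_def)
  then show ?thesis
    using yc by (simp add: f_def N.rcos_eq_self_iff)
qed

text \<open>The class of \<open>commutator x y\<close> modulo the term \<open>k + 2\<close> depends
  only on \<open>x\<close> modulo \<open>G'\<close> and on \<open>y\<close> modulo the term
  \<open>k + 1\<close>. By hypothesis and induction, \<open>\<phi>\<close> changes neither class, so
  it fixes these commutators, which generate the next factor.\<close>

lemma endomorphism_lcs_aux:
  assumes hom: "\<phi> \<in> hom G G"
    and triv: "\<And>x. x \<in> carrier G \<Longrightarrow> derived G (carrier G) #> \<phi> x = derived G (carrier G) #> x"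
    and y: "y \<in> lcs_aux G k"
  shows "lcs_aux G (Suc k) #> \<phi> y = lcs_aux G (Suc k) #> y"
  using y
proof (induction k arbitrary: y)
  case 0
  then show ?case using triv lcs_aux_1 by simp
next
  case (Suc k)
  let ?N = "lcs_aux G (Suc (Suc k))"
  interpret N: normal ?N G by (rule lcs_aux_normal)
  interpret M: normal "lcs_aux G (Suc k)" G by (rule lcs_aux_normal)
  interpret D: normal "derived G (carrier G)" G using lcs_aux_normal[of "Suc 0"] lcs_aux_1 by simp
  interpret \<phi>: group_hom G G \<phi> using hom by (simp add: group_hom_def group_hom_axioms_def)
  let ?K = "{y \<in> carrier G. ?N #> \<phi> y = ?N #> y}"
  have "(\<lambda>y. ?N #> \<phi> y) \<in> hom G (G Mod ?N)"
    using Group.hom_compose[OF hom N.r_coset_hom_Mod] by (simp add: comp_def)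
  then have "subgroup ?K G"
    using hom_equalizer_subgroup[OF N.factorgroup_is_group _ N.r_coset_hom_Mod] by blast
  moreover have "commutator x y \<in> ?K" if x: "x \<in> carrier G" and y: "y \<in> lcs_aux G k" for x y
  proof -
    note yc = lcs_aux_in_carrier[OF y]
    define d where "d = \<phi> x \<otimes> inv x"
    define u where "u = \<phi> y \<otimes> inv y"
    have d: "d \<in> derived G (carrier G)" and dx: "\<phi> x = d \<otimes> x" and dc: "d \<in> carrier G"
      using x triv[OF x] by (auto simp: d_def D.rcos_eq_iff m_assoc)
    have u: "u \<in> lcs_aux G (Suc k)" and uy: "\<phi> y = u \<otimes> y" and uc: "u \<in> carrier G"
      using yc Suc.IH[OF y] by (auto simp: u_def M.rcos_eq_iff m_assoc)
    have "commutator (d \<otimes> x) u \<in> ?N"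
      using commutator_in_lcs_aux u x dc by auto
    then have "?N #> (commutator (d \<otimes> x) u \<otimes> (u \<otimes> commutator (d \<otimes> x) y \<otimes> inv u))
        = ?N #> (u \<otimes> commutator (d \<otimes> x) y \<otimes> inv u)"
      using x yc dc uc by (simp add: N.rcos_mult_left)
    also have "\<dots> = ?N #> commutator (d \<otimes> x) y"
      using x dc uc y commutator_in_lcs_aux by (intro lcs_aux_conj) auto
    \<comment> \<open>Replacing \<open>d \<otimes> x\<close> by \<open>x\<close> costs the factor
      \<open>commutator d y\<close>. For a general \<open>d\<close> it would only lie in the term
      \<open>k + 1\<close>; since \<open>d\<close> is in the derived subgroup, it lies one step
      deeper and vanishes modulo \<open>?N\<close>.\<close>
    also have "\<dots> = (?N #> (d \<otimes> commutator x y \<otimes> inv d)) <#> (?N #> commutator d y)"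
      using x dc yc by (simp add: commutator_mult_left N.rcos_sum)
    also have "\<dots> = (?N #> commutator x y) <#> (?N #> \<one>)"
      using lcs_aux_conj[OF dc, of "commutator x y" "Suc k"] commutator_in_lcs_aux[OF x y]
        commutator_derived[OF d y] N.rcos_eq_self_iff[of "commutator d y"] dc yc
      by (simp add: N.subset)
    also have "\<dots> = ?N #> commutator x y"
      using x yc by (subst N.rcos_sum) auto
    finally have "?N #> commutator (d \<otimes> x) (u \<otimes> y) = ?N #> commutator x y"
      using x yc dc uc by (simp add: commutator_mult_right)
    moreover have "\<phi> (commutator x y) = commutator (\<phi> x) (\<phi> y)"
      using x yc by (simp add: commutator_def)
    ultimately show ?thesis
      using x yc dx uy by simp
  qed
  ultimately have "lcs_aux G (Suc k) \<subseteq> ?K"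
    using lcs_aux_Suc_subset_iff by blast
  then show ?case using Suc.prems by auto
qed

text \<open>On the term \<open>k\<close>, \<open>\<phi>\<close> moves elements by factors in the
  term \<open>k + 1\<close>. A kernel element is its own displacement up to inversion, so it sinks
  through the whole series. Surjectivity rises from the trivial term: if the displacement of
  \<open>y\<close> has a preimage \<open>v\<close>, then \<open>inv v \<otimes> y\<close> is a
  preimage of \<open>y\<close>.\<close>

lemma endomorphism_bij_of_nilpotent:
  assumes nilp: "lcs_aux G c = {\<one>}"
    and hom: "\<phi> \<in> hom G G"
    and triv: "\<And>x. x \<in> carrier G \<Longrightarrow> derived G (carrier G) #> \<phi> x = derived G (carrier G) #> x"
  shows "bij_betw \<phi> (carrier G) (carrier G)"
proof -
  interpret \<phi>: group_hom G G \<phi> using hom by (simp add: group_hom_def group_hom_axioms_def)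
  have step: "\<phi> y \<otimes> inv y \<in> lcs_aux G (Suc k)" if "y \<in> lcs_aux G k" for y k
    using normal.rcos_eq_iff[OF lcs_aux_normal] endomorphism_lcs_aux[OF hom triv that]
      lcs_aux_in_carrier[OF that] by auto
  have "y \<in> lcs_aux G k" if "y \<in> carrier G" "\<phi> y = \<one>" for y k
  proof (induction k)
    case (Suc k)
    then have "inv y \<in> lcs_aux G (Suc k)" using step[OF Suc] that by simp
    then show ?case using that lcs_aux_subgroup subgroup.m_inv_closed inv_inv by metis
  qed (use that in simp)
  then have "y = \<one>" if "y \<in> carrier G" "\<phi> y = \<one>" for y
    using that nilp by blast
  then have "inj_on \<phi> (carrier G)"
    by (simp add: \<phi>.inj_on_one_iff)
  \<comment> \<open>The index \<open>j\<close> counts upwards from the trivial term; once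
    \<open>j \<ge> c\<close>, truncated subtraction keeps the term at the whole group.\<close>
  moreover have "lcs_aux G (c - j) \<subseteq> \<phi> ` carrier G" for j
  proof (induction j)
    case 0
    then show ?case using nilp \<phi>.hom_one by (force simp: image_iff)
  next
    case (Suc j)
    show ?case
    proof (cases "j < c")
      case True
      then have eq: "c - j = Suc (c - Suc j)" by simp
      show ?thesis
      proof
        fix y assume y: "y \<in> lcs_aux G (c - Suc j)"
        note yc = lcs_aux_in_carrier[OF y]
        have "\<phi> y \<otimes> inv y \<in> \<phi> ` carrier G"
          using step[OF y] Suc.IH unfolding eq by blast
        then obtain v where v: "v \<in> carrier G" "\<phi> v = \<phi> y \<otimes> inv y"
          by force
        then have "\<phi> (inv v \<otimes> y) = y"
          using yc by (simp add: group_normalize)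
        then show "y \<in> \<phi> ` carrier G" using v yc by (metis imageI inv_closed m_closed)
      qed
    qed (use Suc in auto)
  qed
  from this[of c] have "\<phi> ` carrier G = carrier G" by auto
  ultimately show ?thesis by (simp add: bij_betw_def)
qed

end

lemma (in group_hom) lcs_aux_image_subset: "h ` lcs_aux G k \<subseteq> lcs_aux H k"
proof (induction k)
  case (Suc k)
  let ?C = "{x \<otimes> y \<otimes> inv x \<otimes> inv y | x y. x \<in> carrier G \<and> y \<in> lcs_aux G k}"
  have "?C \<subseteq> carrier G" using G.lcs_aux_in_carrier by auto
  then have "h ` lcs_aux G (Suc k) = generate H (h ` ?C)"
    by (simp add: lcs_aux.simps generate_img)
  also have "\<dots> \<subseteq> lcs_aux H (Suc k)"
  proof (rule H.generate_subgroup_incl[OF _ H.lcs_aux_subgroup], rule subsetI)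
    fix z assume "z \<in> h ` ?C"
    then obtain x y where xy: "x \<in> carrier G" "y \<in> lcs_aux G k"
      and "z = h (x \<otimes> y \<otimes> inv x \<otimes> inv y)" by blast
    then have "z = H.commutator (h x) (h y)"
      using G.lcs_aux_in_carrier[OF xy(2)] by (simp add: H.commutator_def)
    then show "z \<in> lcs_aux H (Suc k)"
      using H.commutator_in_lcs_aux[of "h x" "h y" k] xy Suc by auto
  qed
  finally show ?case .
qed auto

lemma (in group_hom) lcs_aux_image:
  assumes "h ` carrier G = carrier H"
  shows "lcs_aux H k = h ` lcs_aux G k"
proof (induction k)
  case 0
  then show ?case using assms by simp
next
  case (Suc k)
  have "subgroup (h ` lcs_aux G (Suc k)) H"
    using subgroup_img_is_subgroup[OF G.lcs_aux_subgroup] .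
  moreover have "H.commutator x y \<in> h ` lcs_aux G (Suc k)"
    if xH: "x \<in> carrier H" and yH: "y \<in> lcs_aux H k" for x y
  proof -
    obtain x' where x: "x' \<in> carrier G" "x = h x'"
      using xH unfolding assms[symmetric] by blast
    moreover obtain y' where "y' \<in> lcs_aux G k" "y = h y'"
      using yH unfolding Suc by blast
    ultimately have xy: "x' \<in> carrier G" "y' \<in> lcs_aux G k" "x = h x'" "y = h y'"
      by auto
    then have "H.commutator x y = h (G.commutator x' y')"
      using G.lcs_aux_in_carrier[OF xy(2)] by (simp add: H.commutator_def G.commutator_def)
    then show ?thesis using xy G.commutator_in_lcs_aux by auto
  qed
  ultimately have "lcs_aux H (Suc k) \<subseteq> h ` lcs_aux G (Suc k)"
    by (simp add: H.lcs_aux_Suc_subset_iff)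
  then show ?case using lcs_aux_image_subset by blast
qed

lemma (in normal) rcos_group_hom: "group_hom G (G Mod H) (\<lambda>x. H #> x)"
  using factorgroup_is_group r_coset_hom_Mod by (simp add: group_hom_def group_hom_axioms_def)

section \<open>Finiteness of finitely generated nilpotent groups with torsion center\<close>

context group
begin

text \<open>The term \<open>k\<close> is central modulo the term \<open>k + 1\<close>, so
  conjugation changes an element of \<open>H\<close> only by a factor in
  \<open>lcs_aux G (Suc k)\<close>, which is already inside \<open>H\<close>.\<close>

lemma normal_between_lcs_aux:
  assumes "subgroup H G" "lcs_aux G (Suc k) \<subseteq> H" "H \<subseteq> lcs_aux G k"
  shows "H \<lhd> G"
proof (rule normal_invI[OF assms(1)])
  interpret H: subgroup H G by fact
  fix g h assume g: "g \<in> carrier G" and h: "h \<in> H"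
  have "commutator g h \<in> H"
    using commutator_in_lcs_aux[OF g] h assms by blast
  then have "commutator g h \<otimes> h \<in> H" using h by blast
  then show "g \<otimes> h \<otimes> inv g \<in> H"
    using g h H.mem_carrier by (simp add: commutator_def group_normalize)
qed

text \<open>Modulo the term \<open>k + 2\<close>, the commutator is bilinear on \<open>G\<close> and
  the term \<open>k\<close>. Hence commutators of the generators of \<open>G\<close> with generators
  of one factor generate the next factor.\<close>

lemma lcs_aux_finitely_generated_mod:
  assumes S: "finite S" "S \<subseteq> carrier G" "generate G S = carrier G"
  shows "\<exists>T. finite T \<and> T \<subseteq> lcs_aux G k \<and> generate G (T \<union> lcs_aux G (Suc k)) = lcs_aux G k"
proof (induction k)
  case 0
  have "generate G (S \<union> lcs_aux G (Suc 0)) = carrier G"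
    using mono_generate[of S "S \<union> lcs_aux G (Suc 0)"] S lcs_aux_in_carrier
    by (intro antisym generate_incl) auto
  then show ?case using S by auto
next
  case (Suc k)
  then obtain T where T: "finite T" "T \<subseteq> lcs_aux G k"
    and genT: "generate G (T \<union> lcs_aux G (Suc k)) = lcs_aux G k" by blast
  let ?T = "(\<lambda>(x, t). commutator x t) ` (S \<times> T)"
  let ?H = "generate G (?T \<union> lcs_aux G (Suc (Suc k)))"
  have T'L: "?T \<subseteq> lcs_aux G (Suc k)"
    using T(2) S(2) by (auto intro!: commutator_in_lcs_aux)
  have sub: "?T \<union> lcs_aux G (Suc (Suc k)) \<subseteq> lcs_aux G (Suc k)"
    using T'L lcs_aux_Suc_subset by blast
  then have HL: "?H \<subseteq> lcs_aux G (Suc k)"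
    by (rule generate_subgroup_incl[OF _ lcs_aux_subgroup])
  have Hsub: "subgroup ?H G"
    using sub lcs_aux_in_carrier by (intro generate_is_subgroup) blast
  have incl: "?T \<union> lcs_aux G (Suc (Suc k)) \<subseteq> ?H"
    using generate.incl by (rule subsetI)
  then have "?H \<lhd> G"
    using normal_between_lcs_aux[OF Hsub _ HL] by blast
  then interpret H: normal ?H G .
  \<comment> \<open>Bilinearity is used through the normality of \<open>?H\<close>: it absorbs the
    conjugating factors in the product and inverse rules, so with one entry fixed the elements whose
    commutator lies in \<open>?H\<close> form a subgroup. The second entry is extended first, then
    the first one.\<close>
  have HS: "commutator x y \<in> ?H" if x: "x \<in> S" and y: "y \<in> lcs_aux G k" for x y
  proof -
    let ?M = "{y \<in> lcs_aux G k. commutator x y \<in> ?H}"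
    have xc: "x \<in> carrier G" using x S by blast
    have "subgroup ?M G"
    proof (rule subgroupI)
      show "?M \<subseteq> carrier G" using lcs_aux_in_carrier by blast
      have "\<one> \<in> ?M" using xc subgroup.one_closed[OF lcs_aux_subgroup] by simp
      then show "?M \<noteq> {}" by blast
    next
      fix a assume a: "a \<in> ?M"
      then have ac: "a \<in> carrier G" using lcs_aux_in_carrier by blast
      have "inv a \<otimes> inv (commutator x a) \<otimes> a \<in> ?H"
        using a ac by (auto intro: H.inv_op_closed1)
      then show "inv a \<in> ?M"
        using a ac xc subgroup.m_inv_closed[OF lcs_aux_subgroup] by (simp add: commutator_inv_right)
    next
      fix a b assume a: "a \<in> ?M" and b: "b \<in> ?M"
      then have ac: "a \<in> carrier G" "b \<in> carrier G" using lcs_aux_in_carrier by blast+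
      have "commutator x a \<otimes> (a \<otimes> commutator x b \<otimes> inv a) \<in> ?H"
        using a b ac by (auto intro!: H.inv_op_closed2)
      then show "a \<otimes> b \<in> ?M"
        using a b ac xc subgroup.m_closed[OF lcs_aux_subgroup] by (simp add: commutator_mult_right)
    qed
    moreover have "T \<union> lcs_aux G (Suc k) \<subseteq> ?M"
    proof -
      have "commutator x y \<in> ?H" if "y \<in> T" for y
        using that x incl by blast
      moreover have "commutator x y \<in> ?H" if "y \<in> lcs_aux G (Suc k)" for y
        using commutator_in_lcs_aux[OF xc that] incl by blast
      ultimately show ?thesis using T lcs_aux_Suc_subset by blast
    qed
    ultimately have "lcs_aux G k \<subseteq> ?M"
      using generate_subgroup_incl genT by metis
    then show ?thesis using y by blast
  qed
  have "commutator x y \<in> ?H" if x: "x \<in> carrier G" and y: "y \<in> lcs_aux G k" for x y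
  proof -
    let ?M = "{x \<in> carrier G. commutator x y \<in> ?H}"
    have yc: "y \<in> carrier G" using y lcs_aux_in_carrier by blast
    have "subgroup ?M G"
    proof (rule subgroupI)
      have "\<one> \<in> ?M" using yc by simp
      then show "?M \<noteq> {}" by blast
    next
      fix a assume a: "a \<in> ?M"
      have "inv a \<otimes> inv (commutator a y) \<otimes> a \<in> ?H"
        using a by (auto intro: H.inv_op_closed1)
      then show "inv a \<in> ?M"
        using a yc by (simp add: commutator_inv_left)
    next
      fix a b assume a: "a \<in> ?M" and b: "b \<in> ?M"
      have "a \<otimes> commutator b y \<otimes> inv a \<otimes> commutator a y \<in> ?H"
        using a b by (intro H.m_closed H.inv_op_closed2) auto
      then show "a \<otimes> b \<in> ?M"
        using a b yc by (simp add: commutator_mult_left)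
    qed blast
    moreover have "S \<subseteq> ?M" using HS y S by blast
    ultimately have "carrier G \<subseteq> ?M"
      using generate_subgroup_incl S(3) by metis
    then show ?thesis using x by blast
  qed
  then have "lcs_aux G (Suc k) \<subseteq> ?H"
    by (simp add: lcs_aux_Suc_subset_iff[OF Hsub])
  then have "?H = lcs_aux G (Suc k)" using HL by blast
  moreover have "finite ?T" using T S by blast
  ultimately show ?case using T'L by blast
qed

lemma finite_generate_torsion:
  assumes "t \<in> carrier G" "t [^] (r::nat) = \<one>" "r > 0"
  shows "finite (generate G {t})"
proof -
  have "ord t dvd r" using assms pow_eq_id by blast
  then have "card (generate G {t}) > 0"
    using assms generate_pow_card[of t] by (metis dvd_0_left_iff gr0I nat_less_le)
  then show ?thesis by (rule card_ge_0_finite)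
qed

text \<open>Pigeonhole: two powers of \<open>y\<close> have the same commutator with
  \<open>x\<close>, and their quotient then commutes with \<open>x\<close>.\<close>

lemma commutes_with_power:
  assumes F: "finite F" and x: "x \<in> carrier G" and y: "y \<in> carrier G"
    and comm: "\<And>j::nat. commutator x (y [^] j) \<in> F"
  shows "\<exists>d::nat. d > 0 \<and> y [^] d \<otimes> x = x \<otimes> y [^] d"
proof -
  have "\<not> inj (\<lambda>j::nat. commutator x (y [^] j))"
    using finite_subset[OF _ F] comm finite_imageD[of "\<lambda>j::nat. commutator x (y [^] j)" UNIV]
    by (metis image_subset_iff infinite_UNIV_nat)
  then obtain i j :: nat where ij: "i < j" "commutator x (y [^] i) = commutator x (y [^] j)"
    unfolding inj_def by (metis nat_neq_iff)
  define d where "d = j - i"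
  have j: "y [^] j = y [^] i \<otimes> y [^] d"
    using ij y by (simp add: d_def nat_pow_mult)
  let ?a = "y [^] i" and ?b = "y [^] d"
  have c: "?a \<in> carrier G" "?b \<in> carrier G" using y by auto
  have "inv x \<otimes> commutator x ?a \<otimes> ?a = inv x \<otimes> commutator x (?a \<otimes> ?b) \<otimes> ?a"
    using ij j by simp
  then have "?a \<otimes> inv x = ?a \<otimes> (?b \<otimes> inv x \<otimes> inv ?b)"
    using c x by (simp add: commutator_def group_normalize)
  then have "inv x = ?b \<otimes> inv x \<otimes> inv ?b"
    using c x by simp
  then have "x \<otimes> (inv x \<otimes> ?b) \<otimes> x = x \<otimes> ((?b \<otimes> inv x \<otimes> inv ?b) \<otimes> ?b) \<otimes> x"
    by simp
  then have "?b \<otimes> x = x \<otimes> ?b"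
    using c x by (simp add: group_normalize)
  then show ?thesis using ij(1) by (intro exI[of _ d]) (simp add: d_def)
qed

lemma generate_commutes:
  assumes "S \<subseteq> carrier G" "z \<in> carrier G" "\<And>x. x \<in> S \<Longrightarrow> z \<otimes> x = x \<otimes> z" "x \<in> generate G S"
  shows "z \<otimes> x = x \<otimes> z"
proof -
  let ?M = "{x \<in> carrier G. z \<otimes> x = x \<otimes> z}"
  have "subgroup ?M G"
  proof (rule subgroupI)
    have "\<one> \<in> ?M" using assms by simp
    then show "?M \<noteq> {}" by blast
  next
    fix a assume a: "a \<in> ?M"
    then have ac: "a \<in> carrier G" by simp
    have "inv a \<otimes> (z \<otimes> a) \<otimes> inv a = inv a \<otimes> (a \<otimes> z) \<otimes> inv a" using a by simp
    then have "inv a \<otimes> z = z \<otimes> inv a" using ac assms(2) by (simp add: group_normalize)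
    then show "inv a \<in> ?M" using ac by simp
  next
    fix a b assume ab: "a \<in> ?M" "b \<in> ?M"
    then have "z \<otimes> (a \<otimes> b) = a \<otimes> z \<otimes> b" using assms by (simp flip: m_assoc)
    also have "\<dots> = a \<otimes> b \<otimes> z" using ab assms by (simp add: m_assoc)
    finally show "a \<otimes> b \<in> ?M" using ab by simp
  qed blast
  then show ?thesis using generate_subgroup_incl[of S ?M] assms by auto
qed

text \<open>Finiteness climbs the series from the trivial term. If the term \<open>k + 1\<close> is
  finite, each \<open>y\<close> in the term \<open>k\<close> has a power commuting with all
  generators, by pigeonhole on commutators. That power is central, hence torsion, and so
  \<open>y\<close> is torsion. The term \<open>k\<close> is thus obtained from a finite one by
  adjoining finitely many torsion elements.\<close>

lemma finite_of_nilpotent_torsion_center: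
  assumes S: "finite S" "S \<subseteq> carrier G" "generate G S = carrier G"
    and nilp: "lcs_aux G c = {\<one>}"
    and torsion: "\<And>z. \<lbrakk>z \<in> carrier G; \<And>x. x \<in> carrier G \<Longrightarrow> z \<otimes> x = x \<otimes> z\<rbrakk>
                   \<Longrightarrow> \<exists>r::nat. r > 0 \<and> z [^] r = \<one>"
  shows "finite (carrier G)"
proof -
  have step: "finite (lcs_aux G k)" if fin: "finite (lcs_aux G (Suc k))" for k
  proof -
    have tor: "\<exists>r::nat. r > 0 \<and> y [^] r = \<one>" if y: "y \<in> lcs_aux G k" for y
    proof -
      note yc = lcs_aux_in_carrier[OF y]
      have pow: "y [^] j \<in> lcs_aux G k" for j :: nat
        using subgroup_nat_pow_closed[OF lcs_aux_subgroup y] .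
      have "\<exists>d::nat. d > 0 \<and> y [^] d \<otimes> x = x \<otimes> y [^] d" if "x \<in> S" for x
        using that S yc pow by (intro commutes_with_power[OF fin]) (auto intro: commutator_in_lcs_aux)
      then obtain d :: "'a \<Rightarrow> nat" where d: "\<And>x. x \<in> S \<Longrightarrow> d x > 0 \<and> y [^] d x \<otimes> x = x \<otimes> y [^] d x"
        by metis
      \<comment> \<open>The product is a common multiple of the exponents belonging to the single
        generators, so this one power of \<open>y\<close> commutes with all of them.\<close>
      let ?D = "\<Prod>x\<in>S. d x"
      have "y [^] ?D \<otimes> x = x \<otimes> y [^] ?D" if x: "x \<in> S" for x
      proof -
        have "?D = d x * (\<Prod>x\<in>S - {x}. d x)"
          using S(1) x by (simp add: prod.remove)
        then have "y [^] ?D = (y [^] d x) [^] (\<Prod>x\<in>S - {x}. d x)"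
          using yc by (simp add: nat_pow_pow)
        then show ?thesis
          using group_commutes_pow[of "y [^] d x" x] d[OF x] yc x S by auto
      qed
      then have "y [^] ?D \<otimes> x = x \<otimes> y [^] ?D" if "x \<in> carrier G" for x
        using generate_commutes[of S "y [^] ?D" x] S yc that by auto
      then obtain r :: nat where "r > 0" "(y [^] ?D) [^] r = \<one>"
        using torsion[of "y [^] ?D"] yc by auto
      moreover have "?D > 0" using S d by (simp add: prod_pos)
      ultimately show ?thesis
        using yc by (intro exI[of _ "?D * r"]) (simp add: nat_pow_pow)
    qed
    have "finite (generate G (T \<union> lcs_aux G (Suc k)))" if "finite T" "T \<subseteq> lcs_aux G k" for T
      using that
    proof (induction T rule: finite_induct)
      case empty
      have "generate G (lcs_aux G (Suc k)) \<subseteq> lcs_aux G (Suc k)"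
        by (rule generate_subgroup_incl[OF _ lcs_aux_subgroup]) simp
      then show ?case using fin finite_subset by auto
    next
      case (insert t T)
      let ?H = "generate G (T \<union> lcs_aux G (Suc k))"
      have t: "t \<in> lcs_aux G k" "t \<in> carrier G" using insert.prems lcs_aux_in_carrier by auto
      have sub: "T \<union> lcs_aux G (Suc k) \<subseteq> lcs_aux G k"
        using insert.prems lcs_aux_Suc_subset by blast
      have Hsub: "subgroup ?H G"
        using sub lcs_aux_in_carrier by (intro generate_is_subgroup) blast
      have incl: "T \<union> lcs_aux G (Suc k) \<subseteq> ?H"
        using generate.incl by (rule subsetI)
      \<comment> \<open>Every intermediate group lies between two consecutive terms and is therefore
        normal; its product with the finite cyclic group of \<open>t\<close> is a finite
        subgroup.\<close>
      have norm: "?H \<lhd> G"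
        using normal_between_lcs_aux[OF Hsub] generate_subgroup_incl[OF sub lcs_aux_subgroup] incl by blast
      have ct: "subgroup (generate G {t}) G" using t by (simp add: generate_is_subgroup)
      obtain r :: nat where "r > 0" "t [^] r = \<one>" using tor t by blast
      then have "finite (generate G {t})" using finite_generate_torsion t by blast
      then have fin': "finite (?H <#> generate G {t})"
        using insert by (auto simp: set_mult_def)
      have sg: "subgroup (?H <#> generate G {t}) G"
        using mult_norm_subgroup[OF norm ct] .
      have "h \<in> ?H <#> generate G {t}" if "h \<in> ?H" for h
      proof -
        have "h \<otimes> \<one> \<in> ?H <#> generate G {t}"
          unfolding set_mult_def using that generate.one by blast
        then show ?thesis using that Hsub subgroup.mem_carrier by fastforce
      qed
      moreover have "\<one> \<otimes> t \<in> ?H <#> generate G {t}"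
        unfolding set_mult_def using generate.one generate.incl[of t "{t}" G] by blast
      ultimately have "insert t T \<union> lcs_aux G (Suc k) \<subseteq> ?H <#> generate G {t}"
        using incl t by auto
      from generate_subgroup_incl[OF this sg] show ?case
        using fin' finite_subset by blast
    qed
    then show ?thesis
      using lcs_aux_finitely_generated_mod[OF S, of k] by metis
  qed
  have "finite (lcs_aux G (c - j))" for j
  proof (induction j)
    case (Suc j)
    show ?case
    proof (cases "j < c")
      case True
      then have "Suc (c - Suc j) = c - j" by simp
      then show ?thesis using step Suc by metis
    qed (use Suc in auto)
  qed (use nilp in simp)
  from this[of c] show ?thesis by simp
qed

end

section \<open>Subgroups of finite index\<close>

lemma finite_image_factor:
  assumes "finite (f ` A)" and "\<And>x y. \<lbrakk>x \<in> A; y \<in> A; f x = f y\<rbrakk> \<Longrightarrow> g x = g y"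
  shows "finite (g ` A)"
proof -
  have "g x = g (SOME z. z \<in> A \<and> f z = f x)" if "x \<in> A" for x
    using assms(2)[OF that] someI[of "\<lambda>z. z \<in> A \<and> f z = f x" x] that by metis
  then have "g ` A \<subseteq> (\<lambda>v. g (SOME z. z \<in> A \<and> f z = v)) ` f ` A"
    by blast
  then show ?thesis using assms(1) finite_subset by blast
qed

lemma (in group) FIN_I:
  assumes N: "N \<lhd> G" and F: "finite F" "\<And>x. x \<in> carrier G \<Longrightarrow> f x \<in> F"
    and eq: "\<And>x y. \<lbrakk>x \<in> carrier G; y \<in> carrier G; f x = f y\<rbrakk> \<Longrightarrow> x \<otimes> inv y \<in> N"
  shows "N \<in> FIN G"
proof -
  have "finite (f ` carrier G)"
    using F finite_subset[of "f ` carrier G" F] by blast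
  then have "finite ((\<lambda>x. N #> x) ` carrier G)"
    by (rule finite_image_factor) (use eq normal.rcos_eq_iff[OF N] in auto)
  moreover have "rcosets N = (\<lambda>x. N #> x) ` carrier G"
    by (auto simp: RCOSETS_def)
  ultimately show ?thesis using N by (simp add: FIN_def)
qed

lemma FIN_normal: "N \<in> FIN G \<Longrightarrow> N \<lhd> G"
  and FIN_finite: "N \<in> FIN G \<Longrightarrow> finite (rcosets\<^bsub>G\<^esub> N)"
  by (simp_all add: FIN_def)

lemma (in group) rcos_mem_rcosets: "x \<in> carrier G \<Longrightarrow> N #> x \<in> rcosets N"
  by (auto simp: RCOSETS_def)

lemma (in group) carrier_FIN: "carrier G \<in> FIN G"
  by (rule FIN_I[where F = "{()}" and f = "\<lambda>_. ()"]) (auto simp: normal_self)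

lemma (in group) FIN_superset:
  assumes "N \<in> FIN G" "M \<lhd> G" "N \<subseteq> M"
  shows "M \<in> FIN G"
  using assms(3) normal.rcos_eq_iff[OF FIN_normal[OF assms(1)]]
  by (intro FIN_I[OF assms(2) FIN_finite[OF assms(1)], of "\<lambda>x. N #> x"]) (auto simp: rcos_mem_rcosets)

lemma (in group_hom) vimage_normal:
  assumes "N \<lhd> H"
  shows "h -` N \<inter> carrier G \<lhd> G"
proof -
  interpret N: normal N H by fact
  have "subgroup (h -` N \<inter> carrier G) G"
  proof (rule G.subgroupI)
    have "\<one>\<^bsub>G\<^esub> \<in> h -` N \<inter> carrier G" by simp
    then show "h -` N \<inter> carrier G \<noteq> {}" by blast
  qed auto
  then show ?thesis
    by (rule G.normal_invI) (auto simp: N.inv_op_closed2)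
qed

lemma (in group_hom) vimage_FIN:
  assumes "N \<in> FIN H"
  shows "h -` N \<inter> carrier G \<in> FIN G"
proof -
  interpret N: normal N H using assms by (rule FIN_normal)
  show ?thesis
    by (rule G.FIN_I[OF vimage_normal[OF N.normal_axioms] FIN_finite[OF assms], of "\<lambda>x. N #>\<^bsub>H\<^esub> h x"])
       (auto simp: H.rcos_mem_rcosets N.rcos_eq_iff)
qed

lemma (in group) FIN_Int:
  assumes N: "N \<in> FIN G" and M: "M \<in> FIN G"
  shows "N \<inter> M \<in> FIN G"
proof -
  interpret N: normal N G using N by (rule FIN_normal)
  interpret M: normal M G using M by (rule FIN_normal)
  have "N \<inter> M \<lhd> G"
    using normal_subgroup_intersect N.normal_axioms M.normal_axioms by blast
  then show ?thesis
    by (rule FIN_I[where F = "(rcosets N) \<times> (rcosets M)" and f = "\<lambda>x. (N #> x, M #> x)"])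
       (auto simp: rcos_mem_rcosets FIN_finite N M N.rcos_eq_iff M.rcos_eq_iff)
qed

lemma (in group) FIN_power_mem:
  assumes N: "N \<in> FIN G" and x: "x \<in> carrier G"
  shows "x [^] card (rcosets N) \<in> N" "card (rcosets N) > 0"
proof -
  interpret N: normal N G using N by (rule FIN_normal)
  interpret Q: group "G Mod N" by (rule N.factorgroup_is_group)
  have fin: "finite (carrier (G Mod N))" using FIN_finite[OF N] by (simp add: FactGroup_def)
  have "(N #> x) [^]\<^bsub>G Mod N\<^esub> order (G Mod N) = N"
    using Q.pow_order_eq_1[of "N #> x"] x by (auto simp: carrier_FactGroup)
  then have "N #> (x [^] order (G Mod N)) = N"
    using x by (simp add: N.FactGroup_pow)
  moreover have "order (G Mod N) = card (rcosets N)" by (simp add: order_def FactGroup_def)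
  ultimately show "x [^] card (rcosets N) \<in> N" using x by (simp add: N.rcos_eq_self_iff)
  show "card (rcosets N) > 0"
    using FIN_finite[OF N] rcos_mem_rcosets[OF x, of N] by (auto simp: card_gt_0_iff)
qed

section \<open>Separation by normal subgroups of finite index\<close>

lemma (in group) normal_Union_chain:
  assumes "C \<noteq> {}" "\<And>N. N \<in> C \<Longrightarrow> N \<lhd> G" "\<And>N M. \<lbrakk>N \<in> C; M \<in> C\<rbrakk> \<Longrightarrow> N \<subseteq> M \<or> M \<subseteq> N"
  shows "\<Union>C \<lhd> G"
proof (rule normal_invI)
  have sub: "subgroup N G" if "N \<in> C" for N
    using assms(2)[OF that] by (rule normal_imp_subgroup)
  show "subgroup (\<Union>C) G"
  proof (rule subgroupI)
    show "\<Union>C \<subseteq> carrier G" using sub subgroup.subset by blast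
    obtain N where "N \<in> C" using assms(1) by blast
    then show "\<Union>C \<noteq> {}" using subgroup.one_closed[OF sub] by blast
    show "inv a \<in> \<Union>C" if "a \<in> \<Union>C" for a
      using that subgroup.m_inv_closed[OF sub] by blast
    fix a b assume "a \<in> \<Union>C" "b \<in> \<Union>C"
    then obtain N M where "a \<in> N" "b \<in> M" "N \<in> C" "M \<in> C" by blast
    then show "a \<otimes> b \<in> \<Union>C"
      using assms(3)[of N M] subgroup.m_closed[OF sub] by blast
  qed
  fix x h assume "x \<in> carrier G" "h \<in> \<Union>C"
  then show "x \<otimes> h \<otimes> inv x \<in> \<Union>C"
    using normal.inv_op_closed2[OF assms(2)] by blast
qed

text \<open>A normal subgroup \<open>N\<close> that is maximal subject to \<open>N \<inter> W \<subseteq> T\<close> has finite index: an element of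
  infinite order in the center of \<open>G/N\<close> would generate a subgroup meeting the torsion group
  \<open>WN/N\<close> trivially, contradicting maximality.\<close>
lemma (in group) nilpotent_separation:
  assumes S: "finite S" "S \<subseteq> carrier G" "generate G S = carrier G"
    and nilp: "lcs_aux G c = {\<one>}"
    and T: "T \<lhd> G" and W: "W \<subseteq> carrier G"
    and m: "(m::nat) > 0" "\<And>w. w \<in> W \<Longrightarrow> w [^] m \<in> T"
  shows "\<exists>N \<in> FIN G. N \<inter> W \<subseteq> T"
proof -
  \<comment> \<open>Requiring \<open>T \<subseteq> N\<close> ensures that the \<open>m\<close>-th
    powers of elements of \<open>W\<close> vanish in the quotient by every candidate.\<close>
  define \<A> where "\<A> = {N. N \<lhd> G \<and> T \<subseteq> N \<and> N \<inter> W \<subseteq> T}"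
  have "\<exists>N\<in>\<A>. \<forall>M\<in>\<A>. N \<subseteq> M \<longrightarrow> M = N"
  proof (rule subset_Zorn_nonempty)
    show "\<A> \<noteq> {}" using T by (auto simp: \<A>_def)
    fix C assume C: "C \<noteq> {}" "subset.chain \<A> C"
    then have "\<Union>C \<lhd> G"
      by (intro normal_Union_chain) (auto simp: \<A>_def subset_chain_def)
    then show "\<Union>C \<in> \<A>" using C by (auto simp: \<A>_def subset_chain_def)
  qed
  then obtain N where N: "N \<lhd> G" "T \<subseteq> N" "N \<inter> W \<subseteq> T"
    and max: "\<And>M. \<lbrakk>M \<lhd> G; T \<subseteq> M; M \<inter> W \<subseteq> T; N \<subseteq> M\<rbrakk> \<Longrightarrow> M = N"
    by (auto simp: \<A>_def)
  interpret N: normal N G by (rule N(1))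
  let ?Q = "G Mod N"
  interpret h: group_hom G ?Q "\<lambda>x. N #> x" by (rule N.rcos_group_hom)
  have surj: "(\<lambda>x. N #> x) ` carrier G = carrier ?Q" by (simp add: carrier_FactGroup)
  have "finite (carrier ?Q)"
  proof (rule h.H.finite_of_nilpotent_torsion_center)
    show "finite ((\<lambda>x. N #> x) ` S)" using S by simp
    show "(\<lambda>x. N #> x) ` S \<subseteq> carrier ?Q" using S by auto
    show "generate ?Q ((\<lambda>x. N #> x) ` S) = carrier ?Q"
      using h.generate_img[OF S(2)] S(3) surj by simp
    show "lcs_aux ?Q c = {\<one>\<^bsub>?Q\<^esub>}"
      using h.lcs_aux_image[OF surj, of c] nilp h.hom_one by simp
  next
    fix Z assume Z: "Z \<in> carrier ?Q"
      and central: "\<And>x. x \<in> carrier ?Q \<Longrightarrow> Z \<otimes>\<^bsub>?Q\<^esub> x = x \<otimes>\<^bsub>?Q\<^esub> Z"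
    show "\<exists>r::nat. r > 0 \<and> Z [^]\<^bsub>?Q\<^esub> r = \<one>\<^bsub>?Q\<^esub>"
    proof (cases "Z = N")
      case True
      then have "Z [^]\<^bsub>?Q\<^esub> (1::nat) = \<one>\<^bsub>?Q\<^esub>" using Z h.H.nat_pow_eone by auto
      then show ?thesis by (intro exI[of _ 1]) simp
    next
      case False
      let ?C = "generate ?Q {Z}"
      have Csub: "subgroup ?C ?Q" using Z by (simp add: h.H.generate_is_subgroup)
      have "?C \<lhd> ?Q"
      proof (rule h.H.normal_invI[OF Csub])
        fix x y assume x: "x \<in> carrier ?Q" and y: "y \<in> ?C"
        have yc: "y \<in> carrier ?Q" using y Csub subgroup.mem_carrier by fastforce
        have "x \<otimes>\<^bsub>?Q\<^esub> y = y \<otimes>\<^bsub>?Q\<^esub> x"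
          using h.H.generate_commutes[of "{Z}" x y] x y Z central[OF x] by auto
        then have "x \<otimes>\<^bsub>?Q\<^esub> y \<otimes>\<^bsub>?Q\<^esub> inv\<^bsub>?Q\<^esub> x = y \<otimes>\<^bsub>?Q\<^esub> x \<otimes>\<^bsub>?Q\<^esub> inv\<^bsub>?Q\<^esub> x" by (rule arg_cong)
        also have "\<dots> = y" using x yc h.H.m_assoc[OF yc x] by (simp del: mult_FactGroup one_FactGroup)
        finally show "x \<otimes>\<^bsub>?Q\<^esub> y \<otimes>\<^bsub>?Q\<^esub> inv\<^bsub>?Q\<^esub> x \<in> ?C" using y by simp
      qed
      define M where "M = (\<lambda>x. N #> x) -` ?C \<inter> carrier G"
      have M: "M \<lhd> G" unfolding M_def by (rule h.vimage_normal[OF \<open>?C \<lhd> ?Q\<close>])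
      have NM: "N \<subseteq> M"
        using subgroup.one_closed[OF Csub] N.mem_carrier by (auto simp: M_def N.rcos_const)
      obtain z where z: "z \<in> carrier G" "Z = N #> z" using Z by (auto simp: carrier_FactGroup)
      have "z \<in> M" using z generate.incl[of Z "{Z}" ?Q] by (simp add: M_def)
      moreover have "z \<notin> N" using z False N.rcos_eq_self_iff by blast
      ultimately have "M \<noteq> N" by blast
      \<comment> \<open>Enlarging \<open>N\<close> by \<open>Z\<close> must violate the condition on
        \<open>W\<close>. The witness \<open>w\<close> lies over a power of \<open>Z\<close>; the
        exponent is nonzero since \<open>w\<close> is outside \<open>N\<close>, and the
        \<open>m\<close>-th power of its class is trivial. So \<open>Z\<close> is torsion.\<close>
      then obtain w where w: "w \<in> M" "w \<in> W" "w \<notin> T"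
        using max[OF M _ _ NM] N(2) NM by blast
      have wc: "w \<in> carrier G" using w W by blast
      obtain k :: int where k: "N #> w = Z [^]\<^bsub>?Q\<^esub> k"
        using w Z h.H.generate_pow[of Z] by (auto simp: M_def)
      have "k \<noteq> 0"
      proof
        assume "k = 0"
        then have "w \<in> N" using k wc N.rcos_eq_self_iff by auto
        then show False using w N by blast
      qed
      have "(N #> w) [^]\<^bsub>?Q\<^esub> m = N #> (w [^] m)" using wc by (simp add: N.FactGroup_pow)
      also have "\<dots> = N"
        using m(2)[OF w(2)] N(2) wc N.rcos_eq_self_iff by auto
      finally have "Z [^]\<^bsub>?Q\<^esub> (k * int m) = \<one>\<^bsub>?Q\<^esub>"
        using Z k h.H.int_pow_pow[of Z k "int m"] by (simp add: int_pow_int)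
      moreover have "k * int m \<noteq> 0" using \<open>k \<noteq> 0\<close> m by simp
      \<comment> \<open>The integer exponent may be negative; passing through the finiteness of the
        cyclic subgroup yields a nonzero natural exponent.\<close>
      ultimately have "\<exists>i::int. i \<noteq> 0 \<and> Z [^]\<^bsub>?Q\<^esub> i = \<one>\<^bsub>?Q\<^esub>" by blast
      then have "\<exists>r::nat. r \<noteq> 0 \<and> Z [^]\<^bsub>?Q\<^esub> r = \<one>\<^bsub>?Q\<^esub>"
        using h.H.finite_cyclic_subgroup[OF Z] h.H.finite_cyclic_subgroup_int[OF Z] by blast
      then show ?thesis by blast
    qed
  qed
  then have "N \<in> FIN G" using N by (simp add: FIN_def FactGroup_def)
  then show ?thesis using N by blast
qed

section \<open>The group of IA-automorphisms\<close>

lemma IA_group_conv: "IA_group G = BijGroup (carrier G) \<lparr>carrier := IA G\<rparr>"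
  by (simp add: IA_group_def AutoGroup_def)

lemma carrier_IA_group [simp]: "carrier (IA_group G) = IA G"
  by (simp add: IA_group_def)

lemma IA_hom: "\<phi> \<in> IA G \<Longrightarrow> \<phi> \<in> hom G G"
  and IA_Bij: "\<phi> \<in> IA G \<Longrightarrow> \<phi> \<in> Bij (carrier G)"
  and IA_derived: "\<phi> \<in> IA G \<Longrightarrow> x \<in> carrier G \<Longrightarrow>
    derived G (carrier G) #>\<^bsub>G\<^esub> \<phi> x = derived G (carrier G) #>\<^bsub>G\<^esub> x"
  by (simp_all add: IA_def auto_def)

lemma IA_closed [simp]: "\<phi> \<in> IA G \<Longrightarrow> x \<in> carrier G \<Longrightarrow> \<phi> x \<in> carrier G"
  using IA_hom hom_in_carrier by fast

lemma IA_mult_apply [simp]: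
  "\<lbrakk>\<phi> \<in> IA G; \<psi> \<in> IA G; x \<in> carrier G\<rbrakk> \<Longrightarrow> (\<phi> \<otimes>\<^bsub>IA_group G\<^esub> \<psi>) x = \<phi> (\<psi> x)"
  by (simp add: IA_group_conv BijGroup_def IA_Bij compose_eq)

lemma IA_one_apply [simp]: "x \<in> carrier G \<Longrightarrow> \<one>\<^bsub>IA_group G\<^esub> x = x"
  by (simp add: IA_group_conv BijGroup_def)

lemma IA_ext:
  assumes "\<phi> \<in> IA G" "\<psi> \<in> IA G" "\<And>x. x \<in> carrier G \<Longrightarrow> \<phi> x = \<psi> x"
  shows "\<phi> = \<psi>"
  using assms(3) by (intro extensionalityI[of _ "carrier G"])
    (auto intro: Bij_imp_extensional IA_Bij assms(1,2))

lemma (in group) IA_group_hom: "\<phi> \<in> IA G \<Longrightarrow> group_hom G G \<phi>"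
  using IA_hom by (simp add: group_hom_def group_hom_axioms_def)

lemma (in group) group_IA_group: "group (IA_group G)"
proof -
  interpret B: group "BijGroup (carrier G)" by (rule group_BijGroup)
  interpret A: subgroup "auto G" "BijGroup (carrier G)" by (rule subgroup_auto)
  have IA_sub: "IA G \<subseteq> auto G" by (auto simp: IA_def)
  have app: "(\<phi> \<otimes>\<^bsub>BijGroup (carrier G)\<^esub> \<psi>) x = \<phi> (\<psi> x)"
    if "\<phi> \<in> IA G" "\<psi> \<in> IA G" "x \<in> carrier G" for \<phi> \<psi> x
    using that by (simp add: BijGroup_def IA_Bij compose_eq)
  have "subgroup (IA G) (BijGroup (carrier G))"
  proof (rule B.subgroupI)
    have "\<one>\<^bsub>BijGroup (carrier G)\<^esub> \<in> IA G"
      using A.one_closed by (simp add: IA_def BijGroup_def)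
    then show "IA G \<noteq> {}" by blast
  next
    fix \<phi> assume \<phi>: "\<phi> \<in> IA G"
    let ?\<psi> = "inv\<^bsub>BijGroup (carrier G)\<^esub> \<phi>"
    have "?\<psi> \<in> auto G" using \<phi> IA_sub by blast
    then have \<psi>c: "?\<psi> x \<in> carrier G" if "x \<in> carrier G" for x
      using that by (auto simp: auto_def hom_def)
    have "\<phi> (?\<psi> x) = x" if "x \<in> carrier G" for x
      using bij_betw_inv_into_right[of \<phi> "carrier G" "carrier G"] IA_Bij[OF \<phi>] that
      by (simp add: inv_BijGroup Bij_def)
    \<comment> \<open>Triviality of the inverse at \<open>x\<close> is triviality of
      \<open>\<phi>\<close> at \<open>?\<psi> x\<close>.\<close>
    then have "derived G (carrier G) #> ?\<psi> x = derived G (carrier G) #> x" if "x \<in> carrier G" for x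
      using that IA_derived[OF \<phi> \<psi>c[OF that]] by simp
    then show "?\<psi> \<in> IA G" using \<open>?\<psi> \<in> auto G\<close> by (simp add: IA_def)
  next
    fix \<phi> \<psi> assume "\<phi> \<in> IA G" "\<psi> \<in> IA G"
    then show "\<phi> \<otimes>\<^bsub>BijGroup (carrier G)\<^esub> \<psi> \<in> IA G"
      using A.m_closed IA_sub app IA_derived by (fastforce simp: IA_def)
  qed (use IA_sub A.subset in blast)
  then show ?thesis
    using B.subgroup_imp_group by (simp add: IA_group_conv)
qed

text \<open>For IA-invariant \<open>N\<close> this is the kernel of the action on
  \<open>G/N\<close>, written \<open>C\<^sub>N\<close> in the overview. Phrasing it by cosets avoids
  introducing automorphisms of the quotient.\<close>

definition congruence_subgroup :: "('a, 'b) monoid_scheme \<Rightarrow> 'a set \<Rightarrow> ('a \<Rightarrow> 'a) set" where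
  "congruence_subgroup G N = {\<phi> \<in> IA G. \<forall>x \<in> carrier G. N #>\<^bsub>G\<^esub> \<phi> x = N #>\<^bsub>G\<^esub> x}"

definition IA_invariant :: "('a, 'b) monoid_scheme \<Rightarrow> 'a set \<Rightarrow> bool" where
  "IA_invariant G N \<longleftrightarrow> N \<lhd> G \<and> (\<forall>\<phi> \<in> IA G. \<forall>x \<in> N. \<phi> x \<in> N)"

lemma IA_invariant_normal: "IA_invariant G N \<Longrightarrow> N \<lhd> G"
  by (simp add: IA_invariant_def)

lemma congruence_subgroup_mono:
  assumes "N \<lhd> G" "M \<lhd> G" "N \<subseteq> M"
  shows "congruence_subgroup G N \<subseteq> congruence_subgroup G M"
proof
  fix \<phi> assume \<phi>: "\<phi> \<in> congruence_subgroup G N"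
  then have c: "\<phi> x \<in> carrier G" if "x \<in> carrier G" for x
    using that by (simp add: congruence_subgroup_def)
  then have "M #>\<^bsub>G\<^esub> \<phi> x = M #>\<^bsub>G\<^esub> x" if "x \<in> carrier G" for x
    using \<phi> assms(3) that normal.rcos_eq_iff[OF assms(1) c[OF that] that]
      normal.rcos_eq_iff[OF assms(2) c[OF that] that] by (auto simp: congruence_subgroup_def)
  then show "\<phi> \<in> congruence_subgroup G M" using \<phi> by (simp add: congruence_subgroup_def)
qed

context group
begin

lemma IA_rcos_cong:
  assumes N: "IA_invariant G N" and \<phi>: "\<phi> \<in> IA G"
    and xy: "x \<in> carrier G" "y \<in> carrier G" "N #> x = N #> y"
  shows "N #> \<phi> x = N #> \<phi> y"
proof -
  interpret N: normal N G using N by (rule IA_invariant_normal)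
  interpret \<phi>: group_hom G G \<phi> using IA_group_hom[OF \<phi>] .
  have "x \<otimes> inv y \<in> N" using xy by (simp add: N.rcos_eq_iff)
  then have "\<phi> (x \<otimes> inv y) \<in> N" using N \<phi> by (auto simp: IA_invariant_def)
  then show ?thesis using xy by (simp add: N.rcos_eq_iff)
qed

lemma IA_inv_closed [simp]: "\<phi> \<in> IA G \<Longrightarrow> inv\<^bsub>IA_group G\<^esub> \<phi> \<in> IA G"
  using group.inv_closed[OF group_IA_group, of \<phi>] by simp

lemma IA_mult_closed [simp]:
  "\<phi> \<in> IA G \<Longrightarrow> \<psi> \<in> IA G \<Longrightarrow> \<phi> \<otimes>\<^bsub>IA_group G\<^esub> \<psi> \<in> IA G"
  using monoid.m_closed[OF group.is_monoid[OF group_IA_group], of \<phi> \<psi>] by simp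

lemma IA_inv_apply [simp]:
  assumes "\<phi> \<in> IA G" "x \<in> carrier G"
  shows "\<phi> ((inv\<^bsub>IA_group G\<^esub> \<phi>) x) = x" "(inv\<^bsub>IA_group G\<^esub> \<phi>) (\<phi> x) = x"
proof -
  interpret A: group "IA_group G" by (rule group_IA_group)
  note inv = IA_inv_closed[OF assms(1)]
  show "\<phi> ((inv\<^bsub>IA_group G\<^esub> \<phi>) x) = x"
    using IA_mult_apply[OF assms(1) inv assms(2)] A.r_inv assms by simp
  show "(inv\<^bsub>IA_group G\<^esub> \<phi>) (\<phi> x) = x"
    using IA_mult_apply[OF inv assms] A.l_inv assms by simp
qed

text \<open>With the inverse on the right, triviality is tested at the points
  \<open>\<psi> x\<close>, and these exhaust \<open>G\<close>. This is how cosets of congruence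
  subgroups are compared from here on.\<close>

lemma congruence_subgroup_diff:
  assumes N: "N \<lhd> G" and \<phi>: "\<phi> \<in> IA G" and \<psi>: "\<psi> \<in> IA G"
  shows "\<phi> \<otimes>\<^bsub>IA_group G\<^esub> inv\<^bsub>IA_group G\<^esub> \<psi> \<in> congruence_subgroup G N
    \<longleftrightarrow> (\<forall>x\<in>carrier G. N #> \<phi> x = N #> \<psi> x)" (is "?l \<longleftrightarrow> ?r")
proof
  interpret A: group "IA_group G" by (rule group_IA_group)
  let ?\<psi>' = "inv\<^bsub>IA_group G\<^esub> \<psi>"
  have \<psi>': "?\<psi>' \<in> IA G" using \<psi> A.inv_closed by simp
  have c: "\<phi> \<otimes>\<^bsub>IA_group G\<^esub> ?\<psi>' \<in> IA G" using A.m_closed \<phi> \<psi>' by simp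
  show ?r if ?l
  proof
    fix x assume x: "x \<in> carrier G"
    then have "N #> (\<phi> \<otimes>\<^bsub>IA_group G\<^esub> ?\<psi>') (\<psi> x) = N #> \<psi> x"
      using that \<psi> by (simp add: congruence_subgroup_def)
    then show "N #> \<phi> x = N #> \<psi> x" using \<phi> \<psi> \<psi>' x by simp
  qed
  show ?l if ?r
    using that c \<phi> \<psi> \<psi>' by (auto simp: congruence_subgroup_def)
qed

lemma congruence_subgroup_subgroup:
  assumes N: "N \<lhd> G"
  shows "subgroup (congruence_subgroup G N) (IA_group G)"
proof -
  interpret A: group "IA_group G" by (rule group_IA_group)
  show ?thesis
  proof (rule A.subgroupI)
    have "\<one>\<^bsub>IA_group G\<^esub> \<in> congruence_subgroup G N"
      using A.one_closed by (simp add: congruence_subgroup_def)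
    then show "congruence_subgroup G N \<noteq> {}" by blast
  next
    fix \<phi> assume \<phi>: "\<phi> \<in> congruence_subgroup G N"
    then have "\<phi> \<in> IA G" "\<forall>x\<in>carrier G. N #> \<one>\<^bsub>IA_group G\<^esub> x = N #> \<phi> x"
      by (simp_all add: congruence_subgroup_def)
    then have "\<one>\<^bsub>IA_group G\<^esub> \<otimes>\<^bsub>IA_group G\<^esub> inv\<^bsub>IA_group G\<^esub> \<phi> \<in> congruence_subgroup G N"
      using A.one_closed by (intro iffD2[OF congruence_subgroup_diff[OF N]]) simp_all
    then show "inv\<^bsub>IA_group G\<^esub> \<phi> \<in> congruence_subgroup G N"
      using A.l_one[of "inv\<^bsub>IA_group G\<^esub> \<phi>"] \<open>\<phi> \<in> IA G\<close> by simp
  next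
    fix \<phi> \<psi> assume "\<phi> \<in> congruence_subgroup G N" "\<psi> \<in> congruence_subgroup G N"
    moreover from this have "\<phi> \<otimes>\<^bsub>IA_group G\<^esub> \<psi> \<in> IA G"
      using A.m_closed by (simp add: congruence_subgroup_def)
    ultimately show "\<phi> \<otimes>\<^bsub>IA_group G\<^esub> \<psi> \<in> congruence_subgroup G N"
      by (simp add: congruence_subgroup_def)
  qed (auto simp: congruence_subgroup_def)
qed

lemma congruence_subgroup_normal:
  assumes N: "IA_invariant G N"
  shows "congruence_subgroup G N \<lhd> IA_group G"
proof -
  interpret A: group "IA_group G" by (rule group_IA_group)
  show ?thesis
  proof (rule A.normal_invI[OF congruence_subgroup_subgroup[OF IA_invariant_normal[OF N]]])
    fix \<phi> \<kappa> assume "\<phi> \<in> carrier (IA_group G)" and \<kappa>: "\<kappa> \<in> congruence_subgroup G N"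
    then have \<phi>: "\<phi> \<in> IA G" and \<kappa>': "\<kappa> \<in> IA G" by (simp_all add: congruence_subgroup_def)
    have c: "\<phi> \<otimes>\<^bsub>IA_group G\<^esub> \<kappa> \<in> IA G" using A.m_closed \<phi> \<kappa>' by simp
    have "N #> (\<phi> \<otimes>\<^bsub>IA_group G\<^esub> \<kappa>) x = N #> \<phi> x" if "x \<in> carrier G" for x
      using IA_rcos_cong[OF N \<phi>, of "\<kappa> x" x] \<kappa> \<kappa>' \<phi> that by (simp add: congruence_subgroup_def)
    then show "\<phi> \<otimes>\<^bsub>IA_group G\<^esub> \<kappa> \<otimes>\<^bsub>IA_group G\<^esub> inv\<^bsub>IA_group G\<^esub> \<phi> \<in> congruence_subgroup G N"
      using congruence_subgroup_diff[OF IA_invariant_normal[OF N] c \<phi>] by blast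
  qed
qed

lemma IA_invariant_lcs_aux: "IA_invariant G (lcs_aux G k)"
  unfolding IA_invariant_def
  using lcs_aux_normal group_hom.lcs_aux_image_subset[OF IA_group_hom] by blast

lemma IA_invariant_Int:
  "IA_invariant G N \<Longrightarrow> IA_invariant G M \<Longrightarrow> IA_invariant G (N \<inter> M)"
  unfolding IA_invariant_def using normal_subgroup_intersect by blast

text \<open>The intersection of the preimages of \<open>N\<close> under all IA-automorphisms; for a
  normal subgroup \<open>N\<close> it is the largest IA-invariant subgroup inside
  \<open>N\<close>.\<close>

definition IA_core :: "'a set \<Rightarrow> 'a set" where
  "IA_core N = {x \<in> carrier G. \<forall>\<phi> \<in> IA G. \<phi> x \<in> N}"

lemma IA_core_subset: "IA_core N \<subseteq> N"
proof
  interpret A: group "IA_group G" by (rule group_IA_group)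
  fix x assume "x \<in> IA_core N"
  then have "x \<in> carrier G" "\<one>\<^bsub>IA_group G\<^esub> x \<in> N" using A.one_closed by (auto simp: IA_core_def)
  then show "x \<in> N" by simp
qed

lemma IA_invariant_IA_core:
  assumes "N \<lhd> G"
  shows "IA_invariant G (IA_core N)"
proof -
  interpret A: group "IA_group G" by (rule group_IA_group)
  interpret N: normal N G by fact
  have vimage: "\<phi> -` N \<inter> carrier G \<lhd> G" if "\<phi> \<in> IA G" for \<phi>
    using group_hom.vimage_normal[OF IA_group_hom[OF that] N.normal_axioms] .
  then have sub: "subgroup (\<phi> -` N \<inter> carrier G) G" if "\<phi> \<in> IA G" for \<phi>
    using that normal_imp_subgroup by blast
  have eq: "IA_core N = \<Inter> ((\<lambda>\<phi>. \<phi> -` N \<inter> carrier G) ` IA G)"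
    using A.one_closed by (auto simp: IA_core_def)
  have "subgroup (IA_core N) G"
    unfolding eq using sub A.one_closed by (intro subgroups_Inter) auto
  then have "IA_core N \<lhd> G"
  proof (rule normal_invI)
    fix x h assume "x \<in> carrier G" "h \<in> IA_core N"
    then show "x \<otimes> h \<otimes> inv x \<in> IA_core N"
      unfolding eq using normal.inv_op_closed2[OF vimage] by blast
  qed
  moreover have "\<phi> x \<in> IA_core N" if \<phi>: "\<phi> \<in> IA G" and x: "x \<in> IA_core N" for \<phi> x
  proof -
    have xc: "x \<in> carrier G" using x by (simp add: IA_core_def)
    have "\<psi> (\<phi> x) \<in> N" if "\<psi> \<in> IA G" for \<psi>
    proof -
      have "(\<psi> \<otimes>\<^bsub>IA_group G\<^esub> \<phi>) x \<in> N"
        using x A.m_closed[of \<psi> \<phi>] that \<phi> by (simp add: IA_core_def del: IA_mult_apply)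
      then show ?thesis using that \<phi> xc by simp
    qed
    then show ?thesis using \<phi> xc by (simp add: IA_core_def)
  qed
  ultimately show ?thesis by (simp add: IA_invariant_def)
qed

end

section \<open>Finite index of congruence subgroups and of cores\<close>

locale finitely_generated_group = group +
  fixes S :: "'a set"
  assumes finite_gens: "finite S" and gens_closed: "S \<subseteq> carrier G"
    and generate_gens: "generate G S = carrier G"
begin

lemma IA_rcos_eq_on_gens:
  assumes N: "N \<lhd> G" and \<phi>: "\<phi> \<in> IA G" and \<psi>: "\<psi> \<in> IA G"
    and eq: "\<And>s. s \<in> S \<Longrightarrow> N #> \<phi> s = N #> \<psi> s" and x: "x \<in> carrier G"
  shows "N #> \<phi> x = N #> \<psi> x"
proof -
  interpret N: normal N G by fact
  have hom: "(\<lambda>x. N #> \<phi> x) \<in> hom G (G Mod N)" if "\<phi> \<in> IA G" for \<phi>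
    using Group.hom_compose[OF IA_hom[OF that] N.r_coset_hom_Mod] by (simp add: comp_def)
  show ?thesis
    using hom_eq_on_generate[OF N.factorgroup_is_group hom[OF \<phi>] hom[OF \<psi>] gens_closed eq] x
    by (simp add: generate_gens)
qed

lemma finite_IA_classes:
  assumes "N \<in> FIN G"
  shows "finite (PiE S (\<lambda>_. rcosets N))"
  using finite_gens FIN_finite[OF assms] by (intro finite_PiE) auto

text \<open>The coset of an automorphism is determined by the images of the finitely many generators
  modulo \<open>N\<close>.\<close>

lemma congruence_subgroup_FIN:
  assumes N: "N \<in> FIN G" "IA_invariant G N"
  shows "congruence_subgroup G N \<in> FIN (IA_group G)"
proof -
  interpret A: group "IA_group G" by (rule group_IA_group)
  show ?thesis
  proof (rule A.FIN_I[OF congruence_subgroup_normal[OF N(2)] finite_IA_classes[OF N(1)]])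
    fix \<phi> assume "\<phi> \<in> carrier (IA_group G)"
    then have "N #> \<phi> y \<in> rcosets N" if "y \<in> carrier G" for y
      using that by (simp add: rcos_mem_rcosets)
    then show "(\<lambda>s\<in>S. N #> \<phi> s) \<in> S \<rightarrow>\<^sub>E rcosets N"
      using gens_closed by (auto simp: subset_iff)
  next
    fix \<phi> \<psi> assume \<phi>: "\<phi> \<in> carrier (IA_group G)" and \<psi>: "\<psi> \<in> carrier (IA_group G)"
      and eq: "(\<lambda>s\<in>S. N #> \<phi> s) = (\<lambda>s\<in>S. N #> \<psi> s)"
    have "N #> \<phi> s = N #> \<psi> s" if "s \<in> S" for s
      using fun_cong[OF eq, of s] that by simp
    then have "N #> \<phi> x = N #> \<psi> x" if "x \<in> carrier G" for x
      using IA_rcos_eq_on_gens[OF FIN_normal[OF N(1)] _ _ _ that, of \<phi> \<psi>] \<phi> \<psi> by simp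
    then show "\<phi> \<otimes>\<^bsub>IA_group G\<^esub> inv\<^bsub>IA_group G\<^esub> \<psi> \<in> congruence_subgroup G N"
      using \<phi> \<psi> by (simp add: congruence_subgroup_diff[OF FIN_normal[OF N(1)]])
  qed
qed

text \<open>Only finitely many maps \<open>G \<rightarrow> G/N\<close> are induced by IA-automorphisms, so the core has finite index.\<close>
lemma IA_core_FIN:
  assumes N: "N \<in> FIN G"
  shows "IA_core N \<in> FIN G"
proof -
  interpret N: normal N G using N by (rule FIN_normal)
  let ?\<rho> = "\<lambda>\<phi>. \<lambda>s\<in>S. N #> \<phi> s"
  \<comment> \<open>The set of cosets of all \<open>\<phi> x\<close> alone would forget which
    automorphism produced which coset. The label \<open>?\<rho> \<phi>\<close> restores this: equal
    labels mean equal induced maps into \<open>G/N\<close>.\<close>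
  let ?f = "\<lambda>x. (\<lambda>\<phi>. (?\<rho> \<phi>, N #> \<phi> x)) ` IA G"
  show ?thesis
  proof (rule FIN_I[where f = ?f and F = "Pow ((S \<rightarrow>\<^sub>E rcosets N) \<times> (rcosets N))"])
    show "IA_core N \<lhd> G" using IA_invariant_IA_core[OF N.normal_axioms] by (rule IA_invariant_normal)
    show "finite (Pow ((S \<rightarrow>\<^sub>E rcosets N) \<times> (rcosets N)))"
      using finite_IA_classes[OF N] FIN_finite[OF N] by simp
    show "?f x \<in> Pow ((S \<rightarrow>\<^sub>E rcosets N) \<times> (rcosets N))" if "x \<in> carrier G" for x
    proof -
      have "N #> \<phi> y \<in> rcosets N" if "\<phi> \<in> IA G" "y \<in> carrier G" for \<phi> y
        using rcos_mem_rcosets[OF IA_closed[OF that]] .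
      then show ?thesis using that gens_closed by (auto simp: subset_iff)
    qed
    fix x y assume x: "x \<in> carrier G" and y: "y \<in> carrier G" and eq: "?f x = ?f y"
    have "\<phi> (x \<otimes> inv y) \<in> N" if \<phi>: "\<phi> \<in> IA G" for \<phi>
    proof -
      interpret \<phi>: group_hom G G \<phi> using IA_group_hom[OF \<phi>] .
      have "(?\<rho> \<phi>, N #> \<phi> x) \<in> ?f x" using \<phi> by blast
      then have "(?\<rho> \<phi>, N #> \<phi> x) \<in> ?f y" unfolding eq .
      then obtain \<psi> where \<psi>: "\<psi> \<in> IA G" "?\<rho> \<phi> = ?\<rho> \<psi>" "N #> \<phi> x = N #> \<psi> y" by blast
      have "N #> \<phi> s = N #> \<psi> s" if "s \<in> S" for s
        using fun_cong[OF \<psi>(2), of s] that by simp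
      then have "N #> \<phi> y = N #> \<psi> y"
        using IA_rcos_eq_on_gens[OF N.normal_axioms \<phi> \<psi>(1) _ y] by blast
      then have "N #> \<phi> x = N #> \<phi> y" using \<psi>(3) by simp
      then show ?thesis using x y by (simp add: N.rcos_eq_iff)
    qed
    then show "x \<otimes> inv y \<in> IA_core N" using x y by (simp add: IA_core_def)
  qed
qed

end

section \<open>The congruence subgroup property\<close>

text \<open>\<open>IA_lift\<close> is the form in which freeness enters: generators can be displaced
  by arbitrary elements of \<open>G'\<close>, independently of each other. It supplies roots in the
  congruence subgroup property and approximations in the surjectivity proof.\<close>

locale IA_free_nilpotent_group = finitely_generated_group +
  fixes c :: nat
  assumes nilpotent: "lcs_aux G c = {\<one>}"
    and IA_lift: "(\<And>s. s \<in> S \<Longrightarrow> d s \<in> derived G (carrier G)) \<Longrightarrow> \<exists>\<phi> \<in> IA G. \<forall>s \<in> S. \<phi> s = d s \<otimes> s"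
begin

text \<open>Apply \<open>nilpotent_separation\<close> to the set \<open>?T\<close> of elements
  congruent, modulo the term \<open>i + 1\<close>, to \<open>m\<close>-th powers from the term
  \<open>i\<close>. It is a subgroup because this factor of the series is abelian, and normal
  because the factor is central.\<close>

lemma lcs_aux_power_separation:
  assumes m: "(m::nat) > 0"
  shows "\<exists>N \<in> FIN G. \<forall>x \<in> N \<inter> lcs_aux G i. \<exists>w \<in> lcs_aux G i.
           lcs_aux G (Suc i) #> x = lcs_aux G (Suc i) #> (w [^] m)"
proof -
  let ?L = "lcs_aux G (Suc i)"
  let ?W = "lcs_aux G i"
  interpret L: normal ?L G by (rule lcs_aux_normal)
  interpret W: normal ?W G by (rule lcs_aux_normal)
  interpret Q: group "G Mod ?L" by (rule L.factorgroup_is_group)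
  let ?T = "{x \<in> carrier G. \<exists>w \<in> ?W. ?L #> x = ?L #> (w [^] m)}"
  have pow: "?L #> (a [^] m) <#> (?L #> (b [^] m)) = ?L #> ((a \<otimes> b) [^] m)"
    if ab: "a \<in> ?W" "b \<in> ?W" for a b
  proof -
    have c: "a \<in> carrier G" "b \<in> carrier G" using ab lcs_aux_in_carrier by auto
    let ?a = "?L #> a" and ?b = "?L #> b"
    have q: "?a \<in> carrier (G Mod ?L)" "?b \<in> carrier (G Mod ?L)"
      using c by (auto simp: carrier_FactGroup)
    have "?a \<otimes>\<^bsub>G Mod ?L\<^esub> ?b = ?b \<otimes>\<^bsub>G Mod ?L\<^esub> ?a"
      using lcs_aux_central[OF c(1) ab(2)] c by (simp add: L.rcos_sum)
    then have "(?a \<otimes>\<^bsub>G Mod ?L\<^esub> ?b) [^]\<^bsub>G Mod ?L\<^esub> m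
        = ?a [^]\<^bsub>G Mod ?L\<^esub> m \<otimes>\<^bsub>G Mod ?L\<^esub> ?b [^]\<^bsub>G Mod ?L\<^esub> m"
      using Q.pow_mult_distrib[of ?a ?b m] q by simp
    then show ?thesis using c by (simp add: L.rcos_sum L.FactGroup_pow)
  qed
  have "subgroup ?T G"
  proof (rule subgroupI)
    have "\<one> \<in> ?T" using W.one_closed by (auto intro!: bexI[of _ \<one>])
    then show "?T \<noteq> {}" by blast
  next
    fix a assume "a \<in> ?T"
    then obtain w where w: "a \<in> carrier G" "w \<in> ?W" "?L #> a = ?L #> (w [^] m)" by blast
    have wc: "w \<in> carrier G" using w by simp
    have "?L #> inv a = set_inv (?L #> (w [^] m))" using w by (simp flip: L.rcos_inv)
    also have "\<dots> = ?L #> (inv w [^] m)" using wc by (simp add: L.rcos_inv nat_pow_inv)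
    finally show "inv a \<in> ?T" using w by auto
  next
    fix a b assume "a \<in> ?T" "b \<in> ?T"
    then obtain v w where *: "a \<in> carrier G" "v \<in> ?W" "?L #> a = ?L #> (v [^] m)"
      "b \<in> carrier G" "w \<in> ?W" "?L #> b = ?L #> (w [^] m)" by blast
    then have "?L #> (a \<otimes> b) = ?L #> ((v \<otimes> w) [^] m)"
      using pow[of v w] by (simp flip: L.rcos_sum)
    then show "a \<otimes> b \<in> ?T" using * by auto
  qed blast
  then have "?T \<lhd> G"
  proof (rule normal_invI)
    fix x a assume x: "x \<in> carrier G" and "a \<in> ?T"
    then obtain w where w: "a \<in> carrier G" "w \<in> ?W" "?L #> a = ?L #> (w [^] m)" by blast
    have wc: "w \<in> carrier G" using w by simp
    have wm: "w [^] m \<in> ?W"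
      using subgroup_nat_pow_closed[OF lcs_aux_subgroup w(2)] .
    have "?L #> (x \<otimes> a \<otimes> inv x) = ?L #> (x \<otimes> w [^] m \<otimes> inv x)"
      using w x wc by (intro L.rcos_mult_cong) auto
    also have "\<dots> = ?L #> (w [^] m)" by (rule lcs_aux_conj[OF x wm])
    finally show "x \<otimes> a \<otimes> inv x \<in> ?T" using w x by auto
  qed
  moreover have "w [^] m \<in> ?T" if "w \<in> ?W" for w
    using that lcs_aux_in_carrier by auto
  moreover have "?W \<subseteq> carrier G" using lcs_aux_in_carrier by blast
  ultimately obtain N where "N \<in> FIN G" "N \<inter> ?W \<subseteq> ?T"
    using nilpotent_separation[OF finite_gens gens_closed generate_gens nilpotent, of ?T ?W m] m by blast
  then show ?thesis by blast
qed

text \<open>Iterating \<open>\<theta>\<close> multiplies displacements because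
  \<open>\<theta>\<close>, being trivial on the factors of the series, fixes the earlier
  displacement \<open>w [^] m\<close> modulo the term \<open>i + 1\<close>.\<close>

lemma congruence_lcs_aux_power:
  assumes \<theta>: "\<theta> \<in> congruence_subgroup G (lcs_aux G i)" and x: "x \<in> carrier G"
    and w: "w \<in> lcs_aux G i" and \<theta>x: "\<theta> x = w \<otimes> x"
  shows "lcs_aux G (Suc i) #> (\<theta> [^]\<^bsub>IA_group G\<^esub> (m::nat)) x = lcs_aux G (Suc i) #> (w [^] m \<otimes> x)"
proof (induction m)
  case 0
  then show ?case using x by simp
next
  case (Suc m)
  let ?L = "lcs_aux G (Suc i)"
  interpret L: normal ?L G by (rule lcs_aux_normal)
  interpret A: group "IA_group G" by (rule group_IA_group)
  have \<theta>': "\<theta> \<in> IA G" using \<theta> by (simp add: congruence_subgroup_def)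
  interpret \<theta>: group_hom G G \<theta> by (rule IA_group_hom[OF \<theta>'])
  have pc: "\<theta> [^]\<^bsub>IA_group G\<^esub> m \<in> IA G" using \<theta>' A.nat_pow_closed[of \<theta> m] by simp
  have wc: "w \<in> carrier G" using w lcs_aux_in_carrier by blast
  have wm: "w [^] m \<in> lcs_aux G i"
    using subgroup_nat_pow_closed[OF lcs_aux_subgroup w] .
  have "(\<theta> [^]\<^bsub>IA_group G\<^esub> Suc m) x = \<theta> ((\<theta> [^]\<^bsub>IA_group G\<^esub> m) x)"
    using \<theta>' pc x A.nat_pow_Suc2[of \<theta> m] by simp
  then have "?L #> (\<theta> [^]\<^bsub>IA_group G\<^esub> Suc m) x = ?L #> \<theta> (w [^] m \<otimes> x)"
    using IA_rcos_cong[OF IA_invariant_lcs_aux \<theta>' _ _ Suc] pc wc x by simp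
  also have "\<dots> = ?L #> (\<theta> (w [^] m) \<otimes> (w \<otimes> x))"
    using wc x \<theta>x by simp
  also have "\<dots> = ?L #> (w [^] m \<otimes> (w \<otimes> x))"
    using endomorphism_lcs_aux[OF IA_hom[OF \<theta>'] IA_derived[OF \<theta>'] wm] wc x \<theta>'
    by (intro L.rcos_mult_cong) auto
  finally show ?case using wc x by (simp add: m_assoc)
qed

text \<open>The term of index \<open>Suc 0\<close> is \<open>G'\<close>, modulo which every
  IA-automorphism is trivial, so the base case holds with \<open>N\<close> the whole group. Each
  further step takes an \<open>m\<close>-th root on one factor.\<close>

lemma congruence_subgroup_property_mod_lcs_aux:
  assumes "K \<in> FIN (IA_group G)"
  shows "\<exists>N \<in> FIN G. IA_invariant G N \<and> congruence_subgroup G N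
           \<subseteq> K <#>\<^bsub>IA_group G\<^esub> congruence_subgroup G (lcs_aux G (Suc i))"
  using assms
proof (induction i arbitrary: K)
  case 0
  interpret A: group "IA_group G" by (rule group_IA_group)
  interpret K: normal K "IA_group G" using 0 by (rule FIN_normal)
  have "congruence_subgroup G (lcs_aux G (Suc 0)) = IA G"
    using IA_derived[of _ G] by (auto simp: lcs_aux_1 congruence_subgroup_def simp del: IA_closed)
  moreover have "\<phi> \<in> K <#>\<^bsub>IA_group G\<^esub> IA G" if "\<phi> \<in> IA G" for \<phi>
  proof -
    have "\<one>\<^bsub>IA_group G\<^esub> \<otimes>\<^bsub>IA_group G\<^esub> \<phi> \<in> K <#>\<^bsub>IA_group G\<^esub> IA G"
      unfolding set_mult_def using K.one_closed that by blast
    then show ?thesis using A.l_one[of \<phi>] that by simp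
  qed
  ultimately have "congruence_subgroup G (carrier G)
      \<subseteq> K <#>\<^bsub>IA_group G\<^esub> congruence_subgroup G (lcs_aux G (Suc 0))"
    by (auto simp: congruence_subgroup_def)
  moreover have "IA_invariant G (carrier G)" using IA_invariant_lcs_aux[of 0] by simp
  ultimately show ?case using carrier_FIN by blast
next
  case (Suc i)
  interpret A: group "IA_group G" by (rule group_IA_group)
  interpret K: normal K "IA_group G" using Suc.prems by (rule FIN_normal)
  let ?L = "lcs_aux G (Suc (Suc i))"
  interpret L: normal ?L G by (rule lcs_aux_normal)
  interpret W: normal "lcs_aux G (Suc i)" G by (rule lcs_aux_normal)
  define m where "m = card (rcosets\<^bsub>IA_group G\<^esub> K)"
  have m: "m > 0" using A.FIN_power_mem(2)[OF Suc.prems A.one_closed] by (simp add: m_def)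
  obtain N' where N': "N' \<in> FIN G" "\<And>x. x \<in> N' \<Longrightarrow> x \<in> lcs_aux G (Suc i) \<Longrightarrow>
      \<exists>w \<in> lcs_aux G (Suc i). ?L #> x = ?L #> (w [^] m)"
    using lcs_aux_power_separation[OF m, of "Suc i"] by blast
  define N\<^sub>0 where "N\<^sub>0 = IA_core N'"
  have N\<^sub>0: "N\<^sub>0 \<in> FIN G" "IA_invariant G N\<^sub>0" "N\<^sub>0 \<subseteq> N'"
    using IA_core_FIN[OF N'(1)] IA_invariant_IA_core[OF FIN_normal[OF N'(1)]] IA_core_subset
    by (auto simp: N\<^sub>0_def)
  interpret N\<^sub>0: normal N\<^sub>0 G using N\<^sub>0(1) by (rule FIN_normal)
  let ?C = "congruence_subgroup G"
  \<comment> \<open>Intersecting with the congruence subgroup of \<open>N\<^sub>0\<close> makes the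
    correcting factor \<open>k\<close> trivial modulo \<open>N\<^sub>0\<close>. The remaining factor
    \<open>\<psi>\<close> then stays trivial modulo \<open>N\<^sub>0\<close>, and its displacements
    of generators are \<open>m\<close>-th powers on the factor.\<close>
  have "K \<inter> ?C N\<^sub>0 \<in> FIN (IA_group G)"
    using A.FIN_Int[OF Suc.prems congruence_subgroup_FIN[OF N\<^sub>0(1,2)]] .
  from Suc.IH[OF this] obtain N\<^sub>1 where N\<^sub>1: "N\<^sub>1 \<in> FIN G" "IA_invariant G N\<^sub>1"
    "?C N\<^sub>1 \<subseteq> (K \<inter> ?C N\<^sub>0) <#>\<^bsub>IA_group G\<^esub> ?C (lcs_aux G (Suc i))" by blast
  have "?C (N\<^sub>1 \<inter> N\<^sub>0) \<subseteq> K <#>\<^bsub>IA_group G\<^esub> ?C ?L"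
  proof
    fix \<phi> assume \<phi>: "\<phi> \<in> ?C (N\<^sub>1 \<inter> N\<^sub>0)"
    have n: "N\<^sub>1 \<inter> N\<^sub>0 \<lhd> G" using FIN_normal[OF FIN_Int[OF N\<^sub>1(1) N\<^sub>0(1)]] .
    have \<phi>1: "\<phi> \<in> ?C N\<^sub>1" and \<phi>0: "\<phi> \<in> ?C N\<^sub>0"
      using \<phi> congruence_subgroup_mono[OF n] FIN_normal N\<^sub>1(1) N\<^sub>0(1) by blast+
    obtain k \<psi> where k: "k \<in> K" "k \<in> ?C N\<^sub>0" and \<psi>: "\<psi> \<in> ?C (lcs_aux G (Suc i))"
      and \<phi>_eq: "\<phi> = k \<otimes>\<^bsub>IA_group G\<^esub> \<psi>"
      using \<phi>1 N\<^sub>1(3) unfolding set_mult_def by blast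
    have IA: "k \<in> IA G" "\<psi> \<in> IA G" "\<phi> \<in> IA G"
      using k \<psi> \<phi> by (simp_all add: congruence_subgroup_def)
    have "\<psi> = inv\<^bsub>IA_group G\<^esub> k \<otimes>\<^bsub>IA_group G\<^esub> \<phi>"
      using \<phi>_eq IA by simp
    then have \<psi>0: "\<psi> \<in> ?C N\<^sub>0"
      using subgroup.m_closed[OF congruence_subgroup_subgroup[OF N\<^sub>0.normal_axioms]]
        subgroup.m_inv_closed[OF congruence_subgroup_subgroup[OF N\<^sub>0.normal_axioms]] k \<phi>0 by simp
    have "\<exists>w \<in> lcs_aux G (Suc i). ?L #> (\<psi> s \<otimes> inv s) = ?L #> (w [^] m)" if s: "s \<in> S" for s
    proof -
      have sc: "s \<in> carrier G" using s gens_closed by blast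
      have "\<psi> s \<otimes> inv s \<in> N\<^sub>0"
        using \<psi>0 IA sc N\<^sub>0.rcos_eq_iff[of "\<psi> s" s] by (simp add: congruence_subgroup_def)
      moreover have "\<psi> s \<otimes> inv s \<in> lcs_aux G (Suc i)"
        using \<psi> IA sc W.rcos_eq_iff[of "\<psi> s" s] by (simp add: congruence_subgroup_def)
      ultimately show ?thesis using N' N\<^sub>0 by blast
    qed
    then obtain w where w: "\<And>s. s \<in> S \<Longrightarrow> w s \<in> lcs_aux G (Suc i)"
      "\<And>s. s \<in> S \<Longrightarrow> ?L #> (\<psi> s \<otimes> inv s) = ?L #> (w s [^] m)" by metis
    have "w s \<in> derived G (carrier G)" if "s \<in> S" for s
      using w(1)[OF that] lcs_aux_antimono[of "Suc 0" "Suc i"] lcs_aux_1 by auto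
    \<comment> \<open>An \<open>m\<close>-th root of \<open>\<psi>\<close> modulo the next term,
      prescribed on the generators by the roots \<open>w s\<close> of the displacements.\<close>
    then obtain \<theta> where \<theta>: "\<theta> \<in> IA G" "\<And>s. s \<in> S \<Longrightarrow> \<theta> s = w s \<otimes> s"
      using IA_lift[of w] by blast
    have "lcs_aux G (Suc i) #> \<theta> x = lcs_aux G (Suc i) #> \<one>\<^bsub>IA_group G\<^esub> x" if "x \<in> carrier G" for x
    proof (rule IA_rcos_eq_on_gens[OF W.normal_axioms \<theta>(1) _ _ that])
      show "\<one>\<^bsub>IA_group G\<^esub> \<in> IA G" using A.one_closed by simp
      fix s assume s: "s \<in> S"
      then have "s \<in> carrier G" using gens_closed by blast
      then show "lcs_aux G (Suc i) #> \<theta> s = lcs_aux G (Suc i) #> \<one>\<^bsub>IA_group G\<^esub> s"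
        using \<theta>(2)[OF s] w(1)[OF s] by (simp add: W.rcos_mult_left)
    qed
    then have \<theta>C: "\<theta> \<in> ?C (lcs_aux G (Suc i))"
      using \<theta>(1) by (simp add: congruence_subgroup_def)
    let ?\<theta> = "\<theta> [^]\<^bsub>IA_group G\<^esub> m"
    have \<theta>K: "?\<theta> \<in> K" using A.FIN_power_mem(1)[OF Suc.prems] \<theta> by (simp add: m_def)
    have \<theta>m: "?\<theta> \<in> IA G" using A.nat_pow_closed[of \<theta> m] \<theta> by simp
    have "?L #> \<psi> x = ?L #> ?\<theta> x" if "x \<in> carrier G" for x
    proof (rule IA_rcos_eq_on_gens[OF L.normal_axioms IA(2) \<theta>m _ that])
      fix s assume s: "s \<in> S"
      then have sc: "s \<in> carrier G" using gens_closed by blast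
      have wc: "w s \<in> carrier G" using w(1)[OF s] lcs_aux_in_carrier by blast
      have "?L #> \<psi> s = ?L #> (\<psi> s \<otimes> inv s \<otimes> s)" using IA sc by (simp add: m_assoc)
      also have "\<dots> = ?L #> (w s [^] m \<otimes> s)"
        using w(2)[OF s] IA sc wc by (intro L.rcos_mult_cong) auto
      also have "\<dots> = ?L #> ?\<theta> s"
        using congruence_lcs_aux_power[OF \<theta>C sc w(1)[OF s] \<theta>(2)[OF s]] by simp
      finally show "?L #> \<psi> s = ?L #> ?\<theta> s" .
    qed
    then have "\<psi> \<otimes>\<^bsub>IA_group G\<^esub> inv\<^bsub>IA_group G\<^esub> ?\<theta> \<in> ?C ?L"
      using congruence_subgroup_diff[OF L.normal_axioms IA(2) \<theta>m] by blast
    \<comment> \<open>Conjugation by \<open>?\<theta>\<close> moves the inverse to the left, as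
      required for splitting off \<open>k\<close> times \<open>?\<theta>\<close> in front, which
      lies in \<open>K\<close>.\<close>
    then have "inv\<^bsub>IA_group G\<^esub> ?\<theta> \<otimes>\<^bsub>IA_group G\<^esub> (\<psi> \<otimes>\<^bsub>IA_group G\<^esub> inv\<^bsub>IA_group G\<^esub> ?\<theta>)
        \<otimes>\<^bsub>IA_group G\<^esub> ?\<theta> \<in> ?C ?L"
      using normal.inv_op_closed1[OF congruence_subgroup_normal[OF IA_invariant_lcs_aux]] \<theta>m by simp
    then have \<chi>: "inv\<^bsub>IA_group G\<^esub> ?\<theta> \<otimes>\<^bsub>IA_group G\<^esub> \<psi> \<in> ?C ?L"
      using \<theta>m IA by (simp add: A.m_assoc)
    have "\<phi> = (k \<otimes>\<^bsub>IA_group G\<^esub> ?\<theta>) \<otimes>\<^bsub>IA_group G\<^esub> (inv\<^bsub>IA_group G\<^esub> ?\<theta> \<otimes>\<^bsub>IA_group G\<^esub> \<psi>)"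
      using \<phi>_eq IA \<theta>m by (simp add: A.m_assoc)
    then show "\<phi> \<in> K <#>\<^bsub>IA_group G\<^esub> ?C ?L"
      using \<chi> K.m_closed[OF k(1) \<theta>K] unfolding set_mult_def by blast
  qed
  then show ?case
    using FIN_Int[OF N\<^sub>1(1) N\<^sub>0(1)] IA_invariant_Int[OF N\<^sub>1(2) N\<^sub>0(2)] by blast
qed

lemma congruence_subgroup_property:
  assumes K: "K \<in> FIN (IA_group G)"
  shows "\<exists>N \<in> FIN G. IA_invariant G N \<and> congruence_subgroup G N \<subseteq> K"
proof -
  interpret A: group "IA_group G" by (rule group_IA_group)
  interpret K: normal K "IA_group G" using K by (rule FIN_normal)
  \<comment> \<open>The preceding lemma speaks of successor indices; the term \<open>Suc c\<close>
    is trivial along with the term \<open>c\<close>.\<close>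
  obtain N where N: "N \<in> FIN G" "IA_invariant G N"
    "congruence_subgroup G N \<subseteq> K <#>\<^bsub>IA_group G\<^esub> congruence_subgroup G (lcs_aux G (Suc c))"
    using congruence_subgroup_property_mod_lcs_aux[OF K] by blast
  have "lcs_aux G (Suc c) = {\<one>}"
    using lcs_aux_Suc_subset[of c] nilpotent subgroup.one_closed[OF lcs_aux_subgroup[of "Suc c"]] by auto
  moreover have "\<phi> = \<one>\<^bsub>IA_group G\<^esub>" if "\<phi> \<in> congruence_subgroup G {\<one>}" for \<phi>
  proof (rule IA_ext)
    show "\<phi> \<in> IA G" "\<one>\<^bsub>IA_group G\<^esub> \<in> IA G"
      using that A.one_closed by (simp_all add: congruence_subgroup_def)
    fix x assume "x \<in> carrier G"
    then show "\<phi> x = \<one>\<^bsub>IA_group G\<^esub> x"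
      using that \<open>\<phi> \<in> IA G\<close> by (simp add: congruence_subgroup_def r_coset_def)
  qed
  ultimately have "K <#>\<^bsub>IA_group G\<^esub> congruence_subgroup G (lcs_aux G (Suc c)) \<subseteq> K"
    using K.mem_carrier A.r_one unfolding set_mult_def by fastforce
  then show ?thesis using N by blast
qed

end

section \<open>Profinite completions\<close>

context group
begin

lemma completion_rcosets: "\<xi> \<in> carrier (completion G) \<Longrightarrow> N \<in> FIN G \<Longrightarrow> \<xi> N \<in> rcosets N"
  by (simp add: completion_def)

lemma completion_mono:
  "\<lbrakk>\<xi> \<in> carrier (completion G); N \<in> FIN G; M \<in> FIN G; N \<subseteq> M\<rbrakk> \<Longrightarrow> \<xi> N \<subseteq> \<xi> M"
  by (simp add: completion_def)

lemma completion_mem_carrier: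
  assumes "\<xi> \<in> carrier (completion G)" "N \<in> FIN G" "x \<in> \<xi> N"
  shows "x \<in> carrier G"
  using subgroup.rcosets_carrier[OF normal_imp_subgroup[OF FIN_normal[OF assms(2)]] is_group]
    completion_rcosets[OF assms(1,2)] assms(3) by blast

lemma completion_eq_rcos:
  assumes "\<xi> \<in> carrier (completion G)" "N \<in> FIN G" "x \<in> \<xi> N"
  shows "\<xi> N = N #> x"
  using normal.rcoset_eq_of_mem[OF FIN_normal[OF assms(2)] completion_rcosets[OF assms(1,2)] assms(3)] .

lemma completion_obtain:
  assumes "\<xi> \<in> carrier (completion G)" "N \<in> FIN G"
  obtains x where "x \<in> \<xi> N" "x \<in> carrier G" "\<xi> N = N #> x"
proof -
  obtain x where "x \<in> \<xi> N"
    using completion_rcosets[OF assms] subgroup.rcosets_non_empty[OF normal_imp_subgroup[OF FIN_normal[OF assms(2)]]]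
    by (metis ex_in_conv)
  then show thesis
    using that completion_mem_carrier[OF assms] completion_eq_rcos[OF assms] by blast
qed

lemma rcos_self_FIN: "N \<in> FIN G \<Longrightarrow> x \<in> carrier G \<Longrightarrow> x \<in> N #> x"
  using rcos_self normal_imp_subgroup[OF FIN_normal] by blast

text \<open>Compatibility is checked by a common representative at both levels, which is how
  elements of the completion are built and used below; inclusion of the cosets follows.\<close>

lemma completion_I:
  assumes "\<xi> \<in> extensional (FIN G)"
    and "\<And>N. N \<in> FIN G \<Longrightarrow> \<exists>x \<in> carrier G. \<xi> N = N #> x"
    and "\<And>N M. \<lbrakk>N \<in> FIN G; M \<in> FIN G; N \<subseteq> M\<rbrakk> \<Longrightarrow> \<exists>x \<in> carrier G. \<xi> N = N #> x \<and> \<xi> M = M #> x"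
  shows "\<xi> \<in> carrier (completion G)"
proof -
  have "\<xi> N \<in> rcosets N" if "N \<in> FIN G" for N
    using assms(2)[OF that] rcos_mem_rcosets by auto
  moreover have "\<xi> N \<subseteq> \<xi> M" if NM: "N \<in> FIN G" "M \<in> FIN G" "N \<subseteq> M" for N M
  proof -
    obtain x where "\<xi> N = N #> x" "\<xi> M = M #> x" using assms(3)[OF NM] by blast
    then show ?thesis using NM(3) by (simp add: r_coset_def) blast
  qed
  ultimately show ?thesis using assms(1) by (simp add: completion_def)
qed

lemma completion_ext:
  assumes "\<xi> \<in> carrier (completion G)" "\<zeta> \<in> carrier (completion G)"
    and "\<And>N. N \<in> FIN G \<Longrightarrow> \<xi> N = \<zeta> N"
  shows "\<xi> = \<zeta>"
  by (rule extensionalityI[of _ "FIN G"]) (use assms in \<open>simp_all add: completion_def\<close>)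

lemma completion_mult: "N \<in> FIN G \<Longrightarrow> (\<xi> \<otimes>\<^bsub>completion G\<^esub> \<zeta>) N = \<xi> N <#> \<zeta> N"
  by (simp add: completion_def)

lemma completion_one: "N \<in> FIN G \<Longrightarrow> \<one>\<^bsub>completion G\<^esub> N = N"
  by (simp add: completion_def)

lemma completion_mult_rcos:
  assumes "\<xi> N = N #> x" "\<zeta> N = N #> y" "x \<in> carrier G" "y \<in> carrier G" "N \<in> FIN G"
  shows "(\<xi> \<otimes>\<^bsub>completion G\<^esub> \<zeta>) N = N #> (x \<otimes> y)"
  using assms by (simp add: completion_mult normal.rcos_sum[OF FIN_normal[OF assms(5)]])

lemma completion_mult_mem:
  assumes "x \<in> \<xi> N" "y \<in> \<zeta> N" "N \<in> FIN G"
  shows "x \<otimes> y \<in> (\<xi> \<otimes>\<^bsub>completion G\<^esub> \<zeta>) N"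
  using assms by (auto simp: completion_mult set_mult_def)

lemma completion_common:
  assumes \<xi>: "\<xi> \<in> carrier (completion G)" and NM: "N \<in> FIN G" "M \<in> FIN G" "N \<subseteq> M"
  obtains x where "x \<in> carrier G" "\<xi> N = N #> x" "\<xi> M = M #> x"
proof -
  obtain x where x: "x \<in> \<xi> N" "x \<in> carrier G" "\<xi> N = N #> x"
    using completion_obtain[OF \<xi> NM(1)] .
  then have "\<xi> M = M #> x"
    using completion_eq_rcos[OF \<xi> NM(2)] completion_mono[OF \<xi> NM] by blast
  then show thesis using that x by blast
qed

lemma completion_mult_closed:
  assumes \<xi>: "\<xi> \<in> carrier (completion G)" and \<zeta>: "\<zeta> \<in> carrier (completion G)"
  shows "\<xi> \<otimes>\<^bsub>completion G\<^esub> \<zeta> \<in> carrier (completion G)"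
proof (rule completion_I)
  show "\<xi> \<otimes>\<^bsub>completion G\<^esub> \<zeta> \<in> extensional (FIN G)" by (simp add: completion_def)
next
  have *: "\<exists>x \<in> carrier G. (\<xi> \<otimes>\<^bsub>completion G\<^esub> \<zeta>) N = N #> x \<and> (\<xi> \<otimes>\<^bsub>completion G\<^esub> \<zeta>) M = M #> x"
    if NM: "N \<in> FIN G" "M \<in> FIN G" "N \<subseteq> M" for N M
  proof -
    obtain x where "x \<in> carrier G" "\<xi> N = N #> x" "\<xi> M = M #> x" using completion_common[OF \<xi> NM] .
    moreover obtain y where "y \<in> carrier G" "\<zeta> N = N #> y" "\<zeta> M = M #> y" using completion_common[OF \<zeta> NM] .
    ultimately show ?thesis using NM completion_mult_rcos by (meson m_closed)
  qed
  then show "\<exists>x \<in> carrier G. (\<xi> \<otimes>\<^bsub>completion G\<^esub> \<zeta>) N = N #> x \<and> (\<xi> \<otimes>\<^bsub>completion G\<^esub> \<zeta>) M = M #> x"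
    if "N \<in> FIN G" "M \<in> FIN G" "N \<subseteq> M" for N M using that .
  show "\<exists>x \<in> carrier G. (\<xi> \<otimes>\<^bsub>completion G\<^esub> \<zeta>) N = N #> x" if "N \<in> FIN G" for N
    using *[OF that that] by blast
qed

lemma completion_one_closed: "\<one>\<^bsub>completion G\<^esub> \<in> carrier (completion G)"
proof (rule completion_I)
  have "N = N #> \<one>" if "N \<in> FIN G" for N
    using normal_imp_subgroup[OF FIN_normal[OF that]] subgroup.subset by fastforce
  then show "\<exists>x \<in> carrier G. \<one>\<^bsub>completion G\<^esub> N = N #> x" if "N \<in> FIN G" for N
    using that completion_one by auto
  show "\<exists>x \<in> carrier G. \<one>\<^bsub>completion G\<^esub> N = N #> x \<and> \<one>\<^bsub>completion G\<^esub> M = M #> x"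
    if "N \<in> FIN G" "M \<in> FIN G" "N \<subseteq> M" for N M
    using that \<open>\<And>N. N \<in> FIN G \<Longrightarrow> N = N #> \<one>\<close> completion_one by (intro bexI[of _ \<one>]) auto
qed (simp add: completion_def)

lemma group_completion: "group (completion G)"
proof (rule groupI)
  show "x \<otimes>\<^bsub>completion G\<^esub> y \<in> carrier (completion G)"
    if "x \<in> carrier (completion G)" "y \<in> carrier (completion G)" for x y
    using completion_mult_closed that .
  show "\<one>\<^bsub>completion G\<^esub> \<in> carrier (completion G)" by (rule completion_one_closed)
next
  fix \<xi> \<zeta> \<chi>
  assume h: "\<xi> \<in> carrier (completion G)" "\<zeta> \<in> carrier (completion G)" "\<chi> \<in> carrier (completion G)"
  show "\<xi> \<otimes>\<^bsub>completion G\<^esub> \<zeta> \<otimes>\<^bsub>completion G\<^esub> \<chi> = \<xi> \<otimes>\<^bsub>completion G\<^esub> (\<zeta> \<otimes>\<^bsub>completion G\<^esub> \<chi>)"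
  proof (rule completion_ext)
    fix N assume N: "N \<in> FIN G"
    have "\<xi> N \<subseteq> carrier G" "\<zeta> N \<subseteq> carrier G" "\<chi> N \<subseteq> carrier G"
      using h N completion_mem_carrier by blast+
    then show "(\<xi> \<otimes>\<^bsub>completion G\<^esub> \<zeta> \<otimes>\<^bsub>completion G\<^esub> \<chi>) N = (\<xi> \<otimes>\<^bsub>completion G\<^esub> (\<zeta> \<otimes>\<^bsub>completion G\<^esub> \<chi>)) N"
      using N by (simp add: completion_mult set_mult_assoc)
  qed (use h completion_mult_closed in blast)+
next
  fix \<xi> assume \<xi>: "\<xi> \<in> carrier (completion G)"
  show "\<one>\<^bsub>completion G\<^esub> \<otimes>\<^bsub>completion G\<^esub> \<xi> = \<xi>"
  proof (rule completion_ext)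
    fix N assume N: "N \<in> FIN G"
    then show "(\<one>\<^bsub>completion G\<^esub> \<otimes>\<^bsub>completion G\<^esub> \<xi>) N = \<xi> N"
      using normal.rcosets_mult_eq[OF FIN_normal[OF N] completion_rcosets[OF \<xi> N]]
      by (simp add: completion_mult completion_one)
  qed (use \<xi> completion_mult_closed completion_one_closed in blast)+
  let ?\<zeta> = "\<lambda>N\<in>FIN G. set_inv (\<xi> N)"
  have inv: "?\<zeta> N = N #> inv x" if "N \<in> FIN G" "\<xi> N = N #> x" "x \<in> carrier G" for N x
    using that normal.rcos_inv[OF FIN_normal[OF that(1)]] by simp
  have \<zeta>: "?\<zeta> \<in> carrier (completion G)"
  proof (rule completion_I)
    show "\<exists>x \<in> carrier G. ?\<zeta> N = N #> x \<and> ?\<zeta> M = M #> x"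
      if NM: "N \<in> FIN G" "M \<in> FIN G" "N \<subseteq> M" for N M
    proof -
      obtain x where "x \<in> carrier G" "\<xi> N = N #> x" "\<xi> M = M #> x" using completion_common[OF \<xi> NM] .
      then show ?thesis using inv NM by (meson inv_closed)
    qed
    from this show "\<exists>x \<in> carrier G. ?\<zeta> N = N #> x" if "N \<in> FIN G" for N using that by blast
  qed simp
  moreover have "?\<zeta> \<otimes>\<^bsub>completion G\<^esub> \<xi> = \<one>\<^bsub>completion G\<^esub>"
  proof (rule completion_ext)
    fix N assume N: "N \<in> FIN G"
    obtain x where x: "x \<in> carrier G" "\<xi> N = N #> x" using completion_obtain[OF \<xi> N] .
    have "(?\<zeta> \<otimes>\<^bsub>completion G\<^esub> \<xi>) N = N #> (inv x \<otimes> x)"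
      using x N inv[OF N x(2,1)] by (intro completion_mult_rcos) auto
    then show "(?\<zeta> \<otimes>\<^bsub>completion G\<^esub> \<xi>) N = \<one>\<^bsub>completion G\<^esub> N"
      using x N normal.rcos_eq_self_iff[OF FIN_normal[OF N], of \<one>]
        subgroup.one_closed[OF normal_imp_subgroup[OF FIN_normal[OF N]]]
      by (simp add: completion_one)
  qed (use \<xi> \<zeta> completion_mult_closed completion_one_closed in blast)+
  ultimately show "\<exists>\<zeta>\<in>carrier (completion G). \<zeta> \<otimes>\<^bsub>completion G\<^esub> \<xi> = \<one>\<^bsub>completion G\<^esub>" by blast
qed

lemma eta_apply: "N \<in> FIN G \<Longrightarrow> eta G x N = N #> x"
  by (simp add: eta_def)

lemma eta_closed: "x \<in> carrier G \<Longrightarrow> eta G x \<in> carrier (completion G)"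
  by (rule completion_I) (auto simp: eta_def)

lemma eta_hom: "eta G \<in> hom G (completion G)"
proof (rule homI)
  fix x y assume xy: "x \<in> carrier G" "y \<in> carrier G"
  show "eta G (x \<otimes> y) = eta G x \<otimes>\<^bsub>completion G\<^esub> eta G y"
  proof (rule completion_ext)
    fix N assume N: "N \<in> FIN G"
    show "eta G (x \<otimes> y) N = (eta G x \<otimes>\<^bsub>completion G\<^esub> eta G y) N"
      using completion_mult_rcos[of "eta G x" N x "eta G y" y] xy N by (simp add: eta_apply)
  qed (use xy eta_closed completion_mult_closed in auto)
qed (rule eta_closed)

end

lemma (in group) rcos_eq_mono:
  assumes "N \<lhd> G" "M \<lhd> G" "N \<subseteq> M" "x \<in> carrier G" "y \<in> carrier G" "N #> x = N #> y"
  shows "M #> x = M #> y"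
  using normal.rcos_eq_iff[OF assms(1,4,5)] normal.rcos_eq_iff[OF assms(2,4,5)] assms(3,6) by blast

section \<open>The natural map\<close>

lemma auto_completion_closed:
  "\<alpha> \<in> auto (completion G) \<Longrightarrow> \<xi> \<in> carrier (completion G) \<Longrightarrow> \<alpha> \<xi> \<in> carrier (completion G)"
  by (auto simp: auto_def hom_def)

context finitely_generated_group
begin

text \<open>The value at \<open>N\<close> is computed modulo the core of \<open>N\<close>, where the action of a coset of the
  congruence subgroup is defined.\<close>
definition IA_completion_map ::
  "(('a \<Rightarrow> 'a) set \<Rightarrow> ('a \<Rightarrow> 'a) set) \<Rightarrow> ('a set \<Rightarrow> 'a set) \<Rightarrow> 'a set \<Rightarrow> 'a set" where
  "IA_completion_map \<zeta> = (\<lambda>\<xi> \<in> carrier (completion G). \<lambda>N \<in> FIN G.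
     \<Union>\<phi> \<in> \<zeta> (congruence_subgroup G (IA_core N)). \<Union>g \<in> \<xi> (IA_core N). N #> \<phi> g)"

text \<open>Independence of representatives and of the level. Passing from \<open>\<phi>\<close> to
  \<open>\<psi>\<close> uses that both lie in one coset of the congruence subgroup; passing from
  \<open>x\<close> to \<open>y\<close> uses that \<open>N\<close> is IA-invariant.\<close>

lemma IA_completion_rcos_eq:
  assumes \<zeta>: "\<zeta> \<in> carrier (completion (IA_group G))" and \<xi>: "\<xi> \<in> carrier (completion G)"
    and N: "N \<in> FIN G" "IA_invariant G N" and M: "M \<in> FIN G" "IA_invariant G M" "M \<subseteq> N"
    and \<phi>: "\<phi> \<in> \<zeta> (congruence_subgroup G N)" and x: "x \<in> \<xi> N"
    and \<psi>: "\<psi> \<in> \<zeta> (congruence_subgroup G M)" and y: "y \<in> \<xi> M"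
  shows "N #> \<phi> x = N #> \<psi> y"
proof -
  interpret A: group "IA_group G" by (rule group_IA_group)
  let ?C = "congruence_subgroup G"
  note CN = congruence_subgroup_FIN[OF N] and CM = congruence_subgroup_FIN[OF M(1,2)]
  have "?C M \<subseteq> ?C N"
    using congruence_subgroup_mono[OF FIN_normal[OF M(1)] FIN_normal[OF N(1)] M(3)] .
  then have \<psi>N: "\<psi> \<in> \<zeta> (?C N)" using A.completion_mono[OF \<zeta> CM CN] \<psi> by blast
  have IA: "\<phi> \<in> IA G" "\<psi> \<in> IA G"
    using A.completion_mem_carrier[OF \<zeta> CN] \<phi> \<psi>N by auto
  have yN: "y \<in> \<xi> N" using completion_mono[OF \<xi> M(1) N(1) M(3)] y by blast
  have c: "x \<in> carrier G" "y \<in> carrier G" using completion_mem_carrier[OF \<xi> N(1)] x yN by auto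
  have "?C N #>\<^bsub>IA_group G\<^esub> \<phi> = ?C N #>\<^bsub>IA_group G\<^esub> \<psi>"
    using A.completion_eq_rcos[OF \<zeta> CN \<phi>] A.completion_eq_rcos[OF \<zeta> CN \<psi>N] by simp
  then have "\<phi> \<otimes>\<^bsub>IA_group G\<^esub> inv\<^bsub>IA_group G\<^esub> \<psi> \<in> ?C N"
    using normal.rcos_eq_iff[OF FIN_normal[OF CN], of \<phi> \<psi>] IA by simp
  then have "N #> \<phi> x = N #> \<psi> x"
    using congruence_subgroup_diff[OF FIN_normal[OF N(1)] IA] c by blast
  also have "N #> x = N #> y"
    using completion_eq_rcos[OF \<xi> N(1) x] completion_eq_rcos[OF \<xi> N(1) yN] by simp
  then have "N #> \<psi> x = N #> \<psi> y"
    using IA_rcos_cong[OF N(2) IA(2) c] by blast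
  finally show ?thesis .
qed

lemma IA_core_props:
  assumes "N \<in> FIN G"
  shows "IA_core N \<in> FIN G" "IA_invariant G (IA_core N)" "IA_core N \<subseteq> N"
  using IA_core_FIN[OF assms] IA_invariant_IA_core[OF FIN_normal[OF assms]] IA_core_subset by auto

text \<open>Frees the computation from the core in the definition: any invariant level
  \<open>M\<close> inside \<open>N\<close> serves. Both levels are compared with their intersection,
  and the unions in the definition collapse because all cosets in them are equal.\<close>

lemma IA_completion_map_eq:
  assumes \<zeta>: "\<zeta> \<in> carrier (completion (IA_group G))" and \<xi>: "\<xi> \<in> carrier (completion G)"
    and N: "N \<in> FIN G" and M: "M \<in> FIN G" "IA_invariant G M" "M \<subseteq> N"
    and \<phi>: "\<phi> \<in> \<zeta> (congruence_subgroup G M)" and x: "x \<in> \<xi> M"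
  shows "IA_completion_map \<zeta> \<xi> N = N #> \<phi> x"
proof -
  interpret A: group "IA_group G" by (rule group_IA_group)
  let ?C = "congruence_subgroup G"
  let ?N = "IA_core N"
  note core = IA_core_props[OF N]
  have I: "?N \<inter> M \<in> FIN G" "IA_invariant G (?N \<inter> M)"
    using FIN_Int[OF core(1) M(1)] IA_invariant_Int[OF core(2) M(2)] .
  obtain \<psi> where \<psi>: "\<psi> \<in> \<zeta> (?C (?N \<inter> M))" "\<psi> \<in> IA G"
    using A.completion_obtain[OF \<zeta> congruence_subgroup_FIN[OF I]] by auto
  obtain y where y: "y \<in> \<xi> (?N \<inter> M)" "y \<in> carrier G"
    using completion_obtain[OF \<xi> I(1)] .
  have coset: "N #> \<phi> x = N #> \<psi> y"
    if K: "K \<in> FIN G" "IA_invariant G K" "K \<subseteq> N" "?N \<inter> M \<subseteq> K"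
      and \<phi>: "\<phi> \<in> \<zeta> (?C K)" and x: "x \<in> \<xi> K" for K \<phi> x
  proof (rule rcos_eq_mono[OF FIN_normal[OF K(1)] FIN_normal[OF N] K(3)])
    show "K #> \<phi> x = K #> \<psi> y"
      using IA_completion_rcos_eq[OF \<zeta> \<xi> K(1,2) I K(4) \<phi> x \<psi>(1) y(1)] .
    show "\<phi> x \<in> carrier G"
      using A.completion_mem_carrier[OF \<zeta> congruence_subgroup_FIN[OF K(1,2)] \<phi>]
        completion_mem_carrier[OF \<xi> K(1) x] by simp
    show "\<psi> y \<in> carrier G" using \<psi> y by simp
  qed
  have c: "N #> \<phi>' x' = N #> \<psi> y" if "\<phi>' \<in> \<zeta> (?C ?N)" "x' \<in> \<xi> ?N" for \<phi>' x'
    using coset[OF core _ that] by blast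
  obtain \<phi>\<^sub>0 where \<phi>\<^sub>0: "\<phi>\<^sub>0 \<in> \<zeta> (?C ?N)"
    using A.completion_obtain[OF \<zeta> congruence_subgroup_FIN[OF core(1,2)]] by auto
  obtain x\<^sub>0 where x\<^sub>0: "x\<^sub>0 \<in> \<xi> ?N" using completion_obtain[OF \<xi> core(1)] .
  have "IA_completion_map \<zeta> \<xi> N = (\<Union>\<phi> \<in> \<zeta> (?C ?N). \<Union>g \<in> \<xi> ?N. N #> \<phi> g)"
    using \<xi> N by (simp add: IA_completion_map_def)
  also have "\<dots> = (\<Union>\<phi> \<in> \<zeta> (?C ?N). \<Union>g \<in> \<xi> ?N. N #> \<psi> y)"
    using c by (intro SUP_cong refl)
  also have "\<dots> = N #> \<psi> y" using \<phi>\<^sub>0 x\<^sub>0 by auto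
  also have "\<dots> = N #> \<phi> x" using coset[OF M _ \<phi> x] by blast
  finally show ?thesis .
qed

lemma IA_completion_map_obtain:
  assumes \<zeta>: "\<zeta> \<in> carrier (completion (IA_group G))" and N: "N \<in> FIN G"
  obtains M \<phi> where "M \<in> FIN G" "IA_invariant G M" "M \<subseteq> N" "\<phi> \<in> IA G"
    "\<phi> \<in> \<zeta> (congruence_subgroup G M)"
proof -
  note core = IA_core_props[OF N]
  interpret A: group "IA_group G" by (rule group_IA_group)
  obtain \<phi> where "\<phi> \<in> \<zeta> (congruence_subgroup G (IA_core N))" "\<phi> \<in> IA G"
    using A.completion_obtain[OF \<zeta> congruence_subgroup_FIN[OF core(1,2)]] by auto
  then show thesis using that core by blast
qed

lemma IA_completion_map_closed:
  assumes \<zeta>: "\<zeta> \<in> carrier (completion (IA_group G))" and \<xi>: "\<xi> \<in> carrier (completion G)"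
  shows "IA_completion_map \<zeta> \<xi> \<in> carrier (completion G)"
proof (rule completion_I)
  show "IA_completion_map \<zeta> \<xi> \<in> extensional (FIN G)"
    using \<xi> by (simp add: IA_completion_map_def)
next
  have *: "\<exists>x \<in> carrier G. IA_completion_map \<zeta> \<xi> N = N #> x \<and> IA_completion_map \<zeta> \<xi> M = M #> x"
    if NM: "N \<in> FIN G" "M \<in> FIN G" "N \<subseteq> M" for N M
  proof -
    obtain K \<phi> where K: "K \<in> FIN G" "IA_invariant G K" "K \<subseteq> N" and \<phi>: "\<phi> \<in> IA G"
      "\<phi> \<in> \<zeta> (congruence_subgroup G K)" using IA_completion_map_obtain[OF \<zeta> NM(1)] .
    obtain x where x: "x \<in> \<xi> K" "x \<in> carrier G" using completion_obtain[OF \<xi> K(1)] .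
    have "K \<subseteq> M" using K NM by blast
    then show ?thesis
      using IA_completion_map_eq[OF \<zeta> \<xi> NM(1) K \<phi>(2) x(1)]
        IA_completion_map_eq[OF \<zeta> \<xi> NM(2) K(1,2) _ \<phi>(2) x(1)] \<phi>(1) x(2)
      by (intro bexI[of _ "\<phi> x"]) simp_all
  qed
  show "\<exists>x \<in> carrier G. IA_completion_map \<zeta> \<xi> N = N #> x \<and> IA_completion_map \<zeta> \<xi> M = M #> x"
    if "N \<in> FIN G" "M \<in> FIN G" "N \<subseteq> M" for N M using *[OF that] .
  show "\<exists>x \<in> carrier G. IA_completion_map \<zeta> \<xi> N = N #> x" if "N \<in> FIN G" for N
    using *[OF that that] by blast
qed

lemma IA_completion_map_hom:
  assumes \<zeta>: "\<zeta> \<in> carrier (completion (IA_group G))"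
  shows "IA_completion_map \<zeta> \<in> hom (completion G) (completion G)"
proof (rule homI)
  fix \<xi> \<chi> assume \<xi>: "\<xi> \<in> carrier (completion G)" and \<chi>: "\<chi> \<in> carrier (completion G)"
  show "IA_completion_map \<zeta> (\<xi> \<otimes>\<^bsub>completion G\<^esub> \<chi>)
      = IA_completion_map \<zeta> \<xi> \<otimes>\<^bsub>completion G\<^esub> IA_completion_map \<zeta> \<chi>"
  proof (rule completion_ext)
    fix N assume N: "N \<in> FIN G"
    obtain K \<phi> where K: "K \<in> FIN G" "IA_invariant G K" "K \<subseteq> N" and \<phi>: "\<phi> \<in> IA G"
      "\<phi> \<in> \<zeta> (congruence_subgroup G K)" using IA_completion_map_obtain[OF \<zeta> N] .
    obtain x where x: "x \<in> \<xi> K" "x \<in> carrier G" using completion_obtain[OF \<xi> K(1)] .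
    obtain y where y: "y \<in> \<chi> K" "y \<in> carrier G" using completion_obtain[OF \<chi> K(1)] .
    have "IA_completion_map \<zeta> (\<xi> \<otimes>\<^bsub>completion G\<^esub> \<chi>) N = N #> \<phi> (x \<otimes> y)"
      using IA_completion_map_eq[OF \<zeta> completion_mult_closed[OF \<xi> \<chi>] N K \<phi>(2)
          completion_mult_mem[of x \<xi> K y \<chi>, OF x(1) y(1) K(1)]] .
    also have "\<phi> (x \<otimes> y) = \<phi> x \<otimes> \<phi> y"
      using IA_hom[OF \<phi>(1)] x y by (simp add: hom_mult)
    finally show "IA_completion_map \<zeta> (\<xi> \<otimes>\<^bsub>completion G\<^esub> \<chi>) N
        = (IA_completion_map \<zeta> \<xi> \<otimes>\<^bsub>completion G\<^esub> IA_completion_map \<zeta> \<chi>) N"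
      using completion_mult_rcos[of "IA_completion_map \<zeta> \<xi>" N _ "IA_completion_map \<zeta> \<chi>",
          OF IA_completion_map_eq[OF \<zeta> \<xi> N K \<phi>(2) x(1)]
          IA_completion_map_eq[OF \<zeta> \<chi> N K \<phi>(2) y(1)]] \<phi>(1) x y N by simp
  qed (use \<xi> \<chi> \<zeta> in \<open>simp_all add: IA_completion_map_closed completion_mult_closed\<close>)
qed (rule IA_completion_map_closed[OF \<zeta>])

lemma IA_completion_map_mult:
  assumes \<zeta>: "\<zeta> \<in> carrier (completion (IA_group G))" and \<omega>: "\<omega> \<in> carrier (completion (IA_group G))"
    and \<xi>: "\<xi> \<in> carrier (completion G)"
  shows "IA_completion_map (\<zeta> \<otimes>\<^bsub>completion (IA_group G)\<^esub> \<omega>) \<xi>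
    = IA_completion_map \<zeta> (IA_completion_map \<omega> \<xi>)"
proof -
  interpret A: group "IA_group G" by (rule group_IA_group)
  note \<zeta>\<omega> = A.completion_mult_closed[OF \<zeta> \<omega>]
  show ?thesis
  proof (rule completion_ext)
    fix N assume N: "N \<in> FIN G"
    obtain K \<phi> where K: "K \<in> FIN G" "IA_invariant G K" "K \<subseteq> N" and \<phi>: "\<phi> \<in> IA G"
      "\<phi> \<in> \<zeta> (congruence_subgroup G K)" using IA_completion_map_obtain[OF \<zeta> N] .
    obtain \<psi> where \<psi>: "\<psi> \<in> \<omega> (congruence_subgroup G K)" "\<psi> \<in> IA G"
      using A.completion_obtain[OF \<omega> congruence_subgroup_FIN[OF K(1,2)]] by auto
    obtain x where x: "x \<in> \<xi> K" "x \<in> carrier G" using completion_obtain[OF \<xi> K(1)] .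
    \<comment> \<open>The inner value is needed at the invariant level \<open>K\<close>, not only at
      \<open>N\<close>, before \<open>\<phi>\<close> may act on its representative.\<close>
    have "\<psi> x \<in> IA_completion_map \<omega> \<xi> K"
      using IA_completion_map_eq[OF \<omega> \<xi> K(1) K(1,2) order.refl \<psi>(1) x(1)] rcos_self_FIN[OF K(1)] \<psi> x by simp
    then have "IA_completion_map \<zeta> (IA_completion_map \<omega> \<xi>) N = N #> \<phi> (\<psi> x)"
      using IA_completion_map_eq[OF \<zeta> IA_completion_map_closed[OF \<omega> \<xi>] N K \<phi>(2)] by blast
    moreover have "IA_completion_map (\<zeta> \<otimes>\<^bsub>completion (IA_group G)\<^esub> \<omega>) \<xi> N
        = N #> (\<phi> \<otimes>\<^bsub>IA_group G\<^esub> \<psi>) x"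
      using IA_completion_map_eq[OF \<zeta>\<omega> \<xi> N K
          A.completion_mult_mem[of \<phi> \<zeta> _ \<psi> \<omega>, OF \<phi>(2) \<psi>(1) congruence_subgroup_FIN[OF K(1,2)]] x(1)] .
    ultimately show "IA_completion_map (\<zeta> \<otimes>\<^bsub>completion (IA_group G)\<^esub> \<omega>) \<xi> N
        = IA_completion_map \<zeta> (IA_completion_map \<omega> \<xi>) N"
      using \<phi> \<psi> x by simp
  qed (use \<xi> \<zeta> \<omega> \<zeta>\<omega> in \<open>simp_all add: IA_completion_map_closed\<close>)
qed

text \<open>Serves both the identity element and the continuity of the map.\<close>

lemma IA_completion_map_trivial:
  assumes \<zeta>: "\<zeta> \<in> carrier (completion (IA_group G))" and \<xi>: "\<xi> \<in> carrier (completion G)"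
    and N: "N \<in> FIN G" and M: "M \<in> FIN G" "IA_invariant G M" "M \<subseteq> N"
    and triv: "\<zeta> (congruence_subgroup G M) = congruence_subgroup G M"
  shows "IA_completion_map \<zeta> \<xi> N = \<xi> N"
proof -
  interpret A: group "IA_group G" by (rule group_IA_group)
  obtain x where x: "x \<in> \<xi> M" "x \<in> carrier G" using completion_obtain[OF \<xi> M(1)] .
  have "\<one>\<^bsub>IA_group G\<^esub> \<in> \<zeta> (congruence_subgroup G M)"
    using triv subgroup.one_closed[OF congruence_subgroup_subgroup[OF FIN_normal[OF M(1)]]] by simp
  then have "IA_completion_map \<zeta> \<xi> N = N #> \<one>\<^bsub>IA_group G\<^esub> x"
    using IA_completion_map_eq[OF \<zeta> \<xi> N M _ x(1)] by blast
  also have "\<dots> = \<xi> N"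
    using completion_eq_rcos[OF \<xi> N, of x] completion_mono[OF \<xi> M(1) N M(3)] x by auto
  finally show ?thesis .
qed

lemma IA_completion_map_one:
  assumes \<xi>: "\<xi> \<in> carrier (completion G)"
  shows "IA_completion_map \<one>\<^bsub>completion (IA_group G)\<^esub> \<xi> = \<xi>"
proof -
  interpret A: group "IA_group G" by (rule group_IA_group)
  show ?thesis
  proof (rule completion_ext[OF IA_completion_map_closed[OF A.completion_one_closed \<xi>] \<xi>])
    fix N assume N: "N \<in> FIN G"
    show "IA_completion_map \<one>\<^bsub>completion (IA_group G)\<^esub> \<xi> N = \<xi> N"
      using IA_completion_map_trivial[OF A.completion_one_closed \<xi> N IA_core_props[OF N]]
        A.completion_one[OF congruence_subgroup_FIN[OF IA_core_props(1,2)[OF N]]] by blast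
  qed
qed

lemma IA_completion_map_auto:
  assumes \<zeta>: "\<zeta> \<in> carrier (completion (IA_group G))"
  shows "IA_completion_map \<zeta> \<in> auto (completion G)"
proof -
  interpret A: group "IA_group G" by (rule group_IA_group)
  interpret AC: group "completion (IA_group G)" by (rule A.group_completion)
  let ?\<omega> = "inv\<^bsub>completion (IA_group G)\<^esub> \<zeta>"
  have \<omega>: "?\<omega> \<in> carrier (completion (IA_group G))" using \<zeta> by simp
  have "bij_betw (IA_completion_map \<zeta>) (carrier (completion G)) (carrier (completion G))"
  proof (rule bij_betw_byWitness[where f' = "IA_completion_map ?\<omega>"])
    show "\<forall>\<xi>\<in>carrier (completion G). IA_completion_map ?\<omega> (IA_completion_map \<zeta> \<xi>) = \<xi>"
      using IA_completion_map_mult[OF \<omega> \<zeta>] AC.l_inv[OF \<zeta>] IA_completion_map_one by simp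
    show "\<forall>\<xi>\<in>carrier (completion G). IA_completion_map \<zeta> (IA_completion_map ?\<omega> \<xi>) = \<xi>"
      using IA_completion_map_mult[OF \<zeta> \<omega>] AC.r_inv[OF \<zeta>] IA_completion_map_one by simp
  qed (use IA_completion_map_closed \<zeta> \<omega> in auto)
  moreover have "IA_completion_map \<zeta> \<in> extensional (carrier (completion G))"
    by (simp add: IA_completion_map_def)
  ultimately show ?thesis
    using IA_completion_map_hom[OF \<zeta>] by (simp add: auto_def Bij_def)
qed

lemma IA_completion_map_IA_hat:
  assumes \<zeta>: "\<zeta> \<in> carrier (completion (IA_group G))"
  shows "IA_completion_map \<zeta> \<in> IA_hat G"
proof -
  interpret A: group "IA_group G" by (rule group_IA_group)
  have "\<exists>M \<in> FIN G. IA_completion_map \<zeta> ` open_nbhd G M \<subseteq> open_nbhd G N" if N: "N \<in> FIN G" for N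
  proof -
    obtain K \<phi> where K: "K \<in> FIN G" "IA_invariant G K" "K \<subseteq> N" and \<phi>: "\<phi> \<in> IA G"
      "\<phi> \<in> \<zeta> (congruence_subgroup G K)" using IA_completion_map_obtain[OF \<zeta> N] .
    have "IA_completion_map \<zeta> \<xi> \<in> open_nbhd G N" if "\<xi> \<in> open_nbhd G K" for \<xi>
    proof -
      have \<xi>: "\<xi> \<in> carrier (completion G)" "\<xi> K = K" using that by (simp_all add: open_nbhd_def)
      have "\<one> \<in> \<xi> K" using \<xi> subgroup.one_closed[OF normal_imp_subgroup[OF FIN_normal[OF K(1)]]] by simp
      then have "IA_completion_map \<zeta> \<xi> N = N #> \<phi> \<one>"
        using IA_completion_map_eq[OF \<zeta> \<xi>(1) N K \<phi>(2)] by blast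
      also have "\<dots> = N"
        using group_hom.hom_one[OF IA_group_hom[OF \<phi>(1)]] normal_imp_subgroup[OF FIN_normal[OF N]]
          subgroup.subset by fastforce
      finally show ?thesis using IA_completion_map_closed[OF \<zeta> \<xi>(1)] by (simp add: open_nbhd_def)
    qed
    then show ?thesis using K by blast
  qed
  moreover have "IA_completion_map \<zeta> \<xi> N = \<xi> N"
    if \<xi>: "\<xi> \<in> carrier (completion G)" and N: "N \<in> FIN G" "derived G (carrier G) \<subseteq> N" for \<xi> N
  proof -
    obtain K \<phi> where K: "K \<in> FIN G" "IA_invariant G K" "K \<subseteq> N" and \<phi>: "\<phi> \<in> IA G"
      "\<phi> \<in> \<zeta> (congruence_subgroup G K)" using IA_completion_map_obtain[OF \<zeta> N(1)] .
    obtain x where x: "x \<in> \<xi> K" "x \<in> carrier G" using completion_obtain[OF \<xi> K(1)] .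
    have "IA_completion_map \<zeta> \<xi> N = N #> \<phi> x"
      using IA_completion_map_eq[OF \<zeta> \<xi> N(1) K \<phi>(2) x(1)] .
    also have "\<dots> = N #> x"
      using rcos_eq_mono[OF derived_is_normal[OF normal_self] FIN_normal[OF N(1)] N(2) _ x(2) IA_derived[OF \<phi>(1) x(2)]]
        \<phi>(1) x(2) by simp
    also have "\<dots> = \<xi> N"
      using completion_eq_rcos[OF \<xi> N(1), of x] completion_mono[OF \<xi> K(1) N(1) K(3)] x by auto
    finally show ?thesis .
  qed
  ultimately show ?thesis
    using IA_completion_map_auto[OF \<zeta>] by (simp add: IA_hat_def cont_aut_def)
qed

lemma IA_completion_map_group_hom:
  "IA_completion_map \<in> hom (completion (IA_group G)) (IA_hat_group G)"
proof (rule homI)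
  fix \<zeta> assume "\<zeta> \<in> carrier (completion (IA_group G))"
  then show "IA_completion_map \<zeta> \<in> carrier (IA_hat_group G)"
    using IA_completion_map_IA_hat by (simp add: IA_hat_group_def)
next
  interpret A: group "IA_group G" by (rule group_IA_group)
  fix \<zeta> \<omega> assume \<zeta>: "\<zeta> \<in> carrier (completion (IA_group G))" and \<omega>: "\<omega> \<in> carrier (completion (IA_group G))"
  have "IA_completion_map \<zeta> \<in> Bij (carrier (completion G))" "IA_completion_map \<omega> \<in> Bij (carrier (completion G))"
    using IA_completion_map_auto \<zeta> \<omega> by (auto simp: auto_def)
  then have "IA_completion_map \<zeta> \<otimes>\<^bsub>IA_hat_group G\<^esub> IA_completion_map \<omega>
      = compose (carrier (completion G)) (IA_completion_map \<zeta>) (IA_completion_map \<omega>)"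
    by (simp add: IA_hat_group_def AutoGroup_def BijGroup_def)
  also have "\<dots> = IA_completion_map (\<zeta> \<otimes>\<^bsub>completion (IA_group G)\<^esub> \<omega>)"
  proof (rule extensionalityI[of _ "carrier (completion G)"])
    show "IA_completion_map (\<zeta> \<otimes>\<^bsub>completion (IA_group G)\<^esub> \<omega>) \<in> extensional (carrier (completion G))"
      by (simp add: IA_completion_map_def)
    fix \<xi> assume "\<xi> \<in> carrier (completion G)"
    then show "compose (carrier (completion G)) (IA_completion_map \<zeta>) (IA_completion_map \<omega>) \<xi>
        = IA_completion_map (\<zeta> \<otimes>\<^bsub>completion (IA_group G)\<^esub> \<omega>) \<xi>"
      using IA_completion_map_mult[OF \<zeta> \<omega>] by (simp add: compose_eq)
  qed simp
  finally show "IA_completion_map (\<zeta> \<otimes>\<^bsub>completion (IA_group G)\<^esub> \<omega>)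
      = IA_completion_map \<zeta> \<otimes>\<^bsub>IA_hat_group G\<^esub> IA_completion_map \<omega>" by simp
qed

lemma IA_completion_map_continuous:
  assumes N: "N \<in> FIN G"
  shows "\<exists>K \<in> FIN (IA_group G). IA_completion_map ` open_nbhd (IA_group G) K \<subseteq> cong_nbhd G N"
proof (rule bexI)
  note core = IA_core_props[OF N]
  show "congruence_subgroup G (IA_core N) \<in> FIN (IA_group G)"
    using congruence_subgroup_FIN[OF core(1,2)] .
  show "IA_completion_map ` open_nbhd (IA_group G) (congruence_subgroup G (IA_core N)) \<subseteq> cong_nbhd G N"
    using IA_completion_map_trivial[OF _ _ N core] IA_completion_map_IA_hat
    by (auto simp: open_nbhd_def cong_nbhd_def)
qed

text \<open>\<open>hat_map\<close> evaluates at the preimage of \<open>N\<close>, the map here at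
  the core. The core lies in that preimage, so one representative serves both, and multiplying by
  \<open>N\<close> merges the images of the larger coset into one.\<close>

lemma IA_completion_map_eta:
  assumes \<phi>: "\<phi> \<in> IA G"
  shows "IA_completion_map (eta (IA_group G) \<phi>) = hat_map G G \<phi>"
proof (rule extensionalityI[of _ "carrier (completion G)"])
  interpret A: group "IA_group G" by (rule group_IA_group)
  interpret \<phi>: group_hom G G \<phi> using IA_group_hom[OF \<phi>] .
  have eta: "eta (IA_group G) \<phi> \<in> carrier (completion (IA_group G))" using A.eta_closed \<phi> by simp
  fix \<xi> assume \<xi>: "\<xi> \<in> carrier (completion G)"
  show "IA_completion_map (eta (IA_group G) \<phi>) \<xi> = hat_map G G \<phi> \<xi>"
  proof (rule extensionalityI[of _ "FIN G"])
    fix N assume N: "N \<in> FIN G"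
    interpret N: normal N G using N by (rule FIN_normal)
    note core = IA_core_props[OF N]
    obtain x where x: "x \<in> \<xi> (IA_core N)" "x \<in> carrier G" using completion_obtain[OF \<xi> core(1)] .
    have "\<phi> \<in> eta (IA_group G) \<phi> (congruence_subgroup G (IA_core N))"
      using A.eta_apply A.rcos_self_FIN congruence_subgroup_FIN[OF core(1,2)] \<phi> by simp
    then have "IA_completion_map (eta (IA_group G) \<phi>) \<xi> N = N #> \<phi> x"
      using IA_completion_map_eq[OF eta \<xi> N core _ x(1)] by blast
    also have "\<dots> = N <#> \<phi> ` \<xi> (\<phi> -` N \<inter> carrier G)"
    proof -
      let ?M = "\<phi> -` N \<inter> carrier G"
      have M: "?M \<in> FIN G" using \<phi>.vimage_FIN[OF N] .
      have "IA_core N \<subseteq> ?M" using \<phi> by (auto simp: IA_core_def)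
      then have "x \<in> \<xi> ?M" using completion_mono[OF \<xi> core(1) M] x by blast
      then have \<xi>M: "\<xi> ?M = ?M #> x" using completion_eq_rcos[OF \<xi> M] by blast
      have "N #> \<phi> y = N #> \<phi> x" if "y \<in> \<xi> ?M" for y
      proof -
        obtain m where "m \<in> carrier G" "\<phi> m \<in> N" "y = m \<otimes> x"
          using \<open>y \<in> \<xi> ?M\<close> unfolding \<xi>M r_coset_def by blast
        then show ?thesis using x(2) by (simp add: N.rcos_mult_left)
      qed
      then have "(\<Union>y\<in>\<xi> ?M. N #> \<phi> y) = N #> \<phi> x" using \<open>x \<in> \<xi> ?M\<close> by blast
      moreover have "N <#> \<phi> ` \<xi> ?M = (\<Union>y\<in>\<xi> ?M. N #> \<phi> y)"
        unfolding set_mult_def r_coset_def by blast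
      ultimately show ?thesis by simp
    qed
    finally show "IA_completion_map (eta (IA_group G) \<phi>) \<xi> N = hat_map G G \<phi> \<xi> N"
      using \<xi> N by (simp add: hat_map_def)
  qed (use \<xi> in \<open>simp_all add: IA_completion_map_def hat_map_def\<close>)
qed (simp_all add: IA_completion_map_def hat_map_def)

end

section \<open>Bijectivity of the natural map\<close>

context IA_free_nilpotent_group
begin

text \<open>Evaluating on the image of \<open>G\<close> reads off an automorphism modulo
  \<open>N\<close>, hence its coset of the congruence subgroup. By the congruence subgroup property
  these cosets determine the component at every \<open>K\<close>.\<close>

lemma IA_completion_map_inj: "inj_on IA_completion_map (carrier (completion (IA_group G)))"
proof (rule inj_onI)
  interpret A: group "IA_group G" by (rule group_IA_group)
  fix \<zeta> \<omega> assume \<zeta>: "\<zeta> \<in> carrier (completion (IA_group G))" and \<omega>: "\<omega> \<in> carrier (completion (IA_group G))"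
    and eq: "IA_completion_map \<zeta> = IA_completion_map \<omega>"
  show "\<zeta> = \<omega>"
  proof (rule A.completion_ext[OF \<zeta> \<omega>])
    fix K assume K: "K \<in> FIN (IA_group G)"
    obtain N where N: "N \<in> FIN G" "IA_invariant G N" "congruence_subgroup G N \<subseteq> K"
      using congruence_subgroup_property[OF K] by blast
    let ?C = "congruence_subgroup G N"
    note C = congruence_subgroup_FIN[OF N(1,2)]
    obtain \<phi> where \<phi>: "\<phi> \<in> \<zeta> ?C" "\<phi> \<in> IA G" using A.completion_obtain[OF \<zeta> C] by auto
    obtain \<psi> where \<psi>: "\<psi> \<in> \<omega> ?C" "\<psi> \<in> IA G" using A.completion_obtain[OF \<omega> C] by auto
    have "N #> \<phi> x = N #> \<psi> x" if x: "x \<in> carrier G" for x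
    proof -
      have "x \<in> eta G x N" using rcos_self_FIN[OF N(1) x] N(1) by (simp add: eta_apply)
      then show ?thesis
        using IA_completion_map_eq[OF \<zeta> eta_closed[OF x] N(1) N(1,2) order.refl \<phi>(1)]
          IA_completion_map_eq[OF \<omega> eta_closed[OF x] N(1) N(1,2) order.refl \<psi>(1)] eq by simp
    qed
    then have "\<phi> \<otimes>\<^bsub>IA_group G\<^esub> inv\<^bsub>IA_group G\<^esub> \<psi> \<in> K"
      using congruence_subgroup_diff[OF FIN_normal[OF N(1)] \<phi>(2) \<psi>(2)] N(3) by blast
    then have "K #>\<^bsub>IA_group G\<^esub> \<phi> = K #>\<^bsub>IA_group G\<^esub> \<psi>"
      using normal.rcos_eq_iff[OF FIN_normal[OF K], of \<phi> \<psi>] \<phi> \<psi> by simp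
    moreover have "\<zeta> K = K #>\<^bsub>IA_group G\<^esub> \<phi>"
      using A.completion_eq_rcos[OF \<zeta> K] A.completion_mono[OF \<zeta> C K N(3)] \<phi> by blast
    moreover have "\<omega> K = K #>\<^bsub>IA_group G\<^esub> \<psi>"
      using A.completion_eq_rcos[OF \<omega> K] A.completion_mono[OF \<omega> C K N(3)] \<psi> by blast
    ultimately show "\<zeta> K = \<omega> K" by simp
  qed
qed

text \<open>Since \<open>\<alpha>\<close> is trivial modulo \<open>N G'\<close>, it moves each generator by an element of \<open>G'\<close> modulo \<open>N\<close>,
  and freeness provides an automorphism of \<open>G\<close> doing the same.\<close>
lemma IA_hat_approximation:
  assumes \<alpha>: "\<alpha> \<in> IA_hat G" and N: "N \<in> FIN G" "IA_invariant G N"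
  shows "\<exists>\<phi> \<in> IA G. \<forall>\<xi> \<in> carrier (completion G). \<forall>x \<in> \<xi> N. \<alpha> \<xi> N = N #> \<phi> x"
proof -
  interpret CG: group "completion G" by (rule group_completion)
  interpret N: normal N G using N(1) by (rule FIN_normal)
  interpret D: normal "derived G (carrier G)" G by (rule derived_is_normal[OF normal_self])
  have \<alpha>_auto: "\<alpha> \<in> auto (completion G)" using \<alpha> by (simp add: IA_hat_def cont_aut_def)
  have \<alpha>_hom: "\<alpha> \<in> hom (completion G) (completion G)" using \<alpha>_auto by (simp add: auto_def)
  note \<alpha>_closed = auto_completion_closed[OF \<alpha>_auto]
  \<comment> \<open>The condition defining \<open>IA_hat\<close> concerns subgroups containing
    \<open>G'\<close>; this is the smallest one that also contains \<open>N\<close>.\<close>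
  let ?M = "N <#> derived G (carrier G)"
  have M_normal: "?M \<lhd> G"
  proof (rule normal_invI)
    show "subgroup ?M G" using mult_norm_subgroup[OF N.normal_axioms D.subgroup_axioms] .
    fix x h assume x: "x \<in> carrier G" and "h \<in> ?M"
    then obtain n d where nd: "n \<in> N" "d \<in> derived G (carrier G)" "h = n \<otimes> d"
      by (auto simp: set_mult_def)
    then have "x \<otimes> h \<otimes> inv x = (x \<otimes> n \<otimes> inv x) \<otimes> (x \<otimes> d \<otimes> inv x)"
      using x N.mem_carrier D.mem_carrier by (simp add: group_normalize)
    then show "x \<otimes> h \<otimes> inv x \<in> ?M"
      using N.inv_op_closed2[OF x nd(1)] D.inv_op_closed2[OF x nd(2)] unfolding set_mult_def by blast
  qed
  have NM: "N \<subseteq> ?M"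
  proof
    fix n assume n: "n \<in> N"
    have "n \<otimes> \<one> \<in> ?M" unfolding set_mult_def using n D.one_closed by blast
    then show "n \<in> ?M" using n N.mem_carrier by simp
  qed
  have DM: "derived G (carrier G) \<subseteq> ?M"
  proof
    fix d assume d: "d \<in> derived G (carrier G)"
    have "\<one> \<otimes> d \<in> ?M" unfolding set_mult_def using d N.one_closed by blast
    then show "d \<in> ?M" using d D.mem_carrier by simp
  qed
  have M: "?M \<in> FIN G" using FIN_superset[OF N(1) M_normal NM] .
  have "\<exists>d \<in> derived G (carrier G). \<alpha> (eta G s) N = N #> (d \<otimes> s)" if s: "s \<in> S" for s
  proof -
    have sc: "s \<in> carrier G" using s gens_closed by blast
    note \<alpha>s = \<alpha>_closed[OF eta_closed[OF sc]]
    obtain y where y: "y \<in> \<alpha> (eta G s) N" "y \<in> carrier G" "\<alpha> (eta G s) N = N #> y"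
      using completion_obtain[OF \<alpha>s N(1)] .
    have "\<alpha> (eta G s) ?M = eta G s ?M"
      using \<alpha> eta_closed[OF sc] M DM by (simp add: IA_hat_def)
    then have "y \<in> ?M #> s"
      using completion_mono[OF \<alpha>s N(1) M NM] y(1) M by (auto simp: eta_apply)
    \<comment> \<open>The factor \<open>n\<close> disappears modulo \<open>N\<close>, so only the
      displacement \<open>d\<close> in \<open>G'\<close> remains.\<close>
    then obtain n d where nd: "n \<in> N" "d \<in> derived G (carrier G)" "y = n \<otimes> d \<otimes> s"
      by (auto simp: set_mult_def r_coset_def)
    have "N #> y = N #> (d \<otimes> s)"
      using nd sc N.mem_carrier D.mem_carrier N.rcos_mult_left[OF nd(1), of "d \<otimes> s"] by (simp add: m_assoc)
    then show ?thesis using y nd by auto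
  qed
  then obtain d where d: "\<And>s. s \<in> S \<Longrightarrow> d s \<in> derived G (carrier G)"
    "\<And>s. s \<in> S \<Longrightarrow> \<alpha> (eta G s) N = N #> (d s \<otimes> s)" by metis
  obtain \<phi> where \<phi>: "\<phi> \<in> IA G" "\<And>s. s \<in> S \<Longrightarrow> \<phi> s = d s \<otimes> s"
    using IA_lift[of d] d(1) by blast
  have eval_hom: "(\<lambda>\<xi>. \<xi> N) \<in> hom (completion G) (G Mod N)"
    using completion_rcosets N(1) by (intro homI) (auto simp: FactGroup_def completion_mult)
  have "(\<lambda>x. \<alpha> (eta G x) N) \<in> hom G (G Mod N)"
    using Group.hom_compose[OF Group.hom_compose[OF eta_hom \<alpha>_hom] eval_hom] by (simp add: comp_def)
  moreover have "(\<lambda>x. N #> \<phi> x) \<in> hom G (G Mod N)"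
    using Group.hom_compose[OF IA_hom[OF \<phi>(1)] N.r_coset_hom_Mod] by (simp add: comp_def)
  ultimately have eta_eq: "\<alpha> (eta G x) N = N #> \<phi> x" if "x \<in> carrier G" for x
    using hom_eq_on_generate[OF N.factorgroup_is_group _ _ gens_closed,
        of "\<lambda>x. \<alpha> (eta G x) N" "\<lambda>x. N #> \<phi> x" x] d(2) \<phi>(2) that generate_gens by simp
  have "\<alpha> \<xi> N = N #> \<phi> x" if \<xi>: "\<xi> \<in> carrier (completion G)" and x: "x \<in> \<xi> N" for \<xi> x
  proof -
    obtain L where L: "L \<in> FIN G" "\<alpha> ` open_nbhd G L \<subseteq> open_nbhd G N"
      using \<alpha> N(1) by (auto simp: IA_hat_def cont_aut_def)
    note I = FIN_Int[OF L(1) N(1)]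
    obtain y where y: "y \<in> \<xi> (L \<inter> N)" "y \<in> carrier G" using completion_obtain[OF \<xi> I] .
    have yL: "\<xi> L = L #> y"
      using completion_eq_rcos[OF \<xi> L(1)] completion_mono[OF \<xi> I L(1)] y by blast
    have "y \<in> \<xi> N" using completion_mono[OF \<xi> I N(1)] y by blast
    \<comment> \<open>Density and continuity: \<open>y\<close> represents \<open>\<xi>\<close> at
      the level \<open>L\<close>, so the quotient \<open>\<chi>\<close> lies in the neighbourhood
      that \<open>\<alpha>\<close> carries into the one of \<open>N\<close>. Thus
      \<open>\<alpha> \<xi>\<close> and \<open>\<alpha> (eta G y)\<close> agree at
      \<open>N\<close>.\<close>
    define \<chi> where "\<chi> = eta G (inv y) \<otimes>\<^bsub>completion G\<^esub> \<xi>"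
    have \<chi>: "\<chi> \<in> carrier (completion G)"
      using \<xi> y(2) eta_closed completion_mult_closed by (simp add: \<chi>_def)
    have "\<chi> L = L #> (inv y \<otimes> y)"
      using yL y(2) L(1) unfolding \<chi>_def by (intro completion_mult_rcos) (auto simp: eta_apply)
    also have "\<dots> = L"
      using y(2) L(1) normal_imp_subgroup[OF FIN_normal[OF L(1)]] subgroup.subset by fastforce
    finally have "\<alpha> \<chi> N = N" using L(2) \<chi> by (auto simp: open_nbhd_def)
    then have \<alpha>\<chi>: "\<alpha> \<chi> N = N #> \<one>" by (simp add: N.subset)
    have "eta G y \<otimes>\<^bsub>completion G\<^esub> eta G (inv y) = \<one>\<^bsub>completion G\<^esub>"
    proof -
      have "eta G y \<otimes>\<^bsub>completion G\<^esub> eta G (inv y) = eta G (y \<otimes> inv y)"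
        using hom_mult[OF eta_hom, of y "inv y"] y(2) by simp
      also have "\<dots> = \<one>\<^bsub>completion G\<^esub>"
        using y(2) hom_one[OF eta_hom is_group CG.is_group] by simp
      finally show ?thesis .
    qed
    then have "\<xi> = eta G y \<otimes>\<^bsub>completion G\<^esub> \<chi>"
      unfolding \<chi>_def using \<xi> y(2) eta_closed by (simp flip: CG.m_assoc)
    then have "\<alpha> \<xi> = \<alpha> (eta G y) \<otimes>\<^bsub>completion G\<^esub> \<alpha> \<chi>"
      using hom_mult[OF \<alpha>_hom eta_closed[OF y(2)] \<chi>] by simp
    then have "\<alpha> \<xi> N = N #> (\<phi> y \<otimes> \<one>)"
      using completion_mult_rcos[of "\<alpha> (eta G y)" N _ "\<alpha> \<chi>", OF eta_eq[OF y(2)] \<alpha>\<chi>] \<phi>(1) y(2) N(1) by simp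
    also have "\<dots> = N #> \<phi> x"
      using IA_rcos_cong[OF N(2) \<phi>(1), of y x] completion_eq_rcos[OF \<xi> N(1) \<open>y \<in> \<xi> N\<close>]
        completion_eq_rcos[OF \<xi> N(1) x] completion_mem_carrier[OF \<xi> N(1) x] y(2) \<phi>(1) by simp
    finally show ?thesis .
  qed
  then show ?thesis using \<phi>(1) by blast
qed

text \<open>The approximations of \<open>\<alpha>\<close> at a level \<open>N\<close> form one class
  modulo the congruence subgroup, and they remain approximations at larger invariant levels. By the
  congruence subgroup property these classes prescribe a component at each \<open>K\<close>.\<close>

lemma IA_completion_map_surj:
  assumes \<alpha>: "\<alpha> \<in> IA_hat G"
  shows "\<exists>\<zeta> \<in> carrier (completion (IA_group G)). IA_completion_map \<zeta> = \<alpha>"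
proof -
  interpret A: group "IA_group G" by (rule group_IA_group)
  have \<alpha>_auto: "\<alpha> \<in> auto (completion G)" using \<alpha> by (simp add: IA_hat_def cont_aut_def)
  note \<alpha>_closed = auto_completion_closed[OF \<alpha>_auto]
  let ?C = "congruence_subgroup G"
  define P where "P N \<phi> \<longleftrightarrow> \<phi> \<in> IA G \<and> (\<forall>\<xi> \<in> carrier (completion G). \<forall>x \<in> \<xi> N. \<alpha> \<xi> N = N #> \<phi> x)" for N \<phi>
  have P_ex: "\<exists>\<phi>. P N \<phi>" if "N \<in> FIN G" "IA_invariant G N" for N
    using IA_hat_approximation[OF \<alpha> that] by (auto simp: P_def)
  have P_unique: "\<phi> \<otimes>\<^bsub>IA_group G\<^esub> inv\<^bsub>IA_group G\<^esub> \<psi> \<in> ?C N"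
    if N: "N \<in> FIN G" and "P N \<phi>" "P N \<psi>" for N \<phi> \<psi>
  proof -
    have "N #> \<phi> x = N #> \<psi> x" if x: "x \<in> carrier G" for x
    proof -
      have "x \<in> eta G x N" using rcos_self_FIN[OF N x] N by (simp add: eta_apply)
      then have "\<alpha> (eta G x) N = N #> \<phi> x" "\<alpha> (eta G x) N = N #> \<psi> x"
        using \<open>P N \<phi>\<close> \<open>P N \<psi>\<close> eta_closed[OF x] unfolding P_def by blast+
      then show ?thesis by simp
    qed
    then show ?thesis
      using congruence_subgroup_diff[OF FIN_normal[OF N]] \<open>P N \<phi>\<close> \<open>P N \<psi>\<close> by (simp add: P_def)
  qed
  have P_mono: "P M \<phi>" if "P N \<phi>" and N: "N \<in> FIN G" and M: "M \<in> FIN G" "IA_invariant G M" "N \<subseteq> M" for N M \<phi>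
    unfolding P_def
  proof (intro conjI ballI)
    show \<phi>: "\<phi> \<in> IA G" using \<open>P N \<phi>\<close> by (simp add: P_def)
    fix \<xi> x assume \<xi>: "\<xi> \<in> carrier (completion G)" and x: "x \<in> \<xi> M"
    obtain y where y: "y \<in> \<xi> N" "y \<in> carrier G" using completion_obtain[OF \<xi> N] .
    have "\<phi> y \<in> \<alpha> \<xi> N"
      using \<open>P N \<phi>\<close> \<xi> y rcos_self_FIN[OF N, of "\<phi> y"] \<phi> by (simp add: P_def)
    then have "\<alpha> \<xi> M = M #> \<phi> y"
      using completion_mono[OF \<alpha>_closed[OF \<xi>] N M(1,3)] completion_eq_rcos[OF \<alpha>_closed[OF \<xi>] M(1)] by blast
    moreover have "y \<in> \<xi> M" using completion_mono[OF \<xi> N M(1,3)] y by blast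
    ultimately show "\<alpha> \<xi> M = M #> \<phi> x"
      using IA_rcos_cong[OF M(2) \<phi>, of y x] completion_eq_rcos[OF \<xi> M(1), of y]
        completion_eq_rcos[OF \<xi> M(1) x] completion_mem_carrier[OF \<xi> M(1) x] y(2) by simp
  qed
  \<comment> \<open>The choice is made separately for each \<open>K\<close>, without a coherent
    family of automorphisms; compatibility follows from uniqueness of the coset.\<close>
  define Q where "Q K C \<longleftrightarrow> (\<exists>N \<phi>. N \<in> FIN G \<and> IA_invariant G N \<and> ?C N \<subseteq> K \<and> P N \<phi> \<and> C = K #>\<^bsub>IA_group G\<^esub> \<phi>)" for K C
  define \<zeta> where "\<zeta> = (\<lambda>K \<in> FIN (IA_group G). SOME C. Q K C)"
  have \<zeta>_eq: "\<zeta> K = K #>\<^bsub>IA_group G\<^esub> \<phi>"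
    if K: "K \<in> FIN (IA_group G)" and N: "N \<in> FIN G" "IA_invariant G N" "?C N \<subseteq> K" and \<phi>: "P N \<phi>" for K N \<phi>
  proof -
    have "Q K (K #>\<^bsub>IA_group G\<^esub> \<phi>)" using N \<phi> by (auto simp: Q_def)
    then have "Q K (\<zeta> K)" using K by (simp add: \<zeta>_def someI)
    then obtain M \<psi> where M: "M \<in> FIN G" "IA_invariant G M" "?C M \<subseteq> K" and \<psi>: "P M \<psi>"
      and eq: "\<zeta> K = K #>\<^bsub>IA_group G\<^esub> \<psi>" by (auto simp: Q_def)
    note I = FIN_Int[OF N(1) M(1)] IA_invariant_Int[OF N(2) M(2)]
    \<comment> \<open>An approximation at the common refinement approximates at both levels, which
      links the two cosets.\<close>
    obtain \<theta> where \<theta>: "P (N \<inter> M) \<theta>" using P_ex[OF I] by blast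
    have cos: "K #>\<^bsub>IA_group G\<^esub> \<phi> = K #>\<^bsub>IA_group G\<^esub> \<theta>"
      if L: "L \<in> FIN G" "IA_invariant G L" "?C L \<subseteq> K" "N \<inter> M \<subseteq> L" and \<phi>: "P L \<phi>" for L \<phi>
    proof -
      have "P L \<theta>" using P_mono[OF \<theta> I(1) L(1,2,4)] .
      then have "\<phi> \<otimes>\<^bsub>IA_group G\<^esub> inv\<^bsub>IA_group G\<^esub> \<theta> \<in> K" using P_unique[OF L(1) \<phi>] L(3) by blast
      then show ?thesis
        using normal.rcos_eq_iff[OF FIN_normal[OF K], of \<phi> \<theta>] \<phi> \<theta> by (simp add: P_def)
    qed
    show ?thesis using cos[OF N _ \<phi>] cos[OF M _ \<psi>] eq by simp
  qed
  have \<zeta>: "\<zeta> \<in> carrier (completion (IA_group G))"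
  proof (rule A.completion_I)
    have *: "\<exists>\<phi> \<in> carrier (IA_group G). \<zeta> K = K #>\<^bsub>IA_group G\<^esub> \<phi> \<and> \<zeta> L = L #>\<^bsub>IA_group G\<^esub> \<phi>"
      if KL: "K \<in> FIN (IA_group G)" "L \<in> FIN (IA_group G)" "K \<subseteq> L" for K L
    proof -
      obtain N where N: "N \<in> FIN G" "IA_invariant G N" "?C N \<subseteq> K"
        using congruence_subgroup_property[OF KL(1)] by blast
      obtain \<phi> where \<phi>: "P N \<phi>" using P_ex[OF N(1,2)] by blast
      have "?C N \<subseteq> L" using N KL by blast
      then show ?thesis
        using \<zeta>_eq[OF KL(1) N \<phi>] \<zeta>_eq[OF KL(2) N(1,2) _ \<phi>] \<phi> by (intro bexI[of _ \<phi>]) (auto simp: P_def)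
    qed
    show "\<exists>\<phi> \<in> carrier (IA_group G). \<zeta> K = K #>\<^bsub>IA_group G\<^esub> \<phi> \<and> \<zeta> L = L #>\<^bsub>IA_group G\<^esub> \<phi>"
      if "K \<in> FIN (IA_group G)" "L \<in> FIN (IA_group G)" "K \<subseteq> L" for K L using *[OF that] .
    show "\<exists>\<phi> \<in> carrier (IA_group G). \<zeta> K = K #>\<^bsub>IA_group G\<^esub> \<phi>" if "K \<in> FIN (IA_group G)" for K
      using *[OF that that] by blast
  qed (simp add: \<zeta>_def)
  have "IA_completion_map \<zeta> = \<alpha>"
  proof (rule extensionalityI[of _ "carrier (completion G)"])
    show "IA_completion_map \<zeta> \<in> extensional (carrier (completion G))" by (simp add: IA_completion_map_def)
    show "\<alpha> \<in> extensional (carrier (completion G))" using \<alpha>_auto by (simp add: auto_def Bij_def)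
    fix \<xi> assume \<xi>: "\<xi> \<in> carrier (completion G)"
    show "IA_completion_map \<zeta> \<xi> = \<alpha> \<xi>"
    proof (rule completion_ext[OF IA_completion_map_closed[OF \<zeta> \<xi>] \<alpha>_closed[OF \<xi>]])
      fix N assume N: "N \<in> FIN G"
      note core = IA_core_props[OF N]
      note C = congruence_subgroup_FIN[OF core(1,2)]
      obtain \<phi> where \<phi>: "P (IA_core N) \<phi>" using P_ex[OF core(1,2)] by blast
      have IA: "\<phi> \<in> IA G" using \<phi> by (simp add: P_def)
      obtain x where x: "x \<in> \<xi> (IA_core N)" "x \<in> carrier G" using completion_obtain[OF \<xi> core(1)] .
      have "\<phi> \<in> \<zeta> (?C (IA_core N))"
        using \<zeta>_eq[OF C core(1,2) order.refl \<phi>] A.rcos_self_FIN[OF C, of \<phi>] IA by simp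
      then have "IA_completion_map \<zeta> \<xi> N = N #> \<phi> x"
        using IA_completion_map_eq[OF \<zeta> \<xi> N core _ x(1)] by blast
      moreover have "\<phi> x \<in> \<alpha> \<xi> (IA_core N)"
        using \<phi> \<xi> x rcos_self_FIN[OF core(1), of "\<phi> x"] IA by (simp add: P_def)
      then have "\<alpha> \<xi> N = N #> \<phi> x"
        using completion_mono[OF \<alpha>_closed[OF \<xi>] core(1) N core(3)]
          completion_eq_rcos[OF \<alpha>_closed[OF \<xi>] N] by blast
      ultimately show "IA_completion_map \<zeta> \<xi> N = \<alpha> \<xi> N" by simp
    qed
  qed
  then show ?thesis using \<zeta> by blast
qed

lemma natural_map_iso: "natural_map_is_iso G"
proof -
  have "carrier (IA_hat_group G) = IA_hat G" by (simp add: IA_hat_group_def)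
  then have "bij_betw IA_completion_map (carrier (completion (IA_group G))) (carrier (IA_hat_group G))"
    using IA_completion_map_inj IA_completion_map_surj IA_completion_map_IA_hat
    unfolding bij_betw_def by blast
  then have "IA_completion_map \<in> iso (completion (IA_group G)) (IA_hat_group G)"
    using IA_completion_map_group_hom by (simp add: iso_def)
  then show ?thesis
    unfolding natural_map_is_iso_def
    using IA_completion_map_continuous IA_completion_map_eta by blast
qed

end

section \<open>Free groups and free nilpotent groups\<close>

definition inv_letter :: "nat \<times> bool \<Rightarrow> nat \<times> bool" where
  "inv_letter x = (fst x, \<not> snd x)"

lemma inv_letter_inv_letter [simp]: "inv_letter (inv_letter x) = x"
  by (simp add: inv_letter_def)

lemma fst_inv_letter [simp]: "fst (inv_letter x) = fst x"
  by (simp add: inv_letter_def)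

text \<open>Cancellation as an equation, so that a case split substitutes the letter instead of
  carrying conditions on its components.\<close>

lemma red_cons_Cons: "red_cons x (y # ys) = (if y = inv_letter x then ys else x # y # ys)"
  by (cases x; cases y) (auto simp: inv_letter_def)

declare red_cons.simps(2) [simp del]

lemma reduced_Nil [simp]: "reduced []"
  by (simp add: reduced_def)

lemma reduced_single [simp]: "reduced [x]"
  by (simp add: reduced_def)

lemma reduced_Cons_Cons: "reduced (x # y # ys) \<longleftrightarrow> y \<noteq> inv_letter x \<and> reduced (y # ys)"
proof -
  have "reduced (x # y # ys) \<longleftrightarrow> \<not> (fst x = fst y \<and> snd x \<noteq> snd y) \<and> reduced (y # ys)"
    unfolding reduced_def by (auto simp: nth_Cons split: nat.splits)
  then show ?thesis by (cases x; cases y) (auto simp: inv_letter_def)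
qed

lemma reduced_ConsD: "reduced (x # ws) \<Longrightarrow> reduced ws"
  by (cases ws) (auto simp: reduced_Cons_Cons)

lemma red_cons_reduced: "reduced ws \<Longrightarrow> reduced (red_cons x ws)"
  by (cases ws) (auto simp: red_cons_Cons reduced_Cons_Cons dest: reduced_ConsD)

lemma red_cons_eq_Cons: "reduced (x # ws) \<Longrightarrow> red_cons x ws = x # ws"
  by (cases ws) (auto simp: red_cons_Cons reduced_Cons_Cons)

text \<open>The core of van der Waerden's argument: letters act on reduced words by permutations,
  and a word acts in the same way as its reduction. Associativity of the reduced product is then
  composition of actions.\<close>

lemma red_cons_inv_letter: "reduced ws \<Longrightarrow> red_cons x (red_cons (inv_letter x) ws) = ws"
  by (cases ws) (auto simp: red_cons_Cons red_cons_eq_Cons)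

lemma set_red_cons: "set (red_cons x ws) \<subseteq> insert x (set ws)"
  by (cases ws) (auto simp: red_cons_Cons)

lemma foldr_red_cons_reduced: "reduced v \<Longrightarrow> reduced (foldr red_cons ws v)"
  by (induction ws) (auto intro: red_cons_reduced)

lemma set_foldr_red_cons: "set (foldr red_cons ws v) \<subseteq> set ws \<union> set v"
  by (induction ws) (use set_red_cons in fastforce)+

lemma foldr_red_cons_red_cons:
  assumes "reduced v"
  shows "foldr red_cons (red_cons x ws) v = red_cons x (foldr red_cons ws v)"
proof (cases ws)
  case (Cons y ys)
  then show ?thesis
    using red_cons_inv_letter[OF foldr_red_cons_reduced[OF assms]] by (auto simp: red_cons_Cons)
qed simp

lemma foldr_red_cons_reduce:
  "reduced v \<Longrightarrow> foldr red_cons (reduce ws) v = foldr red_cons ws v"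
  by (induction ws) (auto simp: reduce_def foldr_red_cons_red_cons)

lemma reduce_reduced: "reduced ws \<Longrightarrow> reduce ws = ws"
proof (induction ws)
  case (Cons x ws)
  then show ?case using reduced_ConsD[OF Cons.prems] red_cons_eq_Cons by (simp add: reduce_def)
qed (simp add: reduce_def)

lemma reduce_append: "reduced ys \<Longrightarrow> reduce (xs @ ys) = foldr red_cons xs ys"
  using reduce_reduced by (simp add: reduce_def)

lemma foldr_red_cons_inverse:
  "reduced ws \<Longrightarrow> foldr red_cons (rev (map inv_letter ws)) ws = []"
proof (induction ws)
  case (Cons x ws)
  then show ?case using reduced_ConsD by (auto simp: red_cons_Cons)
qed simp

lemma carrier_free_group: "carrier (free_group n) = {ws. reduced ws \<and> fst ` set ws \<subseteq> {..<n}}"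
  by (simp add: free_group_def)

lemma one_free_group: "\<one>\<^bsub>free_group n\<^esub> = []"
  by (simp add: free_group_def)

lemma mult_free_group:
  "ys \<in> carrier (free_group n) \<Longrightarrow> xs \<otimes>\<^bsub>free_group n\<^esub> ys = foldr red_cons xs ys"
  by (simp add: free_group_def reduce_append)

lemma foldr_red_cons_closed:
  assumes "fst ` set xs \<subseteq> {..<n}" "ys \<in> carrier (free_group n)"
  shows "foldr red_cons xs ys \<in> carrier (free_group n)"
  using assms set_foldr_red_cons[of xs ys] foldr_red_cons_reduced
  by (force simp: carrier_free_group)

lemma group_free_group: "group (free_group n)"
proof (rule groupI)
  show one: "\<one>\<^bsub>free_group n\<^esub> \<in> carrier (free_group n)"
    by (simp add: carrier_free_group one_free_group)
  show closed: "xs \<otimes>\<^bsub>free_group n\<^esub> ys \<in> carrier (free_group n)"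
    if "xs \<in> carrier (free_group n)" "ys \<in> carrier (free_group n)" for xs ys
    using foldr_red_cons_closed[of xs n ys] that by (simp add: mult_free_group carrier_free_group)
  show "\<one>\<^bsub>free_group n\<^esub> \<otimes>\<^bsub>free_group n\<^esub> xs = xs" if "xs \<in> carrier (free_group n)" for xs
    using that by (simp add: mult_free_group one_free_group)
  show "xs \<otimes>\<^bsub>free_group n\<^esub> ys \<otimes>\<^bsub>free_group n\<^esub> zs = xs \<otimes>\<^bsub>free_group n\<^esub> (ys \<otimes>\<^bsub>free_group n\<^esub> zs)"
    if "xs \<in> carrier (free_group n)" "ys \<in> carrier (free_group n)" "zs \<in> carrier (free_group n)" for xs ys zs
  proof -
    have red: "reduced ys" "reduced zs" using that by (auto simp: carrier_free_group)
    have "xs \<otimes>\<^bsub>free_group n\<^esub> ys \<otimes>\<^bsub>free_group n\<^esub> zs = foldr red_cons (reduce (xs @ ys)) zs"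
      using that red by (simp add: mult_free_group reduce_append)
    also have "\<dots> = foldr red_cons xs (foldr red_cons ys zs)"
      using red by (simp add: foldr_red_cons_reduce)
    also have "\<dots> = xs \<otimes>\<^bsub>free_group n\<^esub> (ys \<otimes>\<^bsub>free_group n\<^esub> zs)"
      using closed[OF that(2,3)] that by (simp add: mult_free_group)
    finally show ?thesis .
  qed
  show "\<exists>ys\<in>carrier (free_group n). ys \<otimes>\<^bsub>free_group n\<^esub> xs = \<one>\<^bsub>free_group n\<^esub>"
    if xs: "xs \<in> carrier (free_group n)" for xs
  proof
    let ?ys = "reduce (rev (map inv_letter xs))"
    have "fst ` set (rev (map inv_letter xs)) \<subseteq> {..<n}"
      using xs by (auto simp: carrier_free_group)
    then show "?ys \<in> carrier (free_group n)"
      using foldr_red_cons_closed[OF _ one] by (simp add: reduce_def one_free_group)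
    have "reduced xs" using xs by (simp add: carrier_free_group)
    then show "?ys \<otimes>\<^bsub>free_group n\<^esub> xs = \<one>\<^bsub>free_group n\<^esub>"
      using foldr_red_cons_reduce foldr_red_cons_inverse xs by (simp add: mult_free_group one_free_group)
  qed
qed

section \<open>Generators and universal property, and passage to the nilpotent quotient\<close>

definition free_gens :: "nat \<Rightarrow> (nat \<times> bool) list set" where
  "free_gens n = (\<lambda>i. [(i, True)]) ` {..<n}"

lemma free_gens_closed: "free_gens n \<subseteq> carrier (free_group n)"
  by (auto simp: free_gens_def carrier_free_group)

lemma generate_free_gens: "generate (free_group n) (free_gens n) = carrier (free_group n)"
proof
  interpret F: group "free_group n" by (rule group_free_group)
  show "generate (free_group n) (free_gens n) \<subseteq> carrier (free_group n)"
    using F.generate_incl[OF free_gens_closed] .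
  have letter: "[x] \<in> generate (free_group n) (free_gens n)" if "fst x < n" for x
  proof -
    obtain i b where x: "x = (i, b)" "i < n" using \<open>fst x < n\<close> by (cases x) auto
    have gen: "[(i, True)] \<in> free_gens n" using x by (auto simp: free_gens_def)
    show ?thesis
    proof (cases b)
      case True
      then show ?thesis using gen x generate.incl by metis
    next
      case False
      have "inv\<^bsub>free_group n\<^esub> [(i, True)] = [(i, False)]"
        using x by (intro F.inv_equality)
          (auto simp: carrier_free_group mult_free_group one_free_group red_cons_Cons inv_letter_def)
      then show ?thesis using generate.inv[OF gen, of "free_group n"] False x by simp
    qed
  qed
  show "carrier (free_group n) \<subseteq> generate (free_group n) (free_gens n)"
  proof
    fix ws assume "ws \<in> carrier (free_group n)"
    then show "ws \<in> generate (free_group n) (free_gens n)"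
    proof (induction ws)
      case Nil
      then show ?case using generate.one[of "free_group n"] by (simp add: one_free_group)
    next
      case (Cons x ws)
      have ws: "ws \<in> carrier (free_group n)" and x: "fst x < n"
        using Cons.prems by (auto simp: carrier_free_group dest: reduced_ConsD)
      have "[x] \<otimes>\<^bsub>free_group n\<^esub> ws = x # ws"
        using Cons.prems ws by (simp add: mult_free_group red_cons_eq_Cons carrier_free_group)
      then show ?case using generate.eng[OF letter[OF x] Cons.IH[OF ws]] by simp
    qed
  qed
qed

text \<open>Letters with an index outside \<open>{..<n}\<close> do not occur in the free group; they are sent to
  \<open>\<one>\<close> only to make the evaluation total.\<close>
lemma free_group_universal:
  assumes "group H" and h: "\<And>i. i < n \<Longrightarrow> h i \<in> carrier H"
  shows "\<exists>f \<in> hom (free_group n) H. \<forall>i < n. f [(i, True)] = h i"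
proof -
  interpret H: group H by fact
  define l where "l x = (if fst x < n then if snd x then h (fst x) else inv\<^bsub>H\<^esub> h (fst x) else \<one>\<^bsub>H\<^esub>)" for x
  define f where "f ws = foldr (\<lambda>x a. l x \<otimes>\<^bsub>H\<^esub> a) ws \<one>\<^bsub>H\<^esub>" for ws
  have l: "l x \<in> carrier H" for x using h by (simp add: l_def)
  have l_inv: "l x \<otimes>\<^bsub>H\<^esub> l (inv_letter x) = \<one>\<^bsub>H\<^esub>" for x
    using h by (auto simp: l_def inv_letter_def)
  have f: "f ws \<in> carrier H" for ws by (induction ws) (auto simp: f_def l)
  have f_Cons: "f (x # ws) = l x \<otimes>\<^bsub>H\<^esub> f ws" for x ws by (simp add: f_def)
  \<comment> \<open>A single cancellation leaves the value unchanged, which makes evaluation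
    multiplicative for the reduced product.\<close>
  have f_red: "f (red_cons x ws) = l x \<otimes>\<^bsub>H\<^esub> f ws" for x ws
  proof (cases ws)
    case (Cons y ys)
    have "l x \<otimes>\<^bsub>H\<^esub> (l (inv_letter x) \<otimes>\<^bsub>H\<^esub> f ys) = f ys"
      using l f l_inv by (simp flip: H.m_assoc)
    then show ?thesis using Cons by (simp add: red_cons_Cons f_Cons)
  qed (simp add: f_def)
  have "f (foldr red_cons xs ys) = f xs \<otimes>\<^bsub>H\<^esub> f ys" for xs ys
  proof (induction xs)
    case Nil
    have "f [] = \<one>\<^bsub>H\<^esub>" by (simp add: f_def)
    then show ?case using f by simp
  qed (simp add: f_red f_Cons l f H.m_assoc)
  then have "f \<in> hom (free_group n) H"
    using f by (intro homI) (simp_all add: mult_free_group)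
  moreover have "f [(i, True)] = h i" if "i < n" for i
    using h[OF that] that by (simp add: f_def l_def)
  ultimately show ?thesis by blast
qed

text \<open>Displacements are realized on the free group, descend to the quotient, and give an
  automorphism by nilpotency. The index is \<open>c - 1\<close> because \<open>lcs\<close> counts
  from 1 and \<open>lcs_aux\<close> from 0.\<close>

lemma IA_free_nilpotent_group_Psi:
  "\<exists>S. IA_free_nilpotent_group (Psi n c) S (c - 1)"
proof -
  interpret F: group "free_group n" by (rule group_free_group)
  let ?L = "lcs_aux (free_group n) (c - 1)"
  interpret L: normal ?L "free_group n" by (rule F.lcs_aux_normal)
  define P where "P = Psi n c"
  have P: "P = free_group n Mod ?L" by (simp add: P_def Psi_def lcs_def)
  define p where "p x = ?L #>\<^bsub>free_group n\<^esub> x" for x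
  interpret p: group_hom "free_group n" P p
    using L.rcos_group_hom unfolding P p_def .
  interpret D: normal "derived P (carrier P)" P
    by (rule p.H.derived_is_normal[OF p.H.normal_self])
  have surj: "p ` carrier (free_group n) = carrier P"
    by (simp add: P p_def carrier_FactGroup)
  have L_ker: "p x = \<one>\<^bsub>P\<^esub>" if "x \<in> ?L" for x
    using that L.rcos_const[OF F.is_group] by (simp add: P p_def)
  have nilp: "lcs_aux P (c - 1) = {\<one>\<^bsub>P\<^esub>}"
    using p.lcs_aux_image[OF surj, of "c - 1"] L_ker L.one_closed by force
  define S where "S = p ` free_gens n"
  have S: "finite S" "S \<subseteq> carrier P" "generate P S = carrier P"
  proof -
    show "finite S" by (simp add: S_def free_gens_def)
    show "S \<subseteq> carrier P" using surj free_gens_closed[of n] unfolding S_def by blast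
    show "generate P S = carrier P"
      using p.generate_img[OF free_gens_closed] surj by (simp add: S_def generate_free_gens)
  qed
  have "\<exists>\<phi> \<in> IA P. \<forall>s \<in> S. \<phi> s = d s \<otimes>\<^bsub>P\<^esub> s"
    if d: "\<And>s. s \<in> S \<Longrightarrow> d s \<in> derived P (carrier P)" for d
  proof -
    \<comment> \<open>The displacement depends on the class of the generator, so generators that
      coincide in \<open>P\<close>, for instance when \<open>P\<close> is trivial, receive the same
      image.\<close>
    let ?h = "\<lambda>i. d (p [(i, True)]) \<otimes>\<^bsub>P\<^esub> p [(i, True)]"
    have gen: "p [(i, True)] \<in> S" if "i < n" for i using that by (auto simp: S_def free_gens_def)
    have "?h i \<in> carrier P" if "i < n" for i
      using d[OF gen[OF that]] gen[OF that] S(2) D.mem_carrier by blast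
    then obtain f where f: "f \<in> hom (free_group n) P" "\<And>i. i < n \<Longrightarrow> f [(i, True)] = ?h i"
      using free_group_universal[OF p.H.is_group, of n ?h] by blast
    interpret f: group_hom "free_group n" P f
      using f(1) by (simp add: group_hom_def group_hom_axioms_def F.is_group p.H.is_group)
    \<comment> \<open>Any homomorphism into \<open>P\<close> sends this term into the corresponding
      term of \<open>P\<close>, which is trivial.\<close>
    have "?L \<subseteq> kernel (free_group n) P f"
      using f.lcs_aux_image_subset[of "c - 1"] nilp by (auto simp: kernel_def)
    then obtain g where g: "g \<in> hom P P" "\<And>x. x \<in> carrier (free_group n) \<Longrightarrow> g (p x) = f x"
      using f.FactGroup_universal_kernel[OF L.normal_axioms] unfolding P p_def by blast
    \<comment> \<open>Members of \<open>auto\<close> are extensional, which \<open>g\<close> need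
      not be.\<close>
    define \<phi> where "\<phi> = restrict g (carrier P)"
    have \<phi>_hom: "\<phi> \<in> hom P P"
      using g(1) by (auto simp: \<phi>_def hom_def)
    have \<phi>_gen: "\<phi> s = d s \<otimes>\<^bsub>P\<^esub> s" if s: "s \<in> S" for s
    proof -
      obtain i where i: "i < n" "s = p [(i, True)]" using s by (auto simp: S_def free_gens_def)
      moreover have "[(i, True)] \<in> carrier (free_group n)"
        using i by (auto simp: carrier_free_group)
      ultimately show ?thesis using g(2) f(2) s S(2) by (auto simp: \<phi>_def)
    qed
    have triv: "derived P (carrier P) #>\<^bsub>P\<^esub> \<phi> x = derived P (carrier P) #>\<^bsub>P\<^esub> x"
      if x: "x \<in> carrier P" for x
    proof (rule p.H.hom_eq_on_generate[OF D.factorgroup_is_group _ D.r_coset_hom_Mod S(2)])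
      show "(\<lambda>x. derived P (carrier P) #>\<^bsub>P\<^esub> \<phi> x) \<in> hom P (P Mod derived P (carrier P))"
        using Group.hom_compose[OF \<phi>_hom D.r_coset_hom_Mod] by (simp add: comp_def)
      show "x \<in> generate P S" using x S(3) by simp
      fix s assume s: "s \<in> S"
      then show "derived P (carrier P) #>\<^bsub>P\<^esub> \<phi> s = derived P (carrier P) #>\<^bsub>P\<^esub> s"
        using \<phi>_gen d S(2) D.rcos_mult_left by auto
    qed
    have "bij_betw \<phi> (carrier P) (carrier P)"
      using p.H.endomorphism_bij_of_nilpotent[OF nilp \<phi>_hom triv] .
    then have "\<phi> \<in> IA P"
      using \<phi>_hom triv by (simp add: IA_def auto_def Bij_def) (simp add: \<phi>_def)
    then show ?thesis using \<phi>_gen by blast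
  qed
  then have "IA_free_nilpotent_group P S (c - 1)"
    using S nilp
    by (intro IA_free_nilpotent_group.intro finitely_generated_group.intro p.H.is_group
        finitely_generated_group_axioms.intro IA_free_nilpotent_group_axioms.intro) auto
  then show ?thesis unfolding P_def by blast
qed

theorem theorem4p1:
  fixes n c :: nat
  assumes "n \<ge> 1" and "c \<ge> 1"
  shows "natural_map_is_iso (Psi n c)"
  using IA_free_nilpotent_group_Psi[of n c] IA_free_nilpotent_group.natural_map_iso by blast

end
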